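(* Let $k$ be any field, $A$ a finitely generated commutative $k$-algebra, $X_k=\operatorname{Pts}_k(A)$, $A_k:=\mathcal O_{X_k}(X_k)$, and let $\rho:A\rightarrow A_k$ be the natural homomorphism. Then: (i) $\max(A_k)=\operatorname{Pts}_k(A_k)$, that is, every maximal ideal of $A_k$ is the kernel $\mathfrak m_p$ of a (unique) $k$-algebra homomorphism $p:A_k\to k$; (ii) $(A_k)_{\mathfrak m_p}\simeq A_{\mathfrak m_{\rho(p)}}$ for every $p\in\operatorname{Pts}_k(A_k)$, where $\rho(p)=p\circ\rho\in\operatorname{Pts}_k(A)$; (iii) $\Gamma(\mathcal O_{X_k})=\mathcal O_{X_k}(X_k)\simeq A_k$.
   Context: For a $k$-algebra $A$, $\operatorname{Pts}_k(A)=\operatorname{Hom}_k(A,k)$ is the set of $k$-algebra homomorphisms $p:A\to k$; it is in bijection with the maximal ideals $\mathfrak m\subset A$ with $A/\mathfrak m\simeq k$ via $p\mapsto\mathfrak m_p=\ker p$. For $f\in A$ write $f(p)=p(f)$. The topology on $\operatorname{Pts}_k(A)$ has basic open sets $D(f)=\{p\mid f(p)\neq0\}$, $f\in A$. $\max(B)$ denotes the set of maximal ideals of $B$. The sheaf $\mathcal O_{X_k}$ on $X_k=\operatorname{Pts}_k(A)$: for $U\subseteq X_k$ open let $\rho(U):A\to\prod_{p\in U}A_{\mathfrak m_p}$ be the natural map into the product of localizations, let $S(U)=\{s^{-1}\in\prod_{p\in U}A_{\mathfrak m_p}\mid s=\rho(U)(a)\text{ is a unit, for some }a\in A\}$, and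 let $\mathcal O_{X_k}(U)$ be the subalgebra of $\prod_{p\in U}A_{\mathfrak m_p}$ generated by $\operatorname{im}\rho(U)$ and $S(U)$. $\Gamma(\mathcal O_{X_k})$ denotes global sections. *)

theory Defs
  imports "HOL-Algebra.Module" "HOL-Algebra.Subrings" "HOL-Algebra.QuotRing"
    "HOL-Analysis.Abstract_Topology"
begin

section \<open>Homomorphisms of algebras and finite generation\<close>

definition alg_hom ::
  "('k, 'm) ring_scheme \<Rightarrow> ('k, 'a, 'n) module_scheme \<Rightarrow> ('k, 'b, 'o) module_scheme \<Rightarrow> ('a \<Rightarrow> 'b) set"
  where "alg_hom k A B =
    {h \<in> ring_hom A B. \<forall>c \<in> carrier k. \<forall>x \<in> carrier A. h (c \<odot>\<^bsub>A\<^esub> x) = c \<odot>\<^bsub>B\<^esub> h x}"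

definition alg_isomorphic ::
  "('k, 'm) ring_scheme \<Rightarrow> ('k, 'a, 'n) module_scheme \<Rightarrow> ('k, 'b, 'o) module_scheme \<Rightarrow> bool"
  where "alg_isomorphic k A B \<longleftrightarrow> (\<exists>h \<in> alg_hom k A B. bij_betw h (carrier A) (carrier B))"

definition base_alg :: "('k, 'm) ring_scheme \<Rightarrow> ('k, 'k) module"
  where "base_alg k =
    \<lparr>carrier = carrier k, mult = mult k, one = one k, zero = zero k, add = add k, smult = mult k\<rparr>"

definition subalg :: "('k, 'm) ring_scheme \<Rightarrow> ('k, 'a, 'n) module_scheme \<Rightarrow> 'a set \<Rightarrow> bool"
  where "subalg k A B \<longleftrightarrow> subring B A \<and> (\<forall>c \<in> carrier k. \<forall>x \<in> B. c \<odot>\<^bsub>A\<^esub> x \<in> B)"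

definition generated_subalg :: "('k, 'm) ring_scheme \<Rightarrow> ('k, 'a, 'n) module_scheme \<Rightarrow> 'a set \<Rightarrow> 'a set"
  where "generated_subalg k A G = \<Inter> {B. subalg k A B \<and> G \<subseteq> B}"

definition finitely_generated_alg :: "('k, 'm) ring_scheme \<Rightarrow> ('k, 'a, 'n) module_scheme \<Rightarrow> bool"
  where "finitely_generated_alg k A \<longleftrightarrow>
    (\<exists>G. finite G \<and> G \<subseteq> carrier A \<and> generated_subalg k A G = carrier A)"


section \<open>Points and maximal ideals\<close>

text \<open>Homomorphisms are only determined on the carrier; restricting to extensional functions makes
  equality of points the equality of homomorphisms.\<close>

definition Pts :: "('k, 'm) ring_scheme \<Rightarrow> ('k, 'a, 'n) module_scheme \<Rightarrow> ('a \<Rightarrow> 'k) set"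
  where "Pts k A = alg_hom k A (base_alg k) \<inter> extensional (carrier A)"

definition pt_ideal :: "('k, 'm) ring_scheme \<Rightarrow> ('k, 'a, 'n) module_scheme \<Rightarrow> ('a \<Rightarrow> 'k) \<Rightarrow> 'a set"
  where "pt_ideal k A p = a_kernel A (base_alg k) p"

definition Max_ideals :: "('a, 'm) ring_scheme \<Rightarrow> 'a set set"
  where "Max_ideals B = {I. maximalideal I B}"

definition basic_open :: "('k, 'm) ring_scheme \<Rightarrow> ('k, 'a, 'n) module_scheme \<Rightarrow> 'a \<Rightarrow> ('a \<Rightarrow> 'k) set"
  where "basic_open k A f = {p \<in> Pts k A. p f \<noteq> \<zero>\<^bsub>k\<^esub>}"

definition Pts_topology :: "('k, 'm) ring_scheme \<Rightarrow> ('k, 'a, 'n) module_scheme \<Rightarrow> ('a \<Rightarrow> 'k) topology"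
  where "Pts_topology k A =
    topology (arbitrary union_of (\<lambda>U. \<exists>f \<in> carrier A. U = basic_open k A f))"


section \<open>Localization\<close>

text \<open>Fractions with numerator in \<open>A\<close> and denominator in the multiplicative set \<open>S\<close>, as classes of
  pairs.  An operation is the union of the classes obtained from all choices of representatives;
  for a multiplicative \<open>S\<close> these classes all coincide.\<close>

definition frac_rel :: "('a, 'm) ring_scheme \<Rightarrow> 'a set \<Rightarrow> (('a \<times> 'a) \<times> ('a \<times> 'a)) set"
  where "frac_rel A S = {((a, s), (b, t)). a \<in> carrier A \<and> s \<in> S \<and> b \<in> carrier A \<and> t \<in> S \<and>
    (\<exists>u \<in> S. u \<otimes>\<^bsub>A\<^esub> (a \<otimes>\<^bsub>A\<^esub> t) = u \<otimes>\<^bsub>A\<^esub> (b \<otimes>\<^bsub>A\<^esub> s))}"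

definition fraction :: "('a, 'm) ring_scheme \<Rightarrow> 'a set \<Rightarrow> 'a \<Rightarrow> 'a \<Rightarrow> ('a \<times> 'a) set"
  where "fraction A S a s = frac_rel A S `` {(a, s)}"

definition localization :: "('k, 'a, 'n) module_scheme \<Rightarrow> 'a set \<Rightarrow> ('k, ('a \<times> 'a) set) module"
  where "localization A S =
    \<lparr>carrier = (carrier A \<times> S) // frac_rel A S,
     mult = (\<lambda>X Y. \<Union>(a, s) \<in> X. \<Union>(b, t) \<in> Y. fraction A S (a \<otimes>\<^bsub>A\<^esub> b) (s \<otimes>\<^bsub>A\<^esub> t)),
     one = fraction A S \<one>\<^bsub>A\<^esub> \<one>\<^bsub>A\<^esub>,
     zero = fraction A S \<zero>\<^bsub>A\<^esub> \<one>\<^bsub>A\<^esub>,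
     add = (\<lambda>X Y. \<Union>(a, s) \<in> X. \<Union>(b, t) \<in> Y.
       fraction A S (a \<otimes>\<^bsub>A\<^esub> t \<oplus>\<^bsub>A\<^esub> b \<otimes>\<^bsub>A\<^esub> s) (s \<otimes>\<^bsub>A\<^esub> t)),
     smult = (\<lambda>c X. \<Union>(a, s) \<in> X. fraction A S (c \<odot>\<^bsub>A\<^esub> a) s)\<rparr>"

definition local_alg ::
  "('k, 'm) ring_scheme \<Rightarrow> ('k, 'a, 'n) module_scheme \<Rightarrow> ('a \<Rightarrow> 'k) \<Rightarrow> ('k, ('a \<times> 'a) set) module"
  where "local_alg k A p = localization A (carrier A - pt_ideal k A p)"


section \<open>The sheaf on the space of points\<close>

definition prod_alg :: "'i set \<Rightarrow> ('i \<Rightarrow> ('k, 'a, 'n) module_scheme) \<Rightarrow> ('k, 'i \<Rightarrow> 'a) module"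
  where "prod_alg I M =
    \<lparr>carrier = (\<Pi>\<^sub>E i \<in> I. carrier (M i)),
     mult = (\<lambda>x y. \<lambda>i \<in> I. x i \<otimes>\<^bsub>M i\<^esub> y i),
     one = (\<lambda>i \<in> I. \<one>\<^bsub>M i\<^esub>),
     zero = (\<lambda>i \<in> I. \<zero>\<^bsub>M i\<^esub>),
     add = (\<lambda>x y. \<lambda>i \<in> I. x i \<oplus>\<^bsub>M i\<^esub> y i),
     smult = (\<lambda>c x. \<lambda>i \<in> I. c \<odot>\<^bsub>M i\<^esub> x i)\<rparr>"

definition stalk_prod ::
  "('k, 'm) ring_scheme \<Rightarrow> ('k, 'a, 'n) module_scheme \<Rightarrow> ('a \<Rightarrow> 'k) set
    \<Rightarrow> ('k, ('a \<Rightarrow> 'k) \<Rightarrow> ('a \<times> 'a) set) module"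
  where "stalk_prod k A U = prod_alg U (local_alg k A)"

definition rho ::
  "('k, 'm) ring_scheme \<Rightarrow> ('k, 'a, 'n) module_scheme \<Rightarrow> ('a \<Rightarrow> 'k) set
    \<Rightarrow> 'a \<Rightarrow> ('a \<Rightarrow> 'k) \<Rightarrow> ('a \<times> 'a) set"
  where "rho k A U a = (\<lambda>p \<in> U. fraction A (carrier A - pt_ideal k A p) a \<one>\<^bsub>A\<^esub>)"

definition inverted_units ::
  "('k, 'm) ring_scheme \<Rightarrow> ('k, 'a, 'n) module_scheme \<Rightarrow> ('a \<Rightarrow> 'k) set
    \<Rightarrow> (('a \<Rightarrow> 'k) \<Rightarrow> ('a \<times> 'a) set) set"
  where "inverted_units k A U =
    {inv\<^bsub>stalk_prod k A U\<^esub> s | s. s \<in> Units (stalk_prod k A U) \<and> (\<exists>a \<in> carrier A. s = rho k A U a)}"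

definition str_sheaf ::
  "('k, 'm) ring_scheme \<Rightarrow> ('k, 'a, 'n) module_scheme \<Rightarrow> ('a \<Rightarrow> 'k) set
    \<Rightarrow> ('k, ('a \<Rightarrow> 'k) \<Rightarrow> ('a \<times> 'a) set) module"
  where "str_sheaf k A U = (stalk_prod k A U)
    \<lparr>carrier := generated_subalg k (stalk_prod k A U) (rho k A U ` carrier A \<union> inverted_units k A U)\<rparr>"

definition global_sections ::
  "('k, 'm) ring_scheme \<Rightarrow> ('k, 'a, 'n) module_scheme \<Rightarrow> ('k, ('a \<Rightarrow> 'k) \<Rightarrow> ('a \<times> 'a) set) module"
  where "global_sections k A = str_sheaf k A (topspace (Pts_topology k A))"

definition pts_alg ::
  "('k, 'm) ring_scheme \<Rightarrow> ('k, 'a, 'n) module_scheme \<Rightarrow> ('k, ('a \<Rightarrow> 'k) \<Rightarrow> ('a \<times> 'a) set) module"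
  where "pts_alg k A = str_sheaf k A (Pts k A)"

end

theory Submission
  imports Defs "HOL-Algebra.Algebraic_Closure" "HOL-Algebra.Chinese_Remainder"
begin

text \<open>Write \<open>X\<close> for the set of points of \<open>A\<close>, \<open>m\<^sub>p\<close> for the kernel of a point \<open>p\<close>, and call an
element of \<open>A\<close> nowhere zero if no point of \<open>A\<close> kills it.  An element of \<open>A\<close> becomes a unit in the
product of the local rings at all points exactly when it is nowhere zero, so the ring \<open>A\<^sub>k\<close> of global
sections consists of the fractions \<open>a / s\<close>, with \<open>s\<close> nowhere zero, regarded as families of germs
(\<open>unit_rho_iff\<close>, \<open>pts_alg_carrier\<close>).  A point \<open>q\<close> of \<open>A\<close> extends to \<open>A\<^sub>k\<close> by
\<open>a / s \<mapsto> q a / q s\<close>, and passing from \<open>A\<close> to \<open>A\<^sub>k\<close> inverts only elements that are already inverted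
in the local ring at \<open>q\<close>, so the local rings agree (\<open>local_iso\<close>).

What needs work is that every maximal ideal \<open>m\<close> of \<open>A\<^sub>k\<close> comes from a point.  Let \<open>J\<close> be its preimage
in \<open>A\<close>: a prime ideal without nowhere zero elements, which determines \<open>m\<close>, because every fraction in
\<open>m\<close> has its numerator in \<open>J\<close>.  If \<open>J \<subseteq> m\<^sub>q\<close> for some point \<open>q\<close>, then \<open>m\<close> is contained in the kernel of
the extension of \<open>q\<close>, hence equal to it.  Such a point exists for every prime ideal \<open>J\<close> without nowhere
zero elements (\<open>point_on_prime\<close>), for one of two reasons.

If \<open>k\<close> is not algebraically closed, some polynomial \<open>P\<close> in one variable of degree at least 2 has no
root in \<open>k\<close>.  Its homogenization \<open>N\<close> is a form in two variables whose only zero in \<open>k\<^sup>2\<close> is the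
origin.  Thus \<open>f\<close> and \<open>g\<close> have the same common zeros in \<open>X\<close> as the single element \<open>N(f, g)\<close> of the
ideal that they generate.  By Hilbert's basis theorem \<open>J\<close> is finitely generated, so it contains an
element \<open>f\<close> whose zeros are the common zeros of \<open>J\<close>.  As \<open>f\<close> is not nowhere zero, there is such a zero.

If \<open>k\<close> is algebraically closed, the existence of \<open>q\<close> is Hilbert's Nullstellensatz for the domain
\<open>A / J\<close>.  It follows by adjoining one generator at a time from the extension theorem for
homomorphisms: if \<open>R\<close> is a subring of a domain and \<open>b \<noteq> 0\<close> lies in \<open>R[x]\<close>, then there is \<open>r \<noteq> 0\<close> in
\<open>R\<close> such that every homomorphism from \<open>R\<close> to \<open>k\<close> that does not kill \<open>r\<close> extends to one from \<open>R[x]\<close>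
to \<open>k\<close> that does not kill \<open>b\<close> (\<open>extend_partial_hom\<close>).\<close>

section \<open>Values of polynomials over a subring\<close>

text \<open>The values at \<open>x\<close> of the polynomials over \<open>K\<close> of degree less than \<open>n\<close>.  They filter the ring \<open>K[x]\<close>,
and each layer adds one leading term; all inductions on degrees below run along this filtration.
Leading coefficients may vanish, so the layers are increasing.\<close>

definition (in ring) polys_below :: "'a set \<Rightarrow> 'a \<Rightarrow> nat \<Rightarrow> 'a set"
  where "polys_below K x n = (\<lambda>p. eval p x) ` {p. set p \<subseteq> K \<and> length p = n}"

context ring
begin

lemma polys_below_0 [simp]: "polys_below K x 0 = {\<zero>}"
  by (auto simp: polys_below_def)

lemma polys_below_Suc:
  "polys_below K x (Suc n) = {b \<otimes> x [^] n \<oplus> p | b p. b \<in> K \<and> p \<in> polys_below K x n}"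
proof (intro equalityI subsetI)
  fix y assume "y \<in> polys_below K x (Suc n)"
  then obtain q where "set q \<subseteq> K" "length q = Suc n" "y = eval q x"
    by (auto simp: polys_below_def)
  then show "y \<in> {b \<otimes> x [^] n \<oplus> p | b p. b \<in> K \<and> p \<in> polys_below K x n}"
    by (cases q) (auto simp: polys_below_def)
next
  fix y assume "y \<in> {b \<otimes> x [^] n \<oplus> p | b p. b \<in> K \<and> p \<in> polys_below K x n}"
  then obtain b q where "b \<in> K" "set q \<subseteq> K" "length q = n" "y = b \<otimes> x [^] n \<oplus> eval q x"
    by (auto simp: polys_below_def)
  then show "y \<in> polys_below K x (Suc n)"
    unfolding polys_below_def by (intro image_eqI[of _ _ "b # q"]) auto
qed

lemma polys_below_SucE:
  assumes "y \<in> polys_below K x (Suc n)"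
  obtains b p where "b \<in> K" "p \<in> polys_below K x n" "y = b \<otimes> x [^] n \<oplus> p"
  using assms by (auto simp: polys_below_Suc)

lemma polys_below_SucI:
  "b \<in> K \<Longrightarrow> p \<in> polys_below K x n \<Longrightarrow> b \<otimes> x [^] n \<oplus> p \<in> polys_below K x (Suc n)"
  by (auto simp: polys_below_Suc)

end

context cring
begin

context
  fixes K assumes K: "subring K R"
begin

lemma coeff_carrier: "b \<in> K \<Longrightarrow> b \<in> carrier R"
  using subringE(1)[OF K] by auto

context
  fixes x assumes x: "x \<in> carrier R"
begin

lemma polys_below_carrier: "p \<in> polys_below K x n \<Longrightarrow> p \<in> carrier R"
  using eval_in_carrier subringE(1)[OF K] x by (auto simp: polys_below_def)

lemma polys_below_lift:
  assumes "p \<in> polys_below K x n" shows "p \<in> polys_below K x (Suc n)"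
  using polys_below_SucI[OF subringE(2)[OF K] assms] x polys_below_carrier[OF assms] by simp

lemma polys_below_mono:
  assumes "n \<le> m" "p \<in> polys_below K x n" shows "p \<in> polys_below K x m"
  using assms by (induction m rule: dec_induct) (auto intro: polys_below_lift)

lemma polys_below_zero: "\<zero> \<in> polys_below K x n"
  using polys_below_mono[of 0 n \<zero>] by simp

lemma polys_below_const:
  assumes "b \<in> K" "0 < n" shows "b \<in> polys_below K x n"
proof -
  have "b \<otimes> x [^] (0::nat) \<oplus> \<zero> \<in> polys_below K x (Suc 0)"
    by (rule polys_below_SucI) (simp_all add: assms)
  with assms coeff_carrier[OF assms(1)] show ?thesis
    by (auto intro: polys_below_mono[of "Suc 0"])
qed

lemma polys_below_add:
  "p \<in> polys_below K x n \<Longrightarrow> q \<in> polys_below K x n \<Longrightarrow> p \<oplus> q \<in> polys_below K x n"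
proof (induction n arbitrary: p q)
  case 0
  then show ?case by simp
next
  case (Suc n)
  from Suc.prems obtain b p' c q' where
    p: "b \<in> K" "p' \<in> polys_below K x n" "p = b \<otimes> x [^] n \<oplus> p'" and
    q: "c \<in> K" "q' \<in> polys_below K x n" "q = c \<otimes> x [^] n \<oplus> q'"
    by (metis polys_below_SucE)
  have "p \<oplus> q = (b \<oplus> c) \<otimes> x [^] n \<oplus> (p' \<oplus> q')"
    using p q x by (simp add: coeff_carrier polys_below_carrier l_distr a_ac)
  then show ?case
    using polys_below_SucI[OF subringE(7)[OF K p(1) q(1)] Suc.IH[OF p(2) q(2)]] by simp
qed

lemma polys_below_smult:
  "a \<in> K \<Longrightarrow> p \<in> polys_below K x n \<Longrightarrow> a \<otimes> p \<in> polys_below K x n"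
proof (induction n arbitrary: p)
  case 0
  then show ?case by (simp add: coeff_carrier)
next
  case (Suc n)
  from Suc.prems obtain b p' where
    p: "b \<in> K" "p' \<in> polys_below K x n" "p = b \<otimes> x [^] n \<oplus> p'"
    by (metis polys_below_SucE)
  have "a \<otimes> p = (a \<otimes> b) \<otimes> x [^] n \<oplus> a \<otimes> p'"
    using p x Suc.prems by (simp add: coeff_carrier polys_below_carrier r_distr m_assoc)
  then show ?case
    using polys_below_SucI[OF subringE(6)[OF K Suc.prems(1) p(1)] Suc.IH[OF Suc.prems(1) p(2)]]
    by simp
qed

lemma polys_below_shift:
  "p \<in> polys_below K x n \<Longrightarrow> x [^] m \<otimes> p \<in> polys_below K x (n + m)"
proof (induction n arbitrary: p)
  case 0
  then show ?case using x by (simp add: polys_below_zero)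
next
  case (Suc n)
  from Suc.prems obtain b p' where
    p: "b \<in> K" "p' \<in> polys_below K x n" "p = b \<otimes> x [^] n \<oplus> p'"
    by (metis polys_below_SucE)
  have "x [^] m \<otimes> p = b \<otimes> x [^] (n + m) \<oplus> x [^] m \<otimes> p'"
    using p x by (simp add: coeff_carrier polys_below_carrier r_distr m_lcomm m_comm
        nat_pow_mult[symmetric] m_assoc)
  then show ?case
    using polys_below_SucI[OF p(1) Suc.IH[OF p(2)]] by simp
qed

lemma polys_below_uminus:
  assumes "p \<in> polys_below K x n" shows "\<ominus> p \<in> polys_below K x n"
proof -
  have "\<ominus> \<one> \<in> K" using subringE(3,5)[OF K] by blast
  from polys_below_smult[OF this assms] polys_below_carrier[OF assms] show ?thesis
    by (simp add: l_minus)
qed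

lemma polys_below_minus:
  "p \<in> polys_below K x n \<Longrightarrow> q \<in> polys_below K x n \<Longrightarrow> p \<ominus> q \<in> polys_below K x n"
  unfolding a_minus_def by (intro polys_below_add polys_below_uminus)

lemma simple_extension_eq_polys_below: "simple_extension K x = (\<Union>n. polys_below K x n)"
proof (intro equalityI subsetI)
  fix y assume "y \<in> simple_extension K x"
  then show "y \<in> (\<Union>n. polys_below K x n)"
  proof induction
    case zero
    then show ?case using polys_below_zero by blast
  next
    case (lin p b)
    then obtain n where n: "p \<in> polys_below K x n" by blast
    have "x [^] (1::nat) \<otimes> p \<in> polys_below K x (n + 1)"
      using polys_below_shift[OF n] .
    then have "p \<otimes> x \<oplus> b \<in> polys_below K x (n + 1)"
      using polys_below_add[OF _ polys_below_const[OF lin(2)]] polys_below_carrier[OF n] x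
      by (simp add: m_comm)
    then show ?case by blast
  qed
next
  fix y assume "y \<in> (\<Union>n. polys_below K x n)"
  then obtain p where "set p \<subseteq> K" "y = eval p x"
    by (auto simp: polys_below_def)
  then show "y \<in> simple_extension K x"
  proof (induction p arbitrary: y rule: rev_induct)
    case Nil
    then show ?case by simp
  next
    case (snoc b p)
    then have "y = eval p x \<otimes> x \<oplus> b"
      using eval_append_aux[of p b x] subringE(1)[OF K] x by auto
    then show ?case
      using snoc simple_extension.lin[of "eval p x" K x b] by simp
  qed
qed

lemma simple_extensionE:
  assumes "y \<in> simple_extension K x"
  obtains n where "y \<in> polys_below K x n"
  using assms simple_extension_eq_polys_below by blast

lemma polys_below_in_extension: "y \<in> polys_below K x n \<Longrightarrow> y \<in> simple_extension K x"
  using simple_extension_eq_polys_below by blast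

text \<open>Closure under products is an induction on the degree of the first factor, which works over any
commutative ring.  Zero divisors have to be allowed: \<open>A\<close> itself may have some, and so do the product
rings in which homomorphisms are represented by their graphs.\<close>

lemma simple_extension_subring: "subring (simple_extension K x) R"
proof (rule subringI)
  show "simple_extension K x \<subseteq> carrier R"
    using simple_extension_in_carrier[OF subringE(1)[OF K] x] .
  show "\<one> \<in> simple_extension K x"
    using polys_below_const[OF subringE(3)[OF K], of 1] polys_below_in_extension by simp
  fix p assume p: "p \<in> simple_extension K x"
  then obtain n where n: "p \<in> polys_below K x n" by (rule simple_extensionE)
  show "\<ominus> p \<in> simple_extension K x"
    using polys_below_in_extension[OF polys_below_uminus[OF n]] .
  fix q assume q: "q \<in> simple_extension K x"
  then obtain m where m: "q \<in> polys_below K x m" by (rule simple_extensionE)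
  show sum: "p \<oplus> q \<in> simple_extension K x"
    using polys_below_in_extension[OF polys_below_add[of _ "max n m"]] polys_below_mono n m
    by (meson max.cobounded1 max.cobounded2)
  from n show "p \<otimes> q \<in> simple_extension K x"
  proof (induction n arbitrary: p)
    case 0
    then show ?case using polys_below_carrier[OF m] by simp
  next
    case (Suc n)
    from Suc.prems obtain b p' where
      p: "b \<in> K" "p' \<in> polys_below K x n" "p = b \<otimes> x [^] n \<oplus> p'"
      by (metis polys_below_SucE)
    have "p \<otimes> q = b \<otimes> (x [^] n \<otimes> q) \<oplus> p' \<otimes> q"
      using p x m by (simp add: coeff_carrier polys_below_carrier l_distr m_assoc)
    moreover obtain l where l: "p' \<otimes> q \<in> polys_below K x l"
      using Suc.IH[OF p(2)] by (rule simple_extensionE)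
    moreover have "b \<otimes> (x [^] n \<otimes> q) \<in> polys_below K x (m + n)"
      by (intro polys_below_smult polys_below_shift p m)
    ultimately show ?case
      using polys_below_in_extension[OF polys_below_add[of _ "max l (m + n)"]] polys_below_mono
      by (metis max.cobounded1 max.cobounded2)
  qed
qed

end

end

lemma finite_extension_subring:
  assumes "subring K R" "set xs \<subseteq> carrier R"
  shows "subring (finite_extension K xs) R"
  using assms by (induction xs) (auto intro: simple_extension_subring)

lemma finite_extension_subset:
  assumes "subring K R" "set xs \<subseteq> carrier R"
  shows "K \<union> set xs \<subseteq> finite_extension K xs"
  using assms(2)
proof (induction xs)
  case Nil
  then show ?case by simp
next
  case (Cons x xs)
  have "subring (finite_extension K xs) R"
    using Cons.prems finite_extension_subring[OF assms(1)] by auto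
  from simple_extension_incl[OF subringE(1)[OF this], of x] simple_extension_mem[OF this, of x] Cons
  show ?case by auto
qed

section \<open>Hilbert's basis theorem\<close>

lemma ideal_subring_iff:
  assumes K: "subring K R"
  shows "ideal I (R\<lparr>carrier := K\<rparr>) \<longleftrightarrow>
    I \<subseteq> K \<and> \<zero> \<in> I \<and> (\<forall>a\<in>I. \<forall>b\<in>I. a \<oplus> b \<in> I) \<and> (\<forall>a\<in>I. \<forall>c\<in>K. c \<otimes> a \<in> I)"
    (is "_ \<longleftrightarrow> ?R")
proof
  assume "ideal I (R\<lparr>carrier := K\<rparr>)"
  then interpret I: ideal I "R\<lparr>carrier := K\<rparr>" .
  show ?R
    using I.a_subset additive_subgroup.zero_closed[OF I.is_additive_subgroup]
      additive_subgroup.a_closed[OF I.is_additive_subgroup] I.I_l_closed by auto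
next
  assume I: ?R
  interpret S: ring "R\<lparr>carrier := K\<rparr>" using subring_is_ring[OF K] .
  show "ideal I (R\<lparr>carrier := K\<rparr>)"
  proof (rule idealI)
    show "ring (R\<lparr>carrier := K\<rparr>)" by (rule S.ring_axioms)
    show "subgroup I (add_monoid (R\<lparr>carrier := K\<rparr>))"
    proof (rule S.add.subgroupI)
      fix a assume a: "a \<in> I"
      have "\<ominus> \<one> \<in> K" using subringE(3,5)[OF K] by blast
      then have "\<ominus> \<one> \<otimes> a \<in> I" using a I by blast
      moreover have "a \<in> carrier R" using a I subringE(1)[OF K] by auto
      ultimately have na: "\<ominus> a \<in> I" by (simp add: l_minus)
      have "\<ominus>\<^bsub>R\<lparr>carrier := K\<rparr>\<^esub> a = \<ominus> a"
        by (rule S.minus_equality) (use a na I \<open>a \<in> carrier R\<close> in \<open>auto simp: l_neg\<close>)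
      then show "\<ominus>\<^bsub>R\<lparr>carrier := K\<rparr>\<^esub> a \<in> I"
        using na by simp
    qed (use I in auto)
  next
    fix a c assume ac: "a \<in> I" "c \<in> carrier (R\<lparr>carrier := K\<rparr>)"
    then have "a \<in> carrier R" "c \<in> carrier R" using I subringE(1)[OF K] by auto
    with ac show "c \<otimes>\<^bsub>R\<lparr>carrier := K\<rparr>\<^esub> a \<in> I" "a \<otimes>\<^bsub>R\<lparr>carrier := K\<rparr>\<^esub> c \<in> I"
      using I m_comm[of a c] by auto
  qed
qed

end

text \<open>Finite generation in a form that only tests containment in other ideals; no description of the
elements of a generated ideal is needed.\<close>

lemma (in ring) noetherian_ring_iff_finite_test_set:
  "noetherian_ring R \<longleftrightarrow>
    (\<forall>I. ideal I R \<longrightarrow> (\<exists>G. finite G \<and> G \<subseteq> I \<and> (\<forall>J. ideal J R \<and> G \<subseteq> J \<longrightarrow> I \<subseteq> J)))"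
proof (intro iffI allI impI)
  fix I assume "noetherian_ring R" and I: "ideal I R"
  then obtain G where G: "G \<subseteq> carrier R" "finite G" "I = Idl G"
    using noetherian_ring.finetely_gen by metis
  then show "\<exists>G. finite G \<and> G \<subseteq> I \<and> (\<forall>J. ideal J R \<and> G \<subseteq> J \<longrightarrow> I \<subseteq> J)"
    using genideal_self[OF G(1)] genideal_minimal[of _ G] by (intro exI[of _ G]) simp
next
  assume *: "\<forall>I. ideal I R \<longrightarrow> (\<exists>G. finite G \<and> G \<subseteq> I \<and> (\<forall>J. ideal J R \<and> G \<subseteq> J \<longrightarrow> I \<subseteq> J))"
  show "noetherian_ring R"
  proof (rule noetherian_ringI)
    fix I assume I: "ideal I R"
    with * obtain G where G: "finite G" "G \<subseteq> I" "\<And>J. ideal J R \<Longrightarrow> G \<subseteq> J \<Longrightarrow> I \<subseteq> J"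
      by metis
    have GR: "G \<subseteq> carrier R" using G(2) additive_subgroup.a_subset[OF ideal.axioms(1)[OF I]] by blast
    have "I = Idl G"
      using G(3)[OF genideal_ideal[OF GR] genideal_self[OF GR]] genideal_minimal[OF I G(2)]
      by (rule equalityI)
    with GR G(1) show "\<exists>A\<subseteq>carrier R. finite A \<and> I = Idl A" by (intro exI[of _ G] conjI)
  qed
qed

context cring
begin

text \<open>The leading coefficients of the elements of \<open>I\<close> of degree at most \<open>d\<close>, together with \<open>0\<close>.  If \<open>x\<close>
satisfies relations over \<open>K\<close>, an element can have several leading coefficients, one for each way to
write it; all of them are collected.\<close>

definition leading_coeffs :: "'a set \<Rightarrow> 'a \<Rightarrow> 'a set \<Rightarrow> nat \<Rightarrow> 'a set"
  where "leading_coeffs K x I d = {b \<in> K. \<exists>p \<in> polys_below K x d. b \<otimes> x [^] d \<oplus> p \<in> I}"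

lemma leading_coeffs_ideal:
  assumes K: "subring K R" and x: "x \<in> carrier R"
    and I: "ideal I (R\<lparr>carrier := simple_extension K x\<rparr>)"
  shows "ideal (leading_coeffs K x I d) (R\<lparr>carrier := K\<rparr>)"
  unfolding ideal_subring_iff[OF K]
proof (intro conjI ballI)
  note C = coeff_carrier[OF K] polys_below_carrier[OF K x]
  note I' = I[unfolded ideal_subring_iff[OF simple_extension_subring[OF K x]]]
  show "leading_coeffs K x I d \<subseteq> K" by (auto simp: leading_coeffs_def)
  show "\<zero> \<in> leading_coeffs K x I d"
    using polys_below_zero[OF K x, of d] subringE(2)[OF K] I' x
    by (auto simp: leading_coeffs_def intro!: bexI[of _ \<zero>])
  fix a assume "a \<in> leading_coeffs K x I d"
  then obtain p where a: "a \<in> K" and p: "p \<in> polys_below K x d" "a \<otimes> x [^] d \<oplus> p \<in> I"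
    by (auto simp: leading_coeffs_def)
  {
    fix b assume "b \<in> leading_coeffs K x I d"
    then obtain q where b: "b \<in> K" and q: "q \<in> polys_below K x d" "b \<otimes> x [^] d \<oplus> q \<in> I"
      by (auto simp: leading_coeffs_def)
    have "(a \<oplus> b) \<otimes> x [^] d \<oplus> (p \<oplus> q) = (a \<otimes> x [^] d \<oplus> p) \<oplus> (b \<otimes> x [^] d \<oplus> q)"
      using a b p q x by (simp add: C l_distr a_ac)
    also have "\<dots> \<in> I" using p q I' by blast
    finally show "a \<oplus> b \<in> leading_coeffs K x I d"
      using polys_below_add[OF K x p(1) q(1)] subringE(7)[OF K a b]
      unfolding leading_coeffs_def by blast
  next
    fix c assume c: "c \<in> K"
    have "(c \<otimes> a) \<otimes> x [^] d \<oplus> c \<otimes> p = c \<otimes> (a \<otimes> x [^] d \<oplus> p)"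
      using a c p x by (simp add: C r_distr m_assoc)
    also have "\<dots> \<in> I"
      using p I' c simple_extension_incl[OF subringE(1)[OF K] x] by blast
    finally show "c \<otimes> a \<in> leading_coeffs K x I d"
      using polys_below_smult[OF K x c p(1)] subringE(6)[OF K c a]
      unfolding leading_coeffs_def by blast
  }
qed

lemma leading_coeffs_Suc:
  assumes K: "subring K R" and x: "x \<in> carrier R"
    and I: "ideal I (R\<lparr>carrier := simple_extension K x\<rparr>)"
  shows "leading_coeffs K x I d \<subseteq> leading_coeffs K x I (Suc d)"
proof
  note C = coeff_carrier[OF K] polys_below_carrier[OF K x]
  note I' = I[unfolded ideal_subring_iff[OF simple_extension_subring[OF K x]]]
  fix a assume "a \<in> leading_coeffs K x I d"
  then obtain p where a: "a \<in> K" and p: "p \<in> polys_below K x d" "a \<otimes> x [^] d \<oplus> p \<in> I"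
    by (auto simp: leading_coeffs_def)
  have "a \<otimes> x [^] Suc d \<oplus> x [^] (1::nat) \<otimes> p = x \<otimes> (a \<otimes> x [^] d \<oplus> p)"
    using a p x by (simp add: C r_distr m_ac)
  also have "\<dots> \<in> I"
    using p I' simple_extension_mem[OF K x] by blast
  finally show "a \<in> leading_coeffs K x I (Suc d)"
    using polys_below_shift[OF K x p(1), of 1] a
    unfolding leading_coeffs_def by auto
qed

text \<open>The ideals of leading coefficients increase with the degree, so they are constant from some degree
\<open>N\<close> on.  Elements of \<open>I\<close> that realize generators of the ideals of degree at most \<open>N\<close> generate \<open>I\<close>:
by induction on the degree, any element of \<open>I\<close> can be lowered in degree by subtracting an element
with the same leading coefficient from the ideal that they generate.\<close>

theorem hilbert_basis:
  assumes K: "subring K R" and x: "x \<in> carrier R"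
    and noeth: "noetherian_ring (R\<lparr>carrier := K\<rparr>)"
  shows "noetherian_ring (R\<lparr>carrier := simple_extension K x\<rparr>)"
proof -
  let ?C = "R\<lparr>carrier := simple_extension K x\<rparr>"
  note C = coeff_carrier[OF K] polys_below_carrier[OF K x]
  note ideal_iff = ideal_subring_iff[OF simple_extension_subring[OF K x]]
  note fin = iffD1[OF ring.noetherian_ring_iff_finite_test_set[OF subring_is_ring[OF K]] noeth,
      rule_format]
  have "\<exists>F. finite F \<and> F \<subseteq> I \<and> (\<forall>J. ideal J ?C \<and> F \<subseteq> J \<longrightarrow> I \<subseteq> J)" if I: "ideal I ?C" for I
  proof -
    note I' = I[unfolded ideal_iff]
    let ?L = "leading_coeffs K x I"
    have L_ideal: "ideal (?L d) (R\<lparr>carrier := K\<rparr>)" for d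
      using leading_coeffs_ideal[OF K x I] .
    have L_mono: "?L d \<subseteq> ?L e" if "d \<le> e" for d e
      using lift_Suc_mono_le[of ?L, OF leading_coeffs_Suc[OF K x I] that] .
    \<comment> \<open>The ascending chain becomes stationary because its union is finitely generated.\<close>
    have "ideal (\<Union>d. ?L d) (R\<lparr>carrier := K\<rparr>)"
      unfolding ideal_subring_iff[OF K]
    proof (intro conjI ballI)
      note L' = L_ideal[unfolded ideal_subring_iff[OF K]]
      show "(\<Union>d. ?L d) \<subseteq> K" "\<zero> \<in> (\<Union>d. ?L d)" using L' by blast+
      show "c \<otimes> a \<in> (\<Union>d. ?L d)" if "a \<in> (\<Union>d. ?L d)" "c \<in> K" for a c using that L' by blast
      show "a \<oplus> b \<in> (\<Union>d. ?L d)" if "a \<in> (\<Union>d. ?L d)" "b \<in> (\<Union>d. ?L d)" for a b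
      proof -
        from that obtain d e where "a \<in> ?L d" "b \<in> ?L e" by blast
        then have "a \<in> ?L (max d e)" "b \<in> ?L (max d e)" using L_mono by (meson max.cobounded1 max.cobounded2 subsetD)+
        then show ?thesis using L' by blast
      qed
    qed
    from fin[OF this] obtain G where G: "finite G" "G \<subseteq> (\<Union>d. ?L d)"
      "\<And>J. ideal J (R\<lparr>carrier := K\<rparr>) \<Longrightarrow> G \<subseteq> J \<Longrightarrow> (\<Union>d. ?L d) \<subseteq> J" by metis
    obtain N where N: "G \<subseteq> ?L N"
    proof -
      from G(1,2) have "\<exists>N. G \<subseteq> ?L N"
      proof (induction G)
        case (insert g G)
        then obtain N d where "G \<subseteq> ?L N" "g \<in> ?L d" by blast
        then have "insert g G \<subseteq> ?L (max N d)" using L_mono[of N "max N d"] L_mono[of d "max N d"] by auto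
        then show ?case by blast
      qed auto
      then show ?thesis using that by blast
    qed
    have stable: "?L d \<subseteq> ?L N" for d using G(3)[OF L_ideal N] by blast
    have "\<forall>d. \<exists>G. finite G \<and> G \<subseteq> ?L d \<and> (\<forall>J. ideal J (R\<lparr>carrier := K\<rparr>) \<and> G \<subseteq> J \<longrightarrow> ?L d \<subseteq> J)"
      by (intro allI fin L_ideal)
    then obtain H where H: "\<And>d. finite (H d)" "\<And>d. H d \<subseteq> ?L d"
      "\<And>d J. ideal J (R\<lparr>carrier := K\<rparr>) \<Longrightarrow> H d \<subseteq> J \<Longrightarrow> ?L d \<subseteq> J"
      by metis
    have "\<forall>d. \<forall>g\<in>?L d. \<exists>p. p \<in> polys_below K x d \<and> g \<otimes> x [^] d \<oplus> p \<in> I"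
      by (auto simp: leading_coeffs_def)
    then obtain low where low: "\<And>d g. g \<in> ?L d \<Longrightarrow> low d g \<in> polys_below K x d"
      "\<And>d g. g \<in> ?L d \<Longrightarrow> g \<otimes> x [^] d \<oplus> low d g \<in> I"
      by metis
    define F where "F = (\<Union>d\<in>{..N}. (\<lambda>g. g \<otimes> x [^] d \<oplus> low d g) ` H d)"
    have "I \<subseteq> J" if J: "ideal J ?C" and FJ: "F \<subseteq> J" for J
    proof -
      note J' = J[unfolded ideal_iff]
      \<comment> \<open>Comparing \<open>I\<close> with \<open>I \<inter> J\<close>, rather than with \<open>J\<close>, keeps the difference of two elements
          with the same leading coefficient in \<open>I\<close>, so that the induction continues.\<close>
      have IJ: "ideal (I \<inter> J) ?C" using I' J' unfolding ideal_iff by auto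
      have low_d: "?L d \<subseteq> leading_coeffs K x (I \<inter> J) d" if "d \<le> N" for d
      proof (rule H(3)[OF leading_coeffs_ideal[OF K x IJ]])
        show "H d \<subseteq> leading_coeffs K x (I \<inter> J) d"
        proof
          fix g assume g: "g \<in> H d"
          then have gL: "g \<in> ?L d" using H(2) by blast
          have "g \<otimes> x [^] d \<oplus> low d g \<in> F" using g that by (auto simp: F_def)
          then show "g \<in> leading_coeffs K x (I \<inter> J) d"
            using low[OF gL] gL FJ by (auto simp: leading_coeffs_def)
        qed
      qed
      have L_IJ: "?L d \<subseteq> leading_coeffs K x (I \<inter> J) d" for d
      proof (cases "d \<le> N")
        case False
        have "?L d \<subseteq> leading_coeffs K x (I \<inter> J) N" using stable low_d[of N] by blast
        also have "\<dots> \<subseteq> leading_coeffs K x (I \<inter> J) d"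
          using lift_Suc_mono_le[of "leading_coeffs K x (I \<inter> J)", OF leading_coeffs_Suc[OF K x IJ], of N d] False
          by simp
        finally show ?thesis .
      qed (rule low_d)
      have "y \<in> J" if "y \<in> I" "y \<in> polys_below K x e" for y e
        using that
      proof (induction e arbitrary: y)
        case 0
        then show ?case using J' by simp
      next
        case (Suc e)
        from Suc.prems(2) obtain b p where
          p: "b \<in> K" "p \<in> polys_below K x e" "y = b \<otimes> x [^] e \<oplus> p"
          by (metis polys_below_SucE)
        then have "b \<in> leading_coeffs K x (I \<inter> J) e"
          using Suc.prems(1) L_IJ[of e] by (auto simp: leading_coeffs_def)
        then obtain q where q: "q \<in> polys_below K x e" "b \<otimes> x [^] e \<oplus> q \<in> I \<inter> J"
          by (auto simp: leading_coeffs_def)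
        let ?z = "b \<otimes> x [^] e \<oplus> q"
        have "\<ominus> \<one> \<in> simple_extension K x"
          using subringE(3,5)[OF simple_extension_subring[OF K x]] by blast
        then have "y \<oplus> (\<ominus> \<one>) \<otimes> ?z \<in> I" using Suc.prems(1) q I' by blast
        moreover have c: "b \<otimes> x [^] e \<in> carrier R" "p \<in> carrier R" "q \<in> carrier R"
          using p q x by (simp_all add: C)
        have "y \<oplus> (\<ominus> \<one>) \<otimes> ?z = p \<ominus> q"
          unfolding p(3) using c by algebra
        ultimately have "p \<ominus> q \<in> J"
          using Suc.IH polys_below_minus[OF K x p(2) q(1)] by simp
        then have "(p \<ominus> q) \<oplus> ?z \<in> J" using J' q by blast
        moreover have "(p \<ominus> q) \<oplus> ?z = y"
          unfolding p(3) using c by algebra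
        ultimately show ?case by simp
      qed
      then show ?thesis
        using I' simple_extensionE[OF K x] by (meson subsetD subsetI)
    qed
    moreover have "finite F" using H(1) by (auto simp: F_def)
    moreover have "F \<subseteq> I" using low(2) H(2) by (auto simp: F_def)
    ultimately show ?thesis by blast
  qed
  then show ?thesis
    using ring.noetherian_ring_iff_finite_test_set[OF subring_is_ring[OF simple_extension_subring[OF K x]]]
    by blast
qed

end

section \<open>Roots over an algebraically closed field\<close>

lemma (in algebraically_closed) exists_root:
  assumes "c \<in> carrier L" "c \<noteq> \<zero>" "set cs \<subseteq> carrier L" "cs \<noteq> []"
  shows "\<exists>t \<in> carrier L. eval (c # cs) t = \<zero>"
proof -
  have p: "c # cs \<in> carrier (poly_ring L)"
    using assms by (auto simp: univ_poly_def polynomial_def)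
  from roots_over_carrier[OF this] have "size (roots (c # cs)) > 0"
    using assms(4) by (simp add: splitted_def)
  then obtain t where "t \<in># roots (c # cs)"
    by (metis multiset_nonemptyE nonempty_has_size)
  then have "is_root (c # cs) t"
    using roots_mem_iff_is_root[OF p] by blast
  then show ?thesis
    by (auto simp: is_root_def)
qed

text \<open>A root \<open>t\<close> of \<open>x f(x) + 1\<close> satisfies \<open>t f(t) = - 1\<close>.\<close>

lemma (in algebraically_closed) exists_nonroot:
  assumes "c \<in> carrier L" "c \<noteq> \<zero>" "set cs \<subseteq> carrier L"
  shows "\<exists>t \<in> carrier L. eval (c # cs) t \<noteq> \<zero>"
proof -
  obtain t where t: "t \<in> carrier L" "eval (c # (cs @ [\<one>])) t = \<zero>"
    using exists_root[of c "cs @ [\<one>]"] assms by auto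
  have "eval ((c # cs) @ [\<one>]) t = eval (c # cs) t \<otimes> t \<oplus> \<one>"
    by (rule eval_append_aux) (use assms t in auto)
  with t have "eval (c # cs) t \<otimes> t \<oplus> \<one> = \<zero>" by (metis append_Cons)
  then have "eval (c # cs) t \<noteq> \<zero>" using t by auto
  with t show ?thesis by blast
qed

section \<open>Multiples in the coefficient ring of an algebraic element\<close>

context domain
begin

lemma polys_below_leading_term:
  assumes K: "subring K R" and x: "x \<in> carrier R"
    and "y \<in> polys_below K x n" "y \<noteq> \<zero>"
  obtains d a p where "d < n" "a \<in> K" "a \<noteq> \<zero>" "p \<in> polys_below K x d" "y = a \<otimes> x [^] d \<oplus> p"
proof -
  have "\<exists>d a p. d < n \<and> a \<in> K \<and> a \<noteq> \<zero> \<and> p \<in> polys_below K x d \<and> y = a \<otimes> x [^] d \<oplus> p"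
    using assms(3)
  proof (induction n)
    case 0
    then show ?case using assms(4) by simp
  next
    case (Suc n)
    from Suc.prems obtain b p where
      p: "b \<in> K" "p \<in> polys_below K x n" "y = b \<otimes> x [^] n \<oplus> p"
      by (metis polys_below_SucE)
    show ?case
    proof (cases "b = \<zero>")
      case True
      then have "y = p" using p x polys_below_carrier[OF K x] by simp
      then show ?thesis using Suc.IH p(2) less_Suc_eq by metis
    next
      case False
      then show ?thesis using p by blast
    qed
  qed
  with that show thesis by blast
qed

text \<open>Division with remainder over a coefficient ring that is not a field: the dividend is first multiplied
by a power \<open>c'\<close> of the leading coefficient of the divisor.  The relation holds between the values at
\<open>x\<close>, and the bounds on the degrees of quotient and remainder are those of division of polynomials.\<close>

lemma pseudo_division:
  assumes K: "subring K R" and x: "x \<in> carrier R"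
    and c: "c \<in> K" "c \<noteq> \<zero>" and p: "p \<in> polys_below K x d"
    and "y \<in> polys_below K x e"
  shows "\<exists>c' s t. c' \<in> K \<and> c' \<noteq> \<zero> \<and> s \<in> polys_below K x (e - d) \<and> t \<in> polys_below K x d \<and>
    c' \<otimes> y = (c \<otimes> x [^] d \<oplus> p) \<otimes> s \<oplus> t"
  using assms(6)
proof (induction e arbitrary: y)
  case 0
  have "p \<in> carrier R" "c \<in> carrier R" using p c K x by (auto intro: polys_below_carrier coeff_carrier)
  then have "\<one> \<otimes> y = (c \<otimes> x [^] d \<oplus> p) \<otimes> \<zero> \<oplus> \<zero>" using 0 x by simp
  then show ?case
    using subringE(3)[OF K] polys_below_zero[OF K x] one_not_zero by blast
next
  case (Suc e)
  note C = coeff_carrier[OF K] polys_below_carrier[OF K x]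
  show ?case
  proof (cases "Suc e \<le> d")
    case True
    have "\<one> \<otimes> y = (c \<otimes> x [^] d \<oplus> p) \<otimes> \<zero> \<oplus> y" using C p c Suc.prems x by simp
    then show ?thesis
      using subringE(3)[OF K] polys_below_zero[OF K x] one_not_zero
        polys_below_mono[OF K x True Suc.prems] by blast
  next
    case False
    from Suc.prems obtain a y' where
      y: "a \<in> K" "y' \<in> polys_below K x e" "y = a \<otimes> x [^] e \<oplus> y'"
      by (metis polys_below_SucE)
    define z where "z = c \<otimes> y' \<ominus> a \<otimes> (x [^] (e - d) \<otimes> p)"
    have ed: "d + (e - d) = e" "Suc e - d = Suc (e - d)" using False by auto
    have "z \<in> polys_below K x e"
      unfolding z_def
      using polys_below_smult[OF K x y(1) polys_below_shift[OF K x p, of "e - d"]] ed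
        polys_below_smult[OF K x c(1) y(2)] by (intro polys_below_minus[OF K x]) auto
    from Suc.IH[OF this] obtain c' s t where
      st: "c' \<in> K" "c' \<noteq> \<zero>" "s \<in> polys_below K x (e - d)" "t \<in> polys_below K x d"
        "c' \<otimes> z = (c \<otimes> x [^] d \<oplus> p) \<otimes> s \<oplus> t" by blast
    let ?q = "c \<otimes> x [^] d \<oplus> p" and ?s = "(c' \<otimes> a) \<otimes> x [^] (e - d) \<oplus> s"
    have xe: "x [^] e = x [^] d \<otimes> x [^] (e - d)" using ed(1) x by (simp add: nat_pow_mult)
    have car: "c \<in> carrier R" "a \<in> carrier R" "c' \<in> carrier R" "p \<in> carrier R" "s \<in> carrier R"
      "t \<in> carrier R" "y' \<in> carrier R" "x [^] d \<in> carrier R" "x [^] (e - d) \<in> carrier R"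
      using C c y st p x by auto
    have "(c' \<otimes> c) \<otimes> y = ?q \<otimes> ((c' \<otimes> a) \<otimes> x [^] (e - d)) \<oplus> c' \<otimes> z"
      unfolding y(3) z_def xe using car by algebra
    also have "\<dots> = ?q \<otimes> ?s \<oplus> t"
      unfolding st(5) using car by algebra
    finally have "(c' \<otimes> c) \<otimes> y = ?q \<otimes> ?s \<oplus> t" .
    moreover have "?s \<in> polys_below K x (Suc e - d)"
      unfolding ed using subringE(6)[OF K st(1) y(1)] st(3) by (rule polys_below_SucI)
    moreover have "c' \<otimes> c \<in> K" "c' \<otimes> c \<noteq> \<zero>"
      using subringE(6)[OF K st(1) c(1)] integral_iff car st(2) c(2) by auto
    ultimately show ?thesis using st(4) by blast
  qed
qed

text \<open>The smallest such \<open>n\<close>, if there is one, is the degree of \<open>x\<close> over the fraction field of \<open>K\<close>.\<close>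

definition relation_of_degree :: "'a set \<Rightarrow> 'a \<Rightarrow> nat \<Rightarrow> bool"
  where "relation_of_degree K x n \<longleftrightarrow>
    (\<exists>a \<in> K. a \<noteq> \<zero> \<and> (\<exists>p \<in> polys_below K x n. a \<otimes> x [^] n \<oplus> p = \<zero>))"

text \<open>Over the fraction field of \<open>K\<close>, the element \<open>x\<close> generates a field, so the inverse of \<open>b\<close> is a
fraction with numerator in \<open>K[x]\<close> and denominator in \<open>K\<close>.  The proof stays within \<open>K[x]\<close>: a
nonzero multiple of \<open>b\<close> of the least possible degree \<open>d\<close> has \<open>d = 0\<close>.  Indeed \<open>d < n\<close>, since the
relation for \<open>x\<close> lowers degrees from \<open>n\<close> on; and if \<open>0 < d < n\<close>, division of the relation by the
multiple leaves a remainder which is again a multiple of \<open>b\<close>, of smaller degree and therefore zero,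
so that the quotient, which has degree \<open>n - d\<close>, gives a relation shorter than the shortest one.\<close>

lemma multiple_in_coefficients:
  assumes K: "subring K R" and x: "x \<in> carrier R"
    and rel: "relation_of_degree K x n" and min: "\<And>d. d < n \<Longrightarrow> \<not> relation_of_degree K x d"
    and b: "b \<in> simple_extension K x" "b \<noteq> \<zero>"
  shows "\<exists>b' \<in> simple_extension K x. b \<otimes> b' \<in> K \<and> b \<otimes> b' \<noteq> \<zero>"
proof -
  note C = coeff_carrier[OF K] polys_below_carrier[OF K x]
  note E = simple_extension_subring[OF K x]
  have EC: "y \<in> simple_extension K x \<Longrightarrow> y \<in> carrier R" for y using subringE(1)[OF E] by auto
  have KE: "y \<in> K \<Longrightarrow> y \<in> simple_extension K x" for y
    using simple_extension_incl[OF subringE(1)[OF K] x] by auto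
  have powE: "x [^] (k::nat) \<in> simple_extension K x" for k
    by (induction k) (use subringE(3,6)[OF E] simple_extension_mem[OF K x] in auto)
  define mult_deg where "mult_deg d \<longleftrightarrow> (\<exists>b' \<in> simple_extension K x. \<exists>c \<in> K. c \<noteq> \<zero> \<and>
      (\<exists>p \<in> polys_below K x d. b \<otimes> b' = c \<otimes> x [^] d \<oplus> p) \<and> b \<otimes> b' \<noteq> \<zero>)" for d
  have lower: "\<exists>d < e. mult_deg d"
    if z: "z \<in> polys_below K x e" "z \<noteq> \<zero>" "b' \<in> simple_extension K x" "z = b \<otimes> b'" for z e b'
  proof -
    obtain d a p where "d < e" "a \<in> K" "a \<noteq> \<zero>" "p \<in> polys_below K x d" "z = a \<otimes> x [^] d \<oplus> p"
      using polys_below_leading_term[OF K x z(1,2)] by metis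
    then show ?thesis using z(2-4) unfolding mult_deg_def by metis
  qed
  obtain e where "b \<in> polys_below K x e" using b(1) by (rule simple_extensionE[OF K x])
  then have "\<exists>d. mult_deg d"
    using lower[of b e \<one>] b subringE(3)[OF E] EC by auto
  define d where "d = (LEAST d. mult_deg d)"
  have d: "mult_deg d" unfolding d_def using \<open>\<exists>d. mult_deg d\<close> by (rule LeastI_ex)
  have d_min: "\<not> mult_deg e" if "e < d" for e using that not_less_Least unfolding d_def by blast
  from d obtain b' c p where b': "b' \<in> simple_extension K x" and c: "c \<in> K" "c \<noteq> \<zero>"
    and p: "p \<in> polys_below K x d" and q: "b \<otimes> b' = c \<otimes> x [^] d \<oplus> p" "b \<otimes> b' \<noteq> \<zero>"
    unfolding mult_deg_def by blast
  from rel obtain a m where a: "a \<in> K" "a \<noteq> \<zero>" and m: "m \<in> polys_below K x n"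
    and am: "a \<otimes> x [^] n \<oplus> m = \<zero>" unfolding relation_of_degree_def by blast
  have car: "a \<in> carrier R" "m \<in> carrier R" "c \<in> carrier R" "p \<in> carrier R" "b \<in> carrier R"
    "b' \<in> carrier R" using a m c p b b' C EC by auto
  have "d = 0"
  proof (rule ccontr)
    assume "d \<noteq> 0"
    have "d < n"
    proof (rule ccontr)
      assume "\<not> d < n"
      then have xd: "x [^] d = x [^] n \<otimes> x [^] (d - n)" and nd: "n + (d - n) = d"
        using x by (simp_all add: nat_pow_mult)
      have pc: "x [^] n \<in> carrier R" "x [^] (d - n) \<in> carrier R" using x by auto
      have "b \<otimes> (a \<otimes> b') = a \<otimes> (b \<otimes> b')"
        using car by algebra
      also have "\<dots> = (a \<otimes> p \<ominus> c \<otimes> (x [^] (d - n) \<otimes> m)) \<oplus> (c \<otimes> x [^] (d - n)) \<otimes> (a \<otimes> x [^] n \<oplus> m)"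
        unfolding q xd using car pc by algebra
      also have "\<dots> = a \<otimes> p \<ominus> c \<otimes> (x [^] (d - n) \<otimes> m)"
        unfolding am using car pc by simp
      finally have eq: "b \<otimes> (a \<otimes> b') = a \<otimes> p \<ominus> c \<otimes> (x [^] (d - n) \<otimes> m)" .
      have "a \<otimes> p \<ominus> c \<otimes> (x [^] (d - n) \<otimes> m) \<in> polys_below K x d"
        using polys_below_smult[OF K x a(1) p]
          polys_below_smult[OF K x c(1) polys_below_shift[OF K x m, of "d - n"]] nd
        by (intro polys_below_minus[OF K x]) auto
      moreover have "b \<otimes> (a \<otimes> b') \<noteq> \<zero>" using q(2) a car by (auto simp: integral_iff)
      moreover have "a \<otimes> b' \<in> simple_extension K x" using subringE(6)[OF E] KE a b' by blast
      ultimately obtain e where "e < d" "mult_deg e" using lower eq by metis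
      with d_min show False by blast
    qed
    then have xn: "x [^] n = x [^] d \<otimes> x [^] (n - d)" and nd: "d + (n - d) = n"
      using x by (simp_all add: nat_pow_mult)
    have pc: "x [^] d \<in> carrier R" "x [^] (n - d) \<in> carrier R" using x by auto
    \<comment> \<open>The relation after the first step of its division by the multiple of \<open>b\<close>.  That step is taken
        by hand, because it shows that the leading coefficient of the quotient is not zero.\<close>
    define y where "y = c \<otimes> m \<ominus> a \<otimes> (x [^] (n - d) \<otimes> p)"
    have "y \<in> polys_below K x n"
      unfolding y_def using polys_below_smult[OF K x c(1) m]
        polys_below_smult[OF K x a(1) polys_below_shift[OF K x p, of "n - d"]] nd
      by (intro polys_below_minus[OF K x]) auto
    from pseudo_division[OF K x c p this] obtain c' s t where
      st: "c' \<in> K" "c' \<noteq> \<zero>" "s \<in> polys_below K x (n - d)" "t \<in> polys_below K x d"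
        "c' \<otimes> y = (c \<otimes> x [^] d \<oplus> p) \<otimes> s \<oplus> t" by blast
    have car': "c' \<in> carrier R" "s \<in> carrier R" "t \<in> carrier R" using st C by auto
    let ?w = "(c' \<otimes> a) \<otimes> x [^] (n - d) \<oplus> s"
    have "y = c \<otimes> (a \<otimes> x [^] n \<oplus> m) \<ominus> (a \<otimes> x [^] (n - d)) \<otimes> (c \<otimes> x [^] d \<oplus> p)"
      unfolding y_def xn using car pc by algebra
    also have "\<dots> = \<ominus> ((a \<otimes> x [^] (n - d)) \<otimes> (b \<otimes> b'))"
      unfolding am q using car pc by algebra
    finally have y: "y = \<ominus> ((a \<otimes> x [^] (n - d)) \<otimes> (b \<otimes> b'))" .
    have "t = c' \<otimes> y \<ominus> (b \<otimes> b') \<otimes> s"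
      unfolding st(5) q using car car' pc by algebra
    also have "\<dots> = b \<otimes> (\<ominus> (b' \<otimes> ?w))"
      unfolding y using car car' pc by algebra
    finally have t: "t = b \<otimes> (\<ominus> (b' \<otimes> ?w))" .
    have "?w \<in> simple_extension K x"
      using st a powE polys_below_in_extension[OF K x] KE by (intro subringE(6,7)[OF E]) auto
    then have "\<ominus> (b' \<otimes> ?w) \<in> simple_extension K x" using b' subringE(5,6)[OF E] by blast
    then have "t = \<zero>" using lower[OF st(4) _ _ t] d_min by blast
    moreover have "t = \<ominus> ((b \<otimes> b') \<otimes> ?w)" unfolding t using car car' pc by algebra
    ultimately have "\<ominus> ((b \<otimes> b') \<otimes> ?w) = \<zero>" by simp
    then have "(b \<otimes> b') \<otimes> ?w = \<zero>" using car car' pc by (metis a_closed add.inv_eq_1_iff m_closed)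
    then have "?w = \<zero>" using q(2) car car' pc integral_iff by auto
    moreover have "c' \<otimes> a \<in> K" "c' \<otimes> a \<noteq> \<zero>"
      using subringE(6)[OF K st(1) a(1)] st a car car' integral_iff by auto
    ultimately have "relation_of_degree K x (n - d)"
      using st(3) unfolding relation_of_degree_def by blast
    with min[of "n - d"] \<open>d \<noteq> 0\<close> \<open>d < n\<close> show False by simp
  qed
  then have "b \<otimes> b' = c" using q(1) p car by simp
  with b' c show ?thesis by auto
qed

end

section \<open>Extension of homomorphisms into an algebraically closed field\<close>

lemma RDirProd_simps:
  "x \<otimes>\<^bsub>RDirProd R S\<^esub> y = (fst x \<otimes>\<^bsub>R\<^esub> fst y, snd x \<otimes>\<^bsub>S\<^esub> snd y)"
  "x \<oplus>\<^bsub>RDirProd R S\<^esub> y = (fst x \<oplus>\<^bsub>R\<^esub> fst y, snd x \<oplus>\<^bsub>S\<^esub> snd y)"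
  "\<one>\<^bsub>RDirProd R S\<^esub> = (\<one>\<^bsub>R\<^esub>, \<one>\<^bsub>S\<^esub>)"
  "\<zero>\<^bsub>RDirProd R S\<^esub> = (\<zero>\<^bsub>R\<^esub>, \<zero>\<^bsub>S\<^esub>)"
  by (auto simp: RDirProd_def DirProd_def monoid.defs split: prod.splits)

lemma RDirProd_cring:
  assumes "cring R" "cring S" shows "cring (RDirProd R S)"
proof -
  interpret R: cring R by fact
  interpret S: cring S by fact
  interpret P: ring "RDirProd R S" by (rule RDirProd_ring[OF R.ring_axioms S.ring_axioms])
  show ?thesis
    by (unfold_locales) (auto simp: RDirProd_carrier RDirProd_simps R.m_comm S.m_comm)
qed

lemma (in ring_hom_ring) image_polys_below:
  assumes "K \<subseteq> carrier R" "x \<in> carrier R"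
  shows "h ` R.polys_below K x n = S.polys_below (h ` K) (h x) n"
proof (intro equalityI subsetI)
  fix y assume "y \<in> h ` R.polys_below K x n"
  then obtain p where "set p \<subseteq> K" "length p = n" "y = h (R.eval p x)"
    by (auto simp: R.polys_below_def)
  then show "y \<in> S.polys_below (h ` K) (h x) n"
    unfolding S.polys_below_def using eval_hom'[OF assms(2), of p] assms(1)
    by (intro image_eqI[of _ _ "map h p"]) auto
next
  fix y assume "y \<in> S.polys_below (h ` K) (h x) n"
  then obtain p where p: "set p \<subseteq> h ` K" "length p = n" "y = S.eval p (h x)"
    by (auto simp: S.polys_below_def)
  from p(1) have "p \<in> lists (h ` K)" by auto
  then obtain r where r: "set r \<subseteq> K" "p = map h r" by (auto simp: lists_image)
  then have "y = h (R.eval r x)"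
    using p eval_hom'[OF assms(2), of r] assms(1) by auto
  moreover have "R.eval r x \<in> R.polys_below K x n"
    using r p(2) by (auto simp: R.polys_below_def)
  ultimately show "y \<in> h ` R.polys_below K x n" by blast
qed

lemma image_simple_extension:
  assumes "ring_hom_ring R S h" "cring R" "cring S" "subring K R" "x \<in> carrier R"
  shows "h ` ring.simple_extension R K x = ring.simple_extension S (h ` K) (h x)"
proof -
  interpret ring_hom_ring R S h by fact
  interpret R: cring R by fact
  interpret S: cring S by fact
  have "subring (h ` K) S" using img_is_subring[OF assms(4)] .
  then show ?thesis
    using image_polys_below[OF subringE(1)[OF assms(4)] assms(5)]
    by (simp add: R.simple_extension_eq_polys_below[OF assms(4,5)]
        S.simple_extension_eq_polys_below[OF _ hom_closed[OF assms(5)]] image_UN)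
qed

text \<open>Homomorphisms from subrings of \<open>R\<close> to \<open>L\<close> are represented by their graphs, which are the subrings of
\<open>R \<times> L\<close> that meet \<open>0 \<times> L\<close> in zero only.  The domain of definition is the image under the first projection.
Extending a homomorphism to \<open>x\<close> with value \<open>t\<close> then means adjoining the element \<open>(x, t)\<close> to a subring,
and well-definedness is a statement about the resulting subring.\<close>

definition partial_hom :: "('a, 'm) ring_scheme \<Rightarrow> ('b, 'n) ring_scheme \<Rightarrow> ('a \<times> 'b) set \<Rightarrow> bool"
  where "partial_hom R L G \<longleftrightarrow>
    subring G (RDirProd R L) \<and> (\<forall>c. (\<zero>\<^bsub>R\<^esub>, c) \<in> G \<longrightarrow> c = \<zero>\<^bsub>L\<^esub>)"


lemma partial_homD:
  assumes "cring R" "cring S" "partial_hom R S G" "(a, c) \<in> G" "(a, d) \<in> G"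
  shows "c = d"
proof -
  interpret R: cring R by fact
  interpret S: cring S by fact
  interpret P: cring "RDirProd R S" by (rule RDirProd_cring) fact+
  have G: "subring G (RDirProd R S)" using assms(3) by (simp add: partial_hom_def)
  have car: "a \<in> carrier R" "c \<in> carrier S" "d \<in> carrier S"
    using subringE(1)[OF G] assms(4,5) by (auto simp: RDirProd_carrier)
  have "(\<ominus>\<^bsub>R\<^esub> a, \<ominus>\<^bsub>S\<^esub> d) = \<ominus>\<^bsub>RDirProd R S\<^esub> (a, d)"
    by (rule P.minus_equality[symmetric])
      (use car in \<open>auto simp: RDirProd_carrier RDirProd_simps R.l_neg S.l_neg\<close>)
  also have "\<dots> \<in> G" using subringE(5)[OF G assms(5)] .
  finally have "(a, c) \<oplus>\<^bsub>RDirProd R S\<^esub> (\<ominus>\<^bsub>R\<^esub> a, \<ominus>\<^bsub>S\<^esub> d) \<in> G"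
    using subringE(7)[OF G assms(4)] by blast
  then have "(\<zero>\<^bsub>R\<^esub>, c \<oplus>\<^bsub>S\<^esub> \<ominus>\<^bsub>S\<^esub> d) \<in> G"
    using car by (simp add: RDirProd_simps R.r_neg)
  then have "c \<oplus>\<^bsub>S\<^esub> \<ominus>\<^bsub>S\<^esub> d = \<zero>\<^bsub>S\<^esub>"
    using assms(3) by (simp add: partial_hom_def)
  then show ?thesis using car by (metis S.add.inv_closed S.minus_equality S.minus_minus)
qed

lemma RDirProd_proj_hom:
  assumes "ring R" "ring S"
  shows "ring_hom_ring (RDirProd R S) R fst" "ring_hom_ring (RDirProd R S) S snd"
  using assms RDirProd_ring[OF assms]
  by (auto intro!: ring_hom_ringI simp: RDirProd_carrier RDirProd_simps)

text \<open>If \<open>x\<close> is transcendental over \<open>K\<close>, any value \<open>t\<close> for \<open>x\<close> is allowed.  With \<open>r\<close> the leading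
coefficient of \<open>b\<close>, the image of \<open>b\<close> as a polynomial is not zero, and \<open>t\<close> can be any of its nonroots.
If \<open>x\<close> is algebraic, let \<open>a\<close> be the leading coefficient of a relation of least degree and let \<open>b b'\<close>
be a nonzero multiple of \<open>b\<close> in \<open>K\<close>.  For \<open>r = a b b'\<close> the image of the relation has positive degree
and hence a root \<open>t\<close>, and the value of \<open>b\<close> cannot vanish, because it divides that of \<open>b b'\<close>.\<close>

theorem extend_partial_hom:
  fixes R :: "('a, 'm) ring_scheme" and L :: "('b, 'n) ring_scheme"
  assumes "domain R" "algebraically_closed L"
    and K: "subring K R" and x: "x \<in> carrier R"
    and b: "b \<in> ring.simple_extension R K x" "b \<noteq> \<zero>\<^bsub>R\<^esub>"
  shows "\<exists>r \<in> K. r \<noteq> \<zero>\<^bsub>R\<^esub> \<and> (\<forall>G. partial_hom R L G \<and> fst ` G = K \<and> (r, \<zero>\<^bsub>L\<^esub>) \<notin> G \<longrightarrow>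
    (\<exists>G'. partial_hom R L G' \<and> G \<subseteq> G' \<and> fst ` G' = ring.simple_extension R K x \<and>
      (b, \<zero>\<^bsub>L\<^esub>) \<notin> G'))"
proof -
  interpret R: domain R by fact
  interpret L: algebraically_closed L by fact
  let ?P = "RDirProd R L"
  interpret P: cring ?P by (rule RDirProd_cring) unfold_locales
  interpret fst: ring_hom_ring ?P R fst
    by (rule RDirProd_proj_hom) unfold_locales
  interpret snd: ring_hom_ring ?P L snd
    by (rule RDirProd_proj_hom) unfold_locales
  have cr: "cring R" "cring L" "cring ?P" by unfold_locales
  note KC = R.coeff_carrier[OF K]
  have extension_props:
    "subring (P.simple_extension G (x, t)) ?P \<and> G \<subseteq> P.simple_extension G (x, t) \<and>
      fst ` P.simple_extension G (x, t) = R.simple_extension K x"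
    if "subring G ?P" "fst ` G = K" "t \<in> carrier L" for G t
  proof -
    have X: "(x, t) \<in> carrier ?P" using that x by (simp add: RDirProd_carrier)
    show ?thesis
      using P.simple_extension_subring[OF that(1) X] P.simple_extension_incl[OF subringE(1)[OF that(1)] X]
        image_simple_extension[OF fst.ring_hom_ring_axioms cr(3,1) that(1) X] that(2) by simp
  qed
  \<comment> \<open>Below the least degree of a relation, a polynomial expression in \<open>x\<close> that vanishes has only
      zero coefficients, so it vanishes at \<open>t\<close> as well.\<close>
  have low_degree: "p = \<zero>\<^bsub>?P\<^esub>"
    if G: "partial_hom R L G" "fst ` G = K" and t: "t \<in> carrier L"
      and no_rel: "\<And>d. d < e \<Longrightarrow> \<not> R.relation_of_degree K x d"
      and p: "p \<in> P.polys_below G (x, t) e" "fst p = \<zero>\<^bsub>R\<^esub>" for G t e p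
    using no_rel p
  proof (induction e arbitrary: p)
    case 0
    then show ?case by simp
  next
    case (Suc e)
    have sG: "subring G ?P" using G by (simp add: partial_hom_def)
    have X: "(x, t) \<in> carrier ?P" using t x by (simp add: RDirProd_carrier)
    from Suc.prems(2) obtain g q where
      q: "g \<in> G" "q \<in> P.polys_below G (x, t) e" "p = g \<otimes>\<^bsub>?P\<^esub> (x, t) [^]\<^bsub>?P\<^esub> e \<oplus>\<^bsub>?P\<^esub> q"
      by (metis P.polys_below_SucE)
    have car: "g \<in> carrier ?P" "q \<in> carrier ?P"
      using P.coeff_carrier[OF sG q(1)] P.polys_below_carrier[OF sG X q(2)] .
    have "fst q \<in> R.polys_below K x e"
      using fst.image_polys_below[OF subringE(1)[OF sG] X, of e] q(2) G(2) by auto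
    moreover have "fst p = fst g \<otimes>\<^bsub>R\<^esub> x [^]\<^bsub>R\<^esub> e \<oplus>\<^bsub>R\<^esub> fst q"
      unfolding q(3) using car X fst.hom_nat_pow[OF X, of e] by (simp add: RDirProd_simps)
    moreover have "fst g \<in> K" using q(1) G(2) by auto
    ultimately have "fst g = \<zero>\<^bsub>R\<^esub>"
      using Suc.prems(1)[of e] Suc.prems(3) unfolding R.relation_of_degree_def by auto
    then have "g = \<zero>\<^bsub>?P\<^esub>"
      using G(1) q(1) unfolding partial_hom_def RDirProd_simps by (cases g) auto
    then have "p = q" using q(3) car X by simp
    then show ?case using Suc.IH[OF _ q(2)] Suc.prems(1,3) by auto
  qed
  have lift: "\<exists>gs. set gs \<subseteq> G \<and> map fst gs = cs" if "set cs \<subseteq> K" "fst ` G = K" for cs G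
  proof -
    from that have "cs \<in> lists (fst ` G)" by auto
    then show ?thesis unfolding lists_image by auto
  qed
  show ?thesis
  proof (cases "\<exists>n. R.relation_of_degree K x n")
    case False
    obtain e where "b \<in> R.polys_below K x e" using b(1) by (rule R.simple_extensionE[OF K x])
    from R.polys_below_leading_term[OF K x this b(2)] obtain d a p where
      a: "a \<in> K" "a \<noteq> \<zero>\<^bsub>R\<^esub>" and p: "p \<in> R.polys_below K x d" and
      b_eq: "b = a \<otimes>\<^bsub>R\<^esub> x [^]\<^bsub>R\<^esub> d \<oplus>\<^bsub>R\<^esub> p" by metis
    from p obtain cs where cs: "set cs \<subseteq> K" "length cs = d" "p = R.eval cs x"
      by (auto simp: R.polys_below_def)
    have "\<exists>G'. partial_hom R L G' \<and> G \<subseteq> G' \<and> fst ` G' = R.simple_extension K x \<and> (b, \<zero>\<^bsub>L\<^esub>) \<notin> G'"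
      if G: "partial_hom R L G" "fst ` G = K" "(a, \<zero>\<^bsub>L\<^esub>) \<notin> G" for G
    proof -
      have sG: "subring G ?P" using G by (simp add: partial_hom_def)
      obtain gs where gs: "set gs \<subseteq> G" "map fst gs = cs" using lift[OF cs(1) G(2)] by blast
      obtain \<alpha> where \<alpha>: "(a, \<alpha>) \<in> G" using a(1) G(2) by auto
      have \<alpha>C: "\<alpha> \<in> carrier L" "\<alpha> \<noteq> \<zero>\<^bsub>L\<^esub>"
        using subringE(1)[OF sG] \<alpha> G(3) by (auto simp: RDirProd_carrier)
      have gsC: "set ((a, \<alpha>) # gs) \<subseteq> carrier ?P" using gs \<alpha> subringE(1)[OF sG] by auto
      have "set (map snd gs) \<subseteq> carrier L" using gsC by (auto simp: RDirProd_carrier)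
      from L.exists_nonroot[OF \<alpha>C this] obtain t where
        t: "t \<in> carrier L" "L.eval (\<alpha> # map snd gs) t \<noteq> \<zero>\<^bsub>L\<^esub>" by blast
      have X: "(x, t) \<in> carrier ?P" using t x by (simp add: RDirProd_carrier)
      define G' where "G' = P.simple_extension G (x, t)"
      have G': "subring G' ?P" "G \<subseteq> G'" "fst ` G' = R.simple_extension K x"
        using extension_props[OF sG G(2) t(1)] by (auto simp: G'_def)
      have "partial_hom R L G'"
        unfolding partial_hom_def
      proof (intro conjI allI impI)
        fix c assume "(\<zero>\<^bsub>R\<^esub>, c) \<in> G'"
        then obtain e where "(\<zero>\<^bsub>R\<^esub>, c) \<in> P.polys_below G (x, t) e"
          unfolding G'_def by (rule P.simple_extensionE[OF sG X])
        from low_degree[OF G(1,2) t(1) _ this] False show "c = \<zero>\<^bsub>L\<^esub>" by (auto simp: RDirProd_simps)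
      qed (rule G')
      define \<beta> where "\<beta> = P.eval ((a, \<alpha>) # gs) (x, t)"
      have "\<beta> \<in> P.polys_below G (x, t) (Suc d)"
        unfolding P.polys_below_def \<beta>_def using gs \<alpha> cs(2) by (intro imageI) auto
      then have "\<beta> \<in> G'" unfolding G'_def by (rule P.polys_below_in_extension[OF sG X])
      moreover have "fst \<beta> = R.eval (a # cs) x"
        unfolding \<beta>_def using fst.eval_hom'[OF X gsC] gs(2) by simp
      then have "fst \<beta> = b" using cs b_eq by simp
      moreover have "snd \<beta> = L.eval (\<alpha> # map snd gs) t"
        unfolding \<beta>_def using snd.eval_hom'[OF X gsC] by simp
      ultimately have "(b, snd \<beta>) \<in> G'" "snd \<beta> \<noteq> \<zero>\<^bsub>L\<^esub>"
        using t(2) prod.collapse[of \<beta>] by (metis, metis)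
      then have "(b, \<zero>\<^bsub>L\<^esub>) \<notin> G'"
        using partial_homD[OF cr(1,2) \<open>partial_hom R L G'\<close>] by blast
      with G' \<open>partial_hom R L G'\<close> show ?thesis by blast
    qed
    with a show ?thesis by blast
  next
    case True
    define n where "n = (LEAST n. R.relation_of_degree K x n)"
    have rel: "R.relation_of_degree K x n" unfolding n_def using True by (rule LeastI_ex)
    have min: "\<not> R.relation_of_degree K x d" if "d < n" for d
      using that not_less_Least unfolding n_def by blast
    from R.multiple_in_coefficients[OF K x rel min b] obtain b' where
      b': "b' \<in> R.simple_extension K x" "b \<otimes>\<^bsub>R\<^esub> b' \<in> K" "b \<otimes>\<^bsub>R\<^esub> b' \<noteq> \<zero>\<^bsub>R\<^esub>" by blast
    from rel obtain a p where a: "a \<in> K" "a \<noteq> \<zero>\<^bsub>R\<^esub>" and p: "p \<in> R.polys_below K x n" and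
      ap: "a \<otimes>\<^bsub>R\<^esub> x [^]\<^bsub>R\<^esub> n \<oplus>\<^bsub>R\<^esub> p = \<zero>\<^bsub>R\<^esub>" unfolding R.relation_of_degree_def by blast
    from p obtain cs where cs: "set cs \<subseteq> K" "length cs = n" "p = R.eval cs x"
      by (auto simp: R.polys_below_def)
    have "n \<noteq> 0" using ap p a KC by (cases n) auto
    define r where "r = a \<otimes>\<^bsub>R\<^esub> (b \<otimes>\<^bsub>R\<^esub> b')"
    have r: "r \<in> K" "r \<noteq> \<zero>\<^bsub>R\<^esub>"
      unfolding r_def using subringE(6)[OF K a(1) b'(2)] a b' KC R.integral_iff by auto
    have "\<exists>G'. partial_hom R L G' \<and> G \<subseteq> G' \<and> fst ` G' = R.simple_extension K x \<and> (b, \<zero>\<^bsub>L\<^esub>) \<notin> G'"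
      if G: "partial_hom R L G" "fst ` G = K" "(r, \<zero>\<^bsub>L\<^esub>) \<notin> G" for G
    proof -
      have sG: "subring G ?P" using G by (simp add: partial_hom_def)
      have GC: "g \<in> G \<Longrightarrow> g \<in> carrier ?P" for g using subringE(1)[OF sG] by auto
      obtain gs where gs: "set gs \<subseteq> G" "map fst gs = cs" using lift[OF cs(1) G(2)] by blast
      obtain \<alpha> \<gamma> where \<alpha>: "(a, \<alpha>) \<in> G" and \<gamma>: "(b \<otimes>\<^bsub>R\<^esub> b', \<gamma>) \<in> G"
        using a(1) b'(2) G(2) by (metis imageE prod.collapse)
      have C: "\<alpha> \<in> carrier L" "\<gamma> \<in> carrier L"
        using GC[OF \<alpha>] GC[OF \<gamma>] by (auto simp: RDirProd_carrier)
      have r_val: "(r, \<alpha> \<otimes>\<^bsub>L\<^esub> \<gamma>) \<in> G"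
        using subringE(6)[OF sG \<alpha> \<gamma>] by (simp add: RDirProd_simps r_def)
      then have nz: "\<alpha> \<noteq> \<zero>\<^bsub>L\<^esub>" "\<gamma> \<noteq> \<zero>\<^bsub>L\<^esub>" using G(3) C by auto
      have gsC: "set ((a, \<alpha>) # gs) \<subseteq> carrier ?P" using gs \<alpha> GC by auto
      have "set (map snd gs) \<subseteq> carrier L" using gsC by (auto simp: RDirProd_carrier)
      moreover have "map snd gs \<noteq> []" using cs(2) gs(2) \<open>n \<noteq> 0\<close> by auto
      ultimately obtain t where t: "t \<in> carrier L" "L.eval (\<alpha> # map snd gs) t = \<zero>\<^bsub>L\<^esub>"
        using L.exists_root[OF C(1) nz(1)] by blast
      let ?X = "(x, t)"
      have X: "?X \<in> carrier ?P" using t x by (simp add: RDirProd_carrier)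
      define G' where "G' = P.simple_extension G ?X"
      have G': "subring G' ?P" "G \<subseteq> G'" "fst ` G' = R.simple_extension K x"
        using extension_props[OF sG G(2) t(1)] by (auto simp: G'_def)
      define \<mu> where "\<mu> = P.eval gs ?X"
      have \<mu>: "\<mu> \<in> P.polys_below G ?X n"
        unfolding P.polys_below_def \<mu>_def using gs cs(2) by (intro imageI) auto
      have "fst (P.eval ((a, \<alpha>) # gs) ?X) = \<zero>\<^bsub>R\<^esub>"
        using fst.eval_hom'[OF X gsC] gs(2) cs ap by simp
      moreover have "snd (P.eval ((a, \<alpha>) # gs) ?X) = \<zero>\<^bsub>L\<^esub>"
        using snd.eval_hom'[OF X gsC] t(2) by simp
      ultimately have "P.eval ((a, \<alpha>) # gs) ?X = \<zero>\<^bsub>?P\<^esub>"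
        by (simp add: RDirProd_simps prod_eq_iff)
      then have rel0: "(a, \<alpha>) \<otimes>\<^bsub>?P\<^esub> ?X [^]\<^bsub>?P\<^esub> n \<oplus>\<^bsub>?P\<^esub> \<mu> = \<zero>\<^bsub>?P\<^esub>"
        using cs(2) gs(2) by (auto simp: \<mu>_def)
      \<comment> \<open>From degree \<open>n\<close> on, multiplication by \<open>(a, \<alpha>)\<close> and the relation lower the degree; \<open>\<alpha> \<noteq> 0\<close>
          can be cancelled in the second component.\<close>
      have vanish: "snd q = \<zero>\<^bsub>L\<^esub>"
        if "q \<in> P.polys_below G ?X e" "fst q = \<zero>\<^bsub>R\<^esub>" for q e
        using that
      proof (induction e arbitrary: q)
        case 0
        then show ?case by (simp add: RDirProd_simps)
      next
        case (Suc e)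
        show ?case
        proof (cases "Suc e \<le> n")
          case True
          with low_degree[OF G(1,2) t(1) _ Suc.prems] min show ?thesis
            by (auto simp: RDirProd_simps)
        next
          case False
          from Suc.prems(1) obtain g q' where
            q: "g \<in> G" "q' \<in> P.polys_below G ?X e" "q = g \<otimes>\<^bsub>?P\<^esub> ?X [^]\<^bsub>?P\<^esub> e \<oplus>\<^bsub>?P\<^esub> q'"
            by (metis P.polys_below_SucE)
          have en: "n + (e - n) = e" using False by simp
          then have Xe: "?X [^]\<^bsub>?P\<^esub> e = ?X [^]\<^bsub>?P\<^esub> n \<otimes>\<^bsub>?P\<^esub> ?X [^]\<^bsub>?P\<^esub> (e - n)"
            using X by (simp add: P.nat_pow_mult)
          have car: "g \<in> carrier ?P" "q' \<in> carrier ?P" "(a, \<alpha>) \<in> carrier ?P" "\<mu> \<in> carrier ?P"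
            "?X [^]\<^bsub>?P\<^esub> n \<in> carrier ?P" "?X [^]\<^bsub>?P\<^esub> (e - n) \<in> carrier ?P"
            using GC q(1) \<alpha> P.polys_below_carrier[OF sG X] q(2) \<mu> X by auto
          define z where "z = (a, \<alpha>) \<otimes>\<^bsub>?P\<^esub> q' \<ominus>\<^bsub>?P\<^esub> g \<otimes>\<^bsub>?P\<^esub> (?X [^]\<^bsub>?P\<^esub> (e - n) \<otimes>\<^bsub>?P\<^esub> \<mu>)"
          have "(a, \<alpha>) \<otimes>\<^bsub>?P\<^esub> q = z \<oplus>\<^bsub>?P\<^esub>
              (g \<otimes>\<^bsub>?P\<^esub> ?X [^]\<^bsub>?P\<^esub> (e - n)) \<otimes>\<^bsub>?P\<^esub> ((a, \<alpha>) \<otimes>\<^bsub>?P\<^esub> ?X [^]\<^bsub>?P\<^esub> n \<oplus>\<^bsub>?P\<^esub> \<mu>)"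
            unfolding q(3) z_def Xe using car by algebra
          also have "\<dots> = z"
            unfolding rel0 z_def using car by simp
          finally have zq: "(a, \<alpha>) \<otimes>\<^bsub>?P\<^esub> q = z" .
          have "z \<in> P.polys_below G ?X e"
            unfolding z_def using P.polys_below_smult[OF sG X \<alpha> q(2)]
              P.polys_below_smult[OF sG X q(1) P.polys_below_shift[OF sG X \<mu>, of "e - n"]] en
            by (intro P.polys_below_minus[OF sG X]) auto
          moreover have "fst z = \<zero>\<^bsub>R\<^esub>"
            unfolding zq[symmetric] using Suc.prems(2) a(1) KC by (simp add: RDirProd_simps)
          ultimately have "snd z = \<zero>\<^bsub>L\<^esub>" by (rule Suc.IH)
          then have "\<alpha> \<otimes>\<^bsub>L\<^esub> snd q = \<zero>\<^bsub>L\<^esub>"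
            unfolding zq[symmetric] by (simp add: RDirProd_simps)
          moreover have "snd q \<in> carrier L"
            using P.polys_below_carrier[OF sG X Suc.prems(1)] by (auto simp: RDirProd_carrier)
          ultimately show ?thesis using nz(1) C(1) L.integral_iff by blast
        qed
      qed
      have ph: "partial_hom R L G'"
        unfolding partial_hom_def
      proof (intro conjI allI impI)
        fix c assume "(\<zero>\<^bsub>R\<^esub>, c) \<in> G'"
        then obtain e where "(\<zero>\<^bsub>R\<^esub>, c) \<in> P.polys_below G ?X e"
          unfolding G'_def by (rule P.simple_extensionE[OF sG X])
        from vanish[OF this] show "c = \<zero>\<^bsub>L\<^esub>" by simp
      qed (rule G')
      have "(b, \<zero>\<^bsub>L\<^esub>) \<notin> G'"
      proof
        assume bG: "(b, \<zero>\<^bsub>L\<^esub>) \<in> G'"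
        obtain \<beta>' where \<beta>': "(b', \<beta>') \<in> G'" using b'(1) G'(3) by (metis imageE prod.collapse)
        then have "\<beta>' \<in> carrier L" using subringE(1)[OF G'(1)] by (auto simp: RDirProd_carrier)
        then have "(b \<otimes>\<^bsub>R\<^esub> b', \<zero>\<^bsub>L\<^esub>) \<in> G'"
          using subringE(6)[OF G'(1) bG \<beta>'] by (simp add: RDirProd_simps)
        with \<gamma> G'(2) have "\<gamma> = \<zero>\<^bsub>L\<^esub>" using partial_homD[OF cr(1,2) ph] by blast
        with nz show False by simp
      qed
      with G' ph show ?thesis by blast
    qed
    with r show ?thesis by blast
  qed
qed

corollary extend_partial_hom_finite:
  fixes R :: "('a, 'm) ring_scheme" and L :: "('b, 'n) ring_scheme"
  assumes dom: "domain R" and L: "algebraically_closed L"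
    and K: "subring K R" and xs: "set xs \<subseteq> carrier R"
    and b: "b \<in> ring.finite_extension R K xs" "b \<noteq> \<zero>\<^bsub>R\<^esub>"
  shows "\<exists>r \<in> K. r \<noteq> \<zero>\<^bsub>R\<^esub> \<and> (\<forall>G. partial_hom R L G \<and> fst ` G = K \<and> (r, \<zero>\<^bsub>L\<^esub>) \<notin> G \<longrightarrow>
    (\<exists>G'. partial_hom R L G' \<and> G \<subseteq> G' \<and> fst ` G' = ring.finite_extension R K xs \<and>
      (b, \<zero>\<^bsub>L\<^esub>) \<notin> G'))"
  using xs b
proof (induction xs arbitrary: b)
  case Nil
  interpret R: domain R by fact
  from Nil show ?case by auto
next
  case (Cons x xs)
  interpret R: domain R by fact
  have sub: "subring (R.finite_extension K xs) R"
    using Cons.prems(1) R.finite_extension_subring[OF K] by auto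
  from extend_partial_hom[OF dom L sub, of x b] Cons.prems obtain c where
    c: "c \<in> R.finite_extension K xs" "c \<noteq> \<zero>\<^bsub>R\<^esub>"
      "\<And>G. partial_hom R L G \<Longrightarrow> fst ` G = R.finite_extension K xs \<Longrightarrow> (c, \<zero>\<^bsub>L\<^esub>) \<notin> G \<Longrightarrow>
        \<exists>G'. partial_hom R L G' \<and> G \<subseteq> G' \<and> fst ` G' = R.finite_extension K (x # xs) \<and>
          (b, \<zero>\<^bsub>L\<^esub>) \<notin> G'" by auto
  from Cons.IH[OF _ c(1,2)] Cons.prems(1) obtain r where
    r: "r \<in> K" "r \<noteq> \<zero>\<^bsub>R\<^esub>" "\<And>G. partial_hom R L G \<Longrightarrow> fst ` G = K \<Longrightarrow> (r, \<zero>\<^bsub>L\<^esub>) \<notin> G \<Longrightarrow>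
        \<exists>G'. partial_hom R L G' \<and> G \<subseteq> G' \<and> fst ` G' = R.finite_extension K xs \<and> (c, \<zero>\<^bsub>L\<^esub>) \<notin> G'"
    by auto
  show ?case
  proof (intro bexI[OF _ r(1)] conjI r(2) allI impI)
    fix G assume "partial_hom R L G \<and> fst ` G = K \<and> (r, \<zero>\<^bsub>L\<^esub>) \<notin> G"
    with r(3) obtain G1 where G1: "partial_hom R L G1" "G \<subseteq> G1"
      "fst ` G1 = R.finite_extension K xs" "(c, \<zero>\<^bsub>L\<^esub>) \<notin> G1" by metis
    from c(3)[OF G1(1,3,4)] obtain G2 where "partial_hom R L G2" "G1 \<subseteq> G2"
      "fst ` G2 = R.finite_extension K (x # xs)" "(b, \<zero>\<^bsub>L\<^esub>) \<notin> G2" by metis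
    with G1(2) show "\<exists>G'. partial_hom R L G' \<and> G \<subseteq> G' \<and>
        fst ` G' = R.finite_extension K (x # xs) \<and> (b, \<zero>\<^bsub>L\<^esub>) \<notin> G'" by blast
  qed
qed

section \<open>Localization\<close>

text \<open>Operations on classes of fractions are unions over all representatives; they are computed by showing
that all members of the union coincide.\<close>

lemma UN_pair_const:
  assumes "(a, s) \<in> Q" "\<And>a' s'. (a', s') \<in> Q \<Longrightarrow> f a' s' = c"
  shows "(\<Union>(a, s) \<in> Q. f a s) = c"
  using assms by fast

locale localized_algebra = algebra k A for k :: "('k, 'm) ring_scheme" and A :: "('k, 'a, 'n) module_scheme" +
  fixes S :: "'a set"
  assumes denominators: "S \<subseteq> carrier A" "\<one>\<^bsub>A\<^esub> \<in> S"
    "\<And>s t. s \<in> S \<Longrightarrow> t \<in> S \<Longrightarrow> s \<otimes>\<^bsub>A\<^esub> t \<in> S"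
begin

abbreviation "frc \<equiv> fraction A S"

abbreviation "Loc \<equiv> localization A S"

lemma S_carrier: "s \<in> S \<Longrightarrow> s \<in> carrier A"
  using denominators by blast

lemma frac_rel_equiv: "equiv (carrier A \<times> S) (frac_rel A S)"
proof (rule equivI)
  show "frac_rel A S \<subseteq> (carrier A \<times> S) \<times> (carrier A \<times> S)"
    by (auto simp: frac_rel_def)
  show "refl_on (carrier A \<times> S) (frac_rel A S)"
    using denominators(2) by (auto simp: refl_on_def frac_rel_def)
  show "sym (frac_rel A S)"
    by (rule symI) (auto simp: frac_rel_def, metis)
  show "trans (frac_rel A S)"
  proof (rule transI, clarify)
    fix a s b t c r
    assume "((a, s), b, t) \<in> frac_rel A S" "((b, t), c, r) \<in> frac_rel A S"
    then obtain u v where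
      car: "a \<in> carrier A" "b \<in> carrier A" "c \<in> carrier A" "s \<in> S" "t \<in> S" "r \<in> S" "u \<in> S" "v \<in> S"
      and eq: "u \<otimes>\<^bsub>A\<^esub> (a \<otimes>\<^bsub>A\<^esub> t) = u \<otimes>\<^bsub>A\<^esub> (b \<otimes>\<^bsub>A\<^esub> s)" "v \<otimes>\<^bsub>A\<^esub> (b \<otimes>\<^bsub>A\<^esub> r) = v \<otimes>\<^bsub>A\<^esub> (c \<otimes>\<^bsub>A\<^esub> t)"
      by (auto simp: frac_rel_def)
    note car' = car(1-3) car(4-8)[THEN S_carrier]
    have "(u \<otimes>\<^bsub>A\<^esub> v \<otimes>\<^bsub>A\<^esub> t) \<otimes>\<^bsub>A\<^esub> (a \<otimes>\<^bsub>A\<^esub> r) = (v \<otimes>\<^bsub>A\<^esub> r) \<otimes>\<^bsub>A\<^esub> (u \<otimes>\<^bsub>A\<^esub> (a \<otimes>\<^bsub>A\<^esub> t))"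
      using car' by algebra
    also have "\<dots> = (u \<otimes>\<^bsub>A\<^esub> s) \<otimes>\<^bsub>A\<^esub> (v \<otimes>\<^bsub>A\<^esub> (b \<otimes>\<^bsub>A\<^esub> r))"
      unfolding eq(1) using car' by algebra
    also have "\<dots> = (u \<otimes>\<^bsub>A\<^esub> v \<otimes>\<^bsub>A\<^esub> t) \<otimes>\<^bsub>A\<^esub> (c \<otimes>\<^bsub>A\<^esub> s)"
      unfolding eq(2) using car' by algebra
    finally show "((a, s), c, r) \<in> frac_rel A S"
      using car denominators(3) unfolding frac_rel_def by blast
  qed
qed

lemma frc_eq_iff:
  assumes "a \<in> carrier A" "s \<in> S" "b \<in> carrier A" "t \<in> S"
  shows "frc a s = frc b t \<longleftrightarrow> (\<exists>u \<in> S. u \<otimes>\<^bsub>A\<^esub> (a \<otimes>\<^bsub>A\<^esub> t) = u \<otimes>\<^bsub>A\<^esub> (b \<otimes>\<^bsub>A\<^esub> s))"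
  unfolding fraction_def using eq_equiv_class_iff[OF frac_rel_equiv, of "(a, s)" "(b, t)"] assms
  by (auto simp: frac_rel_def)

lemma frc_eqI:
  assumes "a \<in> carrier A" "s \<in> S" "b \<in> carrier A" "t \<in> S" "a \<otimes>\<^bsub>A\<^esub> t = b \<otimes>\<^bsub>A\<^esub> s"
  shows "frc a s = frc b t"
  using assms frc_eq_iff[OF assms(1-4)] denominators(2) by auto

lemma mem_frc_iff:
  assumes "a \<in> carrier A" "s \<in> S"
  shows "(b, t) \<in> frc a s \<longleftrightarrow> b \<in> carrier A \<and> t \<in> S \<and> frc b t = frc a s"
  using equiv_class_eq_iff[OF frac_rel_equiv, of "(a, s)" "(b, t)"] assms
  unfolding fraction_def by auto

lemma loc_carrier: "carrier Loc = {frc a s | a s. a \<in> carrier A \<and> s \<in> S}"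
  by (auto simp: localization_def quotient_def fraction_def)

lemma frc_closed [simp, intro]: "a \<in> carrier A \<Longrightarrow> s \<in> S \<Longrightarrow> frc a s \<in> carrier Loc"
  by (auto simp: loc_carrier)

lemma loc_cases:
  assumes "x \<in> carrier Loc"
  obtains a s where "a \<in> carrier A" "s \<in> S" "x = frc a s"
  using assms by (auto simp: loc_carrier)

lemma frc_self: "a \<in> carrier A \<Longrightarrow> s \<in> S \<Longrightarrow> (a, s) \<in> frc a s"
  by (simp add: mem_frc_iff)

lemma loc_one: "\<one>\<^bsub>Loc\<^esub> = frc \<one>\<^bsub>A\<^esub> \<one>\<^bsub>A\<^esub>"
  and loc_zero: "\<zero>\<^bsub>Loc\<^esub> = frc \<zero>\<^bsub>A\<^esub> \<one>\<^bsub>A\<^esub>"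
  by (simp_all add: localization_def)

lemma loc_mult:
  assumes "a \<in> carrier A" "s \<in> S" "b \<in> carrier A" "t \<in> S"
  shows "frc a s \<otimes>\<^bsub>Loc\<^esub> frc b t = frc (a \<otimes>\<^bsub>A\<^esub> b) (s \<otimes>\<^bsub>A\<^esub> t)"
proof -
  have "frc (a' \<otimes>\<^bsub>A\<^esub> b') (s' \<otimes>\<^bsub>A\<^esub> t') = frc (a \<otimes>\<^bsub>A\<^esub> b) (s \<otimes>\<^bsub>A\<^esub> t)"
    if "(a', s') \<in> frc a s" "(b', t') \<in> frc b t" for a' s' b' t'
  proof -
    from that assms obtain u v where car: "a' \<in> carrier A" "b' \<in> carrier A" "s' \<in> S" "t' \<in> S" "u \<in> S" "v \<in> S"
      and eq: "u \<otimes>\<^bsub>A\<^esub> (a' \<otimes>\<^bsub>A\<^esub> s) = u \<otimes>\<^bsub>A\<^esub> (a \<otimes>\<^bsub>A\<^esub> s')" "v \<otimes>\<^bsub>A\<^esub> (b' \<otimes>\<^bsub>A\<^esub> t) = v \<otimes>\<^bsub>A\<^esub> (b \<otimes>\<^bsub>A\<^esub> t')"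
      by (auto simp: mem_frc_iff frc_eq_iff)
    note car' = car(1,2) assms(1,3) car(3-6)[THEN S_carrier] assms(2,4)[THEN S_carrier]
    have "(u \<otimes>\<^bsub>A\<^esub> v) \<otimes>\<^bsub>A\<^esub> ((a' \<otimes>\<^bsub>A\<^esub> b') \<otimes>\<^bsub>A\<^esub> (s \<otimes>\<^bsub>A\<^esub> t)) = (u \<otimes>\<^bsub>A\<^esub> (a' \<otimes>\<^bsub>A\<^esub> s)) \<otimes>\<^bsub>A\<^esub> (v \<otimes>\<^bsub>A\<^esub> (b' \<otimes>\<^bsub>A\<^esub> t))"
      using car' by algebra
    also have "\<dots> = (u \<otimes>\<^bsub>A\<^esub> v) \<otimes>\<^bsub>A\<^esub> ((a \<otimes>\<^bsub>A\<^esub> b) \<otimes>\<^bsub>A\<^esub> (s' \<otimes>\<^bsub>A\<^esub> t'))"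
      unfolding eq using car' by algebra
    finally show ?thesis
      using car assms denominators(3) by (subst frc_eq_iff) (auto intro!: bexI[of _ "u \<otimes>\<^bsub>A\<^esub> v"])
  qed
  then show ?thesis
    unfolding localization_def module.simps monoid.simps ring.simps
    by (intro UN_pair_const[OF frc_self[OF assms(1,2)]] UN_pair_const[OF frc_self[OF assms(3,4)]])
qed

lemma loc_add:
  assumes "a \<in> carrier A" "s \<in> S" "b \<in> carrier A" "t \<in> S"
  shows "frc a s \<oplus>\<^bsub>Loc\<^esub> frc b t = frc (a \<otimes>\<^bsub>A\<^esub> t \<oplus>\<^bsub>A\<^esub> b \<otimes>\<^bsub>A\<^esub> s) (s \<otimes>\<^bsub>A\<^esub> t)"
proof -
  have "frc (a' \<otimes>\<^bsub>A\<^esub> t' \<oplus>\<^bsub>A\<^esub> b' \<otimes>\<^bsub>A\<^esub> s') (s' \<otimes>\<^bsub>A\<^esub> t') = frc (a \<otimes>\<^bsub>A\<^esub> t \<oplus>\<^bsub>A\<^esub> b \<otimes>\<^bsub>A\<^esub> s) (s \<otimes>\<^bsub>A\<^esub> t)"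
    if "(a', s') \<in> frc a s" "(b', t') \<in> frc b t" for a' s' b' t'
  proof -
    from that assms obtain u v where car: "a' \<in> carrier A" "b' \<in> carrier A" "s' \<in> S" "t' \<in> S" "u \<in> S" "v \<in> S"
      and eq: "u \<otimes>\<^bsub>A\<^esub> (a' \<otimes>\<^bsub>A\<^esub> s) = u \<otimes>\<^bsub>A\<^esub> (a \<otimes>\<^bsub>A\<^esub> s')" "v \<otimes>\<^bsub>A\<^esub> (b' \<otimes>\<^bsub>A\<^esub> t) = v \<otimes>\<^bsub>A\<^esub> (b \<otimes>\<^bsub>A\<^esub> t')"
      by (auto simp: mem_frc_iff frc_eq_iff)
    note car' = car(1,2) assms(1,3) car(3-6)[THEN S_carrier] assms(2,4)[THEN S_carrier]
    have "(u \<otimes>\<^bsub>A\<^esub> v) \<otimes>\<^bsub>A\<^esub> ((a' \<otimes>\<^bsub>A\<^esub> t' \<oplus>\<^bsub>A\<^esub> b' \<otimes>\<^bsub>A\<^esub> s') \<otimes>\<^bsub>A\<^esub> (s \<otimes>\<^bsub>A\<^esub> t)) =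
        (v \<otimes>\<^bsub>A\<^esub> t \<otimes>\<^bsub>A\<^esub> t') \<otimes>\<^bsub>A\<^esub> (u \<otimes>\<^bsub>A\<^esub> (a' \<otimes>\<^bsub>A\<^esub> s)) \<oplus>\<^bsub>A\<^esub> (u \<otimes>\<^bsub>A\<^esub> s \<otimes>\<^bsub>A\<^esub> s') \<otimes>\<^bsub>A\<^esub> (v \<otimes>\<^bsub>A\<^esub> (b' \<otimes>\<^bsub>A\<^esub> t))"
      using car' by algebra
    also have "\<dots> = (u \<otimes>\<^bsub>A\<^esub> v) \<otimes>\<^bsub>A\<^esub> ((a \<otimes>\<^bsub>A\<^esub> t \<oplus>\<^bsub>A\<^esub> b \<otimes>\<^bsub>A\<^esub> s) \<otimes>\<^bsub>A\<^esub> (s' \<otimes>\<^bsub>A\<^esub> t'))"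
      unfolding eq using car' by algebra
    finally show ?thesis
      using car car' assms denominators(3) by (subst frc_eq_iff) (auto intro!: bexI[of _ "u \<otimes>\<^bsub>A\<^esub> v"])
  qed
  then show ?thesis
    unfolding localization_def module.simps monoid.simps ring.simps
    by (intro UN_pair_const[OF frc_self[OF assms(1,2)]] UN_pair_const[OF frc_self[OF assms(3,4)]])
qed

lemma loc_smult:
  assumes "c \<in> carrier k" "a \<in> carrier A" "s \<in> S"
  shows "c \<odot>\<^bsub>Loc\<^esub> frc a s = frc (c \<odot>\<^bsub>A\<^esub> a) s"
proof -
  have "frc (c \<odot>\<^bsub>A\<^esub> a') s' = frc (c \<odot>\<^bsub>A\<^esub> a) s" if "(a', s') \<in> frc a s" for a' s'
  proof -
    from that assms obtain u where car: "a' \<in> carrier A" "s' \<in> S" "u \<in> S"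
      and eq: "u \<otimes>\<^bsub>A\<^esub> (a' \<otimes>\<^bsub>A\<^esub> s) = u \<otimes>\<^bsub>A\<^esub> (a \<otimes>\<^bsub>A\<^esub> s')"
      by (auto simp: mem_frc_iff frc_eq_iff)
    note car' = car(1) assms car(2,3)[THEN S_carrier] assms(3)[THEN S_carrier]
    have "u \<otimes>\<^bsub>A\<^esub> ((c \<odot>\<^bsub>A\<^esub> a') \<otimes>\<^bsub>A\<^esub> s) = c \<odot>\<^bsub>A\<^esub> (u \<otimes>\<^bsub>A\<^esub> (a' \<otimes>\<^bsub>A\<^esub> s))"
      using car' by (metis m_closed m_comm smult_assoc2 smult_closed)
    also have "\<dots> = u \<otimes>\<^bsub>A\<^esub> ((c \<odot>\<^bsub>A\<^esub> a) \<otimes>\<^bsub>A\<^esub> s')"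
      unfolding eq using car' by (metis m_closed m_comm smult_assoc2 smult_closed)
    finally show ?thesis
      using car assms by (subst frc_eq_iff) auto
  qed
  then show ?thesis
    unfolding localization_def module.simps
    by (intro UN_pair_const[OF frc_self[OF assms(2,3)]])
qed

lemma loc_algebra: "algebra k Loc"
proof (rule algebraI)
  show "cring k" by (rule R_cring)
  note D = denominators S_carrier
  note simps = loc_mult loc_add loc_one loc_zero loc_smult D
  show "cring Loc"
  proof (rule cringI)
    show "abelian_group Loc"
    proof (rule abelian_groupI)
      fix x y assume "x \<in> carrier Loc" "y \<in> carrier Loc"
      then show "x \<oplus>\<^bsub>Loc\<^esub> y \<in> carrier Loc"
        by (auto elim!: loc_cases simp: simps)
    next
      show "\<zero>\<^bsub>Loc\<^esub> \<in> carrier Loc" by (auto simp: simps)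
    next
      fix x y z assume xyz: "x \<in> carrier Loc" "y \<in> carrier Loc" "z \<in> carrier Loc"
      then obtain a s b t c r where eq: "x = frc a s" "y = frc b t" "z = frc c r"
        and car: "a \<in> carrier A" "s \<in> S" "b \<in> carrier A" "t \<in> S" "c \<in> carrier A" "r \<in> S"
        by (auto elim!: loc_cases)
      have "(a \<otimes>\<^bsub>A\<^esub> t \<oplus>\<^bsub>A\<^esub> b \<otimes>\<^bsub>A\<^esub> s) \<otimes>\<^bsub>A\<^esub> r \<oplus>\<^bsub>A\<^esub> c \<otimes>\<^bsub>A\<^esub> (s \<otimes>\<^bsub>A\<^esub> t) =
          a \<otimes>\<^bsub>A\<^esub> (t \<otimes>\<^bsub>A\<^esub> r) \<oplus>\<^bsub>A\<^esub> (b \<otimes>\<^bsub>A\<^esub> r \<oplus>\<^bsub>A\<^esub> c \<otimes>\<^bsub>A\<^esub> t) \<otimes>\<^bsub>A\<^esub> s"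
        using car(1,3,5) car(2,4,6)[THEN S_carrier] by algebra
      moreover have "s \<otimes>\<^bsub>A\<^esub> t \<otimes>\<^bsub>A\<^esub> r = s \<otimes>\<^bsub>A\<^esub> (t \<otimes>\<^bsub>A\<^esub> r)"
        using car(2,4,6)[THEN S_carrier] by (rule m_assoc)
      ultimately show "(x \<oplus>\<^bsub>Loc\<^esub> y) \<oplus>\<^bsub>Loc\<^esub> z = x \<oplus>\<^bsub>Loc\<^esub> (y \<oplus>\<^bsub>Loc\<^esub> z)"
        unfolding eq using car by (simp add: simps)
    next
      fix x y assume "x \<in> carrier Loc" "y \<in> carrier Loc"
      then show "x \<oplus>\<^bsub>Loc\<^esub> y = y \<oplus>\<^bsub>Loc\<^esub> x"
        by (auto elim!: loc_cases simp: simps m_comm a_comm)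
    next
      fix x assume "x \<in> carrier Loc"
      then show "\<zero>\<^bsub>Loc\<^esub> \<oplus>\<^bsub>Loc\<^esub> x = x"
        by (auto elim!: loc_cases simp: simps)
    next
      fix x assume "x \<in> carrier Loc"
      then obtain a s where eq: "x = frc a s" and car: "a \<in> carrier A" "s \<in> S"
        by (auto elim!: loc_cases)
      have "frc (\<ominus>\<^bsub>A\<^esub> a) s \<oplus>\<^bsub>Loc\<^esub> x = \<zero>\<^bsub>Loc\<^esub>"
        unfolding eq using car
        by (simp add: simps) (rule frc_eqI, auto simp: D l_minus l_neg)
      then show "\<exists>y\<in>carrier Loc. y \<oplus>\<^bsub>Loc\<^esub> x = \<zero>\<^bsub>Loc\<^esub>" using car by blast
    qed
    show "comm_monoid Loc"
      by (rule comm_monoidI) (auto elim!: loc_cases simp: simps m_ac)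
    fix x y z assume xyz: "x \<in> carrier Loc" "y \<in> carrier Loc" "z \<in> carrier Loc"
    then obtain a s b t c r where eq: "x = frc a s" "y = frc b t" "z = frc c r"
      and car: "a \<in> carrier A" "s \<in> S" "b \<in> carrier A" "t \<in> S" "c \<in> carrier A" "r \<in> S"
      by (auto elim!: loc_cases)
    have "((a \<otimes>\<^bsub>A\<^esub> t \<oplus>\<^bsub>A\<^esub> b \<otimes>\<^bsub>A\<^esub> s) \<otimes>\<^bsub>A\<^esub> c) \<otimes>\<^bsub>A\<^esub> ((s \<otimes>\<^bsub>A\<^esub> r) \<otimes>\<^bsub>A\<^esub> (t \<otimes>\<^bsub>A\<^esub> r)) =
       ((a \<otimes>\<^bsub>A\<^esub> c) \<otimes>\<^bsub>A\<^esub> (t \<otimes>\<^bsub>A\<^esub> r) \<oplus>\<^bsub>A\<^esub> (b \<otimes>\<^bsub>A\<^esub> c) \<otimes>\<^bsub>A\<^esub> (s \<otimes>\<^bsub>A\<^esub> r)) \<otimes>\<^bsub>A\<^esub> ((s \<otimes>\<^bsub>A\<^esub> t) \<otimes>\<^bsub>A\<^esub> r)"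
      using car(1,3,5) car(2,4,6)[THEN S_carrier] by algebra
    then show "(x \<oplus>\<^bsub>Loc\<^esub> y) \<otimes>\<^bsub>Loc\<^esub> z = x \<otimes>\<^bsub>Loc\<^esub> z \<oplus>\<^bsub>Loc\<^esub> y \<otimes>\<^bsub>Loc\<^esub> z"
      unfolding eq using car by (simp add: simps) (rule frc_eqI, auto simp: D)
  qed
  {
    fix c x assume c: "c \<in> carrier k" and "x \<in> carrier Loc"
    then show "c \<odot>\<^bsub>Loc\<^esub> x \<in> carrier Loc" by (auto elim!: loc_cases simp: simps)
  next
    fix c d x assume "c \<in> carrier k" "d \<in> carrier k" "x \<in> carrier Loc"
    then show "(c \<otimes>\<^bsub>k\<^esub> d) \<odot>\<^bsub>Loc\<^esub> x = c \<odot>\<^bsub>Loc\<^esub> (d \<odot>\<^bsub>Loc\<^esub> x)"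
      by (auto elim!: loc_cases simp: simps smult_assoc1)
  next
    fix c d x assume cd: "c \<in> carrier k" "d \<in> carrier k" and "x \<in> carrier Loc"
    then obtain a s where eq: "x = frc a s" and car: "a \<in> carrier A" "s \<in> S"
      by (auto elim!: loc_cases)
    show "(c \<oplus>\<^bsub>k\<^esub> d) \<odot>\<^bsub>Loc\<^esub> x = c \<odot>\<^bsub>Loc\<^esub> x \<oplus>\<^bsub>Loc\<^esub> d \<odot>\<^bsub>Loc\<^esub> x"
      unfolding eq using car cd
      by (simp add: simps) (rule frc_eqI, auto simp: D smult_l_distr l_distr m_assoc)
  next
    fix c x y assume c: "c \<in> carrier k" and "x \<in> carrier Loc" "y \<in> carrier Loc"
    then show "c \<odot>\<^bsub>Loc\<^esub> (x \<oplus>\<^bsub>Loc\<^esub> y) = c \<odot>\<^bsub>Loc\<^esub> x \<oplus>\<^bsub>Loc\<^esub> c \<odot>\<^bsub>Loc\<^esub> y"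
      by (auto elim!: loc_cases simp: simps smult_r_distr smult_assoc2)
  next
    fix x assume "x \<in> carrier Loc"
    then show "\<one>\<^bsub>k\<^esub> \<odot>\<^bsub>Loc\<^esub> x = x" by (auto elim!: loc_cases simp: simps)
  next
    fix c x y assume c: "c \<in> carrier k" and "x \<in> carrier Loc" "y \<in> carrier Loc"
    then show "(c \<odot>\<^bsub>Loc\<^esub> x) \<otimes>\<^bsub>Loc\<^esub> y = c \<odot>\<^bsub>Loc\<^esub> (x \<otimes>\<^bsub>Loc\<^esub> y)"
      by (auto elim!: loc_cases simp: simps smult_assoc2)
  }
qed

end

section \<open>Products and subalgebras\<close>

lemma prod_alg_simps [simp]:
  "carrier (prod_alg I M) = (\<Pi>\<^sub>E i \<in> I. carrier (M i))"
  "x \<otimes>\<^bsub>prod_alg I M\<^esub> y = (\<lambda>i \<in> I. x i \<otimes>\<^bsub>M i\<^esub> y i)"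
  "x \<oplus>\<^bsub>prod_alg I M\<^esub> y = (\<lambda>i \<in> I. x i \<oplus>\<^bsub>M i\<^esub> y i)"
  "\<one>\<^bsub>prod_alg I M\<^esub> = (\<lambda>i \<in> I. \<one>\<^bsub>M i\<^esub>)"
  "\<zero>\<^bsub>prod_alg I M\<^esub> = (\<lambda>i \<in> I. \<zero>\<^bsub>M i\<^esub>)"
  "c \<odot>\<^bsub>prod_alg I M\<^esub> x = (\<lambda>i \<in> I. c \<odot>\<^bsub>M i\<^esub> x i)"
  by (simp_all add: prod_alg_def)

lemma prod_alg_algebra:
  assumes k: "cring k" and M: "\<And>i. i \<in> I \<Longrightarrow> algebra k (M i)"
  shows "algebra k (prod_alg I M)"
proof -
  have cr: "cring (M i)" if "i \<in> I" for i
    using M[OF that] algebra.M_cring by blast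
  note mon = cring.axioms(1)[OF cr]
  note rs = ring.ring_simprules[OF mon] cring.cring_simprules[OF cr] monoid.r_one[OF ring.is_monoid[OF mon]]
  note ms = module.smult_closed module.smult_l_distr module.smult_r_distr module.smult_assoc1
    module.smult_one
  note ms' = ms[OF algebra.axioms(1)[OF M]] algebra.smult_assoc2[OF M]
  have mem: "x i \<in> carrier (M i)" if "x \<in> (\<Pi>\<^sub>E i\<in>I. carrier (M i))" "i \<in> I" for x i
    using that by auto
  have ext: "restrict f I = x" if "x \<in> (\<Pi>\<^sub>E i\<in>I. carrier (M i))" "\<And>i. i \<in> I \<Longrightarrow> f i = x i" for f x
    using that by (auto simp: PiE_def extensional_def restrict_def)
  have "cring (prod_alg I M)"
  proof (rule cringI)
    show "abelian_group (prod_alg I M)"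
    proof (rule abelian_groupI)
      fix x assume x: "x \<in> carrier (prod_alg I M)"
      show "\<exists>y\<in>carrier (prod_alg I M). y \<oplus>\<^bsub>prod_alg I M\<^esub> x = \<zero>\<^bsub>prod_alg I M\<^esub>"
        by (rule bexI[of _ "\<lambda>i \<in> I. \<ominus>\<^bsub>M i\<^esub> x i"]) (use x in \<open>auto simp: rs mem intro!: restrict_ext\<close>)
    qed (auto simp: rs mem intro!: restrict_ext ext)
    show "comm_monoid (prod_alg I M)"
      by (rule comm_monoidI) (auto simp: rs mem intro!: restrict_ext ext)
  qed (auto simp: rs mem intro!: restrict_ext)
  then show ?thesis
    by (intro algebraI k) (auto simp: ms' mem intro!: restrict_ext ext)
qed

lemma subalg_algebra:
  assumes "algebra k A" "subalg k A B"
  shows "algebra k (A\<lparr>carrier := B\<rparr>)"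
proof -
  interpret algebra k A by fact
  have B: "subring B A" "\<And>c x. c \<in> carrier k \<Longrightarrow> x \<in> B \<Longrightarrow> c \<odot>\<^bsub>A\<^esub> x \<in> B"
    using assms(2) by (auto simp: subalg_def)
  have BA: "x \<in> B \<Longrightarrow> x \<in> carrier A" for x using subringE(1)[OF B(1)] by auto
  have "cring (A\<lparr>carrier := B\<rparr>)"
    by (intro cring.intro subring_is_ring B(1) comm_monoid.intro comm_monoid_axioms.intro
        ring.is_monoid) (auto simp: BA m_comm)
  then show ?thesis
    by (intro algebraI R_cring)
      (auto simp: BA B smult_l_distr smult_r_distr smult_assoc1 smult_assoc2)
qed

lemma alg_homD:
  assumes "h \<in> alg_hom k A B"
  shows "h \<in> ring_hom A B" "\<And>x. x \<in> carrier A \<Longrightarrow> h x \<in> carrier B"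
    "\<And>x y. x \<in> carrier A \<Longrightarrow> y \<in> carrier A \<Longrightarrow> h (x \<otimes>\<^bsub>A\<^esub> y) = h x \<otimes>\<^bsub>B\<^esub> h y"
    "\<And>x y. x \<in> carrier A \<Longrightarrow> y \<in> carrier A \<Longrightarrow> h (x \<oplus>\<^bsub>A\<^esub> y) = h x \<oplus>\<^bsub>B\<^esub> h y"
    "h \<one>\<^bsub>A\<^esub> = \<one>\<^bsub>B\<^esub>"
    "\<And>c x. c \<in> carrier k \<Longrightarrow> x \<in> carrier A \<Longrightarrow> h (c \<odot>\<^bsub>A\<^esub> x) = c \<odot>\<^bsub>B\<^esub> h x"
  using assms by (auto simp: alg_hom_def ring_hom_def)

lemma alg_homI:
  assumes "\<And>x. x \<in> carrier A \<Longrightarrow> h x \<in> carrier B"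
    "\<And>x y. x \<in> carrier A \<Longrightarrow> y \<in> carrier A \<Longrightarrow> h (x \<otimes>\<^bsub>A\<^esub> y) = h x \<otimes>\<^bsub>B\<^esub> h y"
    "\<And>x y. x \<in> carrier A \<Longrightarrow> y \<in> carrier A \<Longrightarrow> h (x \<oplus>\<^bsub>A\<^esub> y) = h x \<oplus>\<^bsub>B\<^esub> h y"
    "h \<one>\<^bsub>A\<^esub> = \<one>\<^bsub>B\<^esub>"
    "\<And>c x. c \<in> carrier k \<Longrightarrow> x \<in> carrier A \<Longrightarrow> h (c \<odot>\<^bsub>A\<^esub> x) = c \<odot>\<^bsub>B\<^esub> h x"
  shows "h \<in> alg_hom k A B"
  using assms by (auto simp: alg_hom_def intro!: ring_hom_memI)

lemma alg_isomorphic_refl: "alg_isomorphic k A A"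
  unfolding alg_isomorphic_def by (rule bexI[of _ id]) (auto intro: alg_homI)

lemma alg_isomorphic_sym:
  assumes "algebra k A" "alg_isomorphic k A B"
  shows "alg_isomorphic k B A"
proof -
  interpret algebra k A by fact
  from assms(2) obtain h where h: "h \<in> alg_hom k A B" "bij_betw h (carrier A) (carrier B)"
    by (auto simp: alg_isomorphic_def)
  define g where "g = inv_into (carrier A) h"
  have g: "g y \<in> carrier A" "h (g y) = y" if "y \<in> carrier B" for y
    using that h(2) unfolding g_def by (metis bij_betw_imp_surj_on inv_into_into, metis bij_betw_inv_into_right)
  have gh: "g (h x) = x" if "x \<in> carrier A" for x
    using that h(2) unfolding g_def by (metis bij_betw_inv_into_left)
  note h' = alg_homD[OF h(1)]
  have "g \<in> alg_hom k B A"
  proof (rule alg_homI)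
    fix x y assume xy: "x \<in> carrier B" "y \<in> carrier B"
    show "g (x \<otimes>\<^bsub>B\<^esub> y) = g x \<otimes>\<^bsub>A\<^esub> g y"
      using gh[of "g x \<otimes>\<^bsub>A\<^esub> g y"] g xy h' by simp
    show "g (x \<oplus>\<^bsub>B\<^esub> y) = g x \<oplus>\<^bsub>A\<^esub> g y"
      using gh[of "g x \<oplus>\<^bsub>A\<^esub> g y"] g xy h' by simp
  next
    fix c x assume xy: "c \<in> carrier k" "x \<in> carrier B"
    show "g (c \<odot>\<^bsub>B\<^esub> x) = c \<odot>\<^bsub>A\<^esub> g x"
      using gh[of "c \<odot>\<^bsub>A\<^esub> g x"] g xy h' by simp
  qed (use g gh[of "\<one>\<^bsub>A\<^esub>"] h' in auto)
  moreover have "bij_betw g (carrier B) (carrier A)"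
    unfolding g_def using h(2) by (rule bij_betw_inv_into)
  ultimately show ?thesis by (auto simp: alg_isomorphic_def)
qed

section \<open>Homomorphisms of localizations\<close>

definition localization_map ::
  "('k, 'b, 'n) module_scheme \<Rightarrow> 'b set \<Rightarrow> ('a \<Rightarrow> 'b) \<Rightarrow> ('a \<times> 'a) set \<Rightarrow> ('b \<times> 'b) set"
  where "localization_map B T h Q = (\<Union>(a, s) \<in> Q. fraction B T (h a) (h s))"

context
  fixes k :: "('k, 'm) ring_scheme" and A :: "('k, 'a, 'n) module_scheme" and S
    and B :: "('k, 'b, 'o) module_scheme" and T h
  assumes A: "localized_algebra k A S" and B: "localized_algebra k B T"
    and h: "h \<in> alg_hom k A B" and hS: "\<And>s. s \<in> S \<Longrightarrow> h s \<in> T"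
begin

interpretation A: localized_algebra k A S by (rule A)
interpretation B: localized_algebra k B T by (rule B)

lemma localization_map_fraction:
  assumes "a \<in> carrier A" "s \<in> S"
  shows "localization_map B T h (fraction A S a s) = fraction B T (h a) (h s)"
  unfolding localization_map_def
proof (rule UN_pair_const[OF A.frc_self[OF assms]])
  fix a' s' assume "(a', s') \<in> fraction A S a s"
  with assms obtain u where car: "a' \<in> carrier A" "s' \<in> S" "u \<in> S"
    and eq: "u \<otimes>\<^bsub>A\<^esub> (a' \<otimes>\<^bsub>A\<^esub> s) = u \<otimes>\<^bsub>A\<^esub> (a \<otimes>\<^bsub>A\<^esub> s')"
    by (auto simp: A.mem_frc_iff A.frc_eq_iff)
  have "h u \<otimes>\<^bsub>B\<^esub> (h a' \<otimes>\<^bsub>B\<^esub> h s) = h u \<otimes>\<^bsub>B\<^esub> (h a \<otimes>\<^bsub>B\<^esub> h s')"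
    using arg_cong[OF eq, of h] car assms A.S_carrier by (simp add: alg_homD[OF h])
  then show "fraction B T (h a') (h s') = fraction B T (h a) (h s)"
    using car assms by (subst B.frc_eq_iff) (auto simp: alg_homD[OF h] hS)
qed

lemma localization_map_hom: "localization_map B T h \<in> alg_hom k (localization A S) (localization B T)"
  by (rule alg_homI)
    (auto elim!: A.loc_cases simp: localization_map_fraction alg_homD[OF h] hS A.loc_mult A.loc_add
      A.loc_smult A.loc_one B.loc_mult B.loc_add B.loc_smult B.loc_one A.denominators A.S_carrier)

end

section \<open>Points of an algebra over a field\<close>

lemma base_alg_simps [simp]:
  "carrier (base_alg k) = carrier k" "monoid.mult (base_alg k) = monoid.mult k" "one (base_alg k) = one k"
  "zero (base_alg k) = zero k" "add (base_alg k) = add k" "smult (base_alg k) = monoid.mult k"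
  by (simp_all add: base_alg_def)

locale algebra_over_field = k: field k + algebra k A
  for k :: "('k, 'm) ring_scheme" and A :: "('k, 'a, 'n) module_scheme"
begin

lemma Pts_hom:
  assumes "p \<in> Pts k A"
  shows "p \<in> ring_hom A k" "\<And>x. x \<in> carrier A \<Longrightarrow> p x \<in> carrier k"
    "\<And>x y. x \<in> carrier A \<Longrightarrow> y \<in> carrier A \<Longrightarrow> p (x \<otimes>\<^bsub>A\<^esub> y) = p x \<otimes>\<^bsub>k\<^esub> p y"
    "\<And>x y. x \<in> carrier A \<Longrightarrow> y \<in> carrier A \<Longrightarrow> p (x \<oplus>\<^bsub>A\<^esub> y) = p x \<oplus>\<^bsub>k\<^esub> p y"
    "p \<one>\<^bsub>A\<^esub> = \<one>\<^bsub>k\<^esub>"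
    "\<And>c x. c \<in> carrier k \<Longrightarrow> x \<in> carrier A \<Longrightarrow> p (c \<odot>\<^bsub>A\<^esub> x) = c \<otimes>\<^bsub>k\<^esub> p x"
  using assms by (auto simp: Pts_def alg_hom_def ring_hom_def)

lemma Pts_ring_hom: "p \<in> Pts k A \<Longrightarrow> ring_hom_cring A k p"
  by (intro ring_hom_cringI M_cring R_cring Pts_hom(1))

lemma PtsI:
  assumes "\<And>x. x \<in> carrier A \<Longrightarrow> p x \<in> carrier k"
    "\<And>x y. x \<in> carrier A \<Longrightarrow> y \<in> carrier A \<Longrightarrow> p (x \<otimes>\<^bsub>A\<^esub> y) = p x \<otimes>\<^bsub>k\<^esub> p y"
    "\<And>x y. x \<in> carrier A \<Longrightarrow> y \<in> carrier A \<Longrightarrow> p (x \<oplus>\<^bsub>A\<^esub> y) = p x \<oplus>\<^bsub>k\<^esub> p y"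
    "p \<one>\<^bsub>A\<^esub> = \<one>\<^bsub>k\<^esub>"
    "\<And>c x. c \<in> carrier k \<Longrightarrow> x \<in> carrier A \<Longrightarrow> p (c \<odot>\<^bsub>A\<^esub> x) = c \<otimes>\<^bsub>k\<^esub> p x"
    "p \<in> extensional (carrier A)"
  shows "p \<in> Pts k A"
  unfolding Pts_def using assms by (auto intro!: alg_homI)

lemma Pts_minus:
  "p \<in> Pts k A \<Longrightarrow> x \<in> carrier A \<Longrightarrow> y \<in> carrier A \<Longrightarrow> p (x \<ominus>\<^bsub>A\<^esub> y) = p x \<ominus>\<^bsub>k\<^esub> p y"
  using ring_hom_cring.hom_a_inv[OF Pts_ring_hom] by (simp add: a_minus_def Pts_hom)

lemma pt_ideal_eq: "pt_ideal k A p = {a \<in> carrier A. p a = \<zero>\<^bsub>k\<^esub>}"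
  by (simp add: pt_ideal_def a_kernel_def')

lemma pt_ideal_ideal: "p \<in> Pts k A \<Longrightarrow> ideal (pt_ideal k A p) A"
  using ring_hom_ring.kernel_is_ideal[OF ring_hom_ringI2[OF ring_axioms k.ring_axioms Pts_hom(1)]]
  by (simp add: pt_ideal_eq a_kernel_def')

text \<open>An element outside the kernel is, up to a scalar, congruent to \<open>1\<close> modulo the kernel.\<close>

lemma pt_ideal_maximal:
  assumes p: "p \<in> Pts k A"
  shows "maximalideal (pt_ideal k A p) A"
proof (rule maximalidealI[OF pt_ideal_ideal[OF p]])
  show "carrier A \<noteq> pt_ideal k A p"
    using Pts_hom(5)[OF p] by (auto simp: pt_ideal_eq set_eq_iff intro!: exI[of _ "\<one>\<^bsub>A\<^esub>"])
  fix J assume J: "ideal J A" "pt_ideal k A p \<subseteq> J" "J \<subseteq> carrier A"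
  interpret J: ideal J A by fact
  show "J = pt_ideal k A p \<or> J = carrier A"
  proof (cases "J \<subseteq> pt_ideal k A p")
    case True
    with J show ?thesis by blast
  next
    case False
    then obtain a where a: "a \<in> J" "a \<in> carrier A" "p a \<noteq> \<zero>\<^bsub>k\<^esub>"
      using J(3) by (auto simp: pt_ideal_eq)
    define c where "c = inv\<^bsub>k\<^esub> (p a)"
    have pa: "p a \<in> Units k" using a Pts_hom(2)[OF p a(2)] by (simp add: k.field_Units)
    then have c: "c \<in> carrier k" by (simp add: c_def)
    have "\<one>\<^bsub>A\<^esub> \<ominus>\<^bsub>A\<^esub> (c \<odot>\<^bsub>A\<^esub> \<one>\<^bsub>A\<^esub>) \<otimes>\<^bsub>A\<^esub> a \<in> pt_ideal k A p"
      using a c pa by (simp add: pt_ideal_eq Pts_minus[OF p] Pts_hom[OF p] c_def k.r_right_minus_eq k.Units_l_inv)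
    then have "\<one>\<^bsub>A\<^esub> \<ominus>\<^bsub>A\<^esub> (c \<odot>\<^bsub>A\<^esub> \<one>\<^bsub>A\<^esub>) \<otimes>\<^bsub>A\<^esub> a \<in> J" using J(2) by blast
    moreover have "(c \<odot>\<^bsub>A\<^esub> \<one>\<^bsub>A\<^esub>) \<otimes>\<^bsub>A\<^esub> a \<in> J" using a c by (auto intro: J.I_l_closed)
    ultimately have "(\<one>\<^bsub>A\<^esub> \<ominus>\<^bsub>A\<^esub> (c \<odot>\<^bsub>A\<^esub> \<one>\<^bsub>A\<^esub>) \<otimes>\<^bsub>A\<^esub> a) \<oplus>\<^bsub>A\<^esub> (c \<odot>\<^bsub>A\<^esub> \<one>\<^bsub>A\<^esub>) \<otimes>\<^bsub>A\<^esub> a \<in> J"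
      by (rule J.a_closed)
    moreover have "(c \<odot>\<^bsub>A\<^esub> \<one>\<^bsub>A\<^esub>) \<otimes>\<^bsub>A\<^esub> a \<in> carrier A" using a c by simp
    ultimately have "\<one>\<^bsub>A\<^esub> \<in> J" by (simp add: a_minus_def a_assoc l_neg)
    then show ?thesis using J.one_imp_carrier by blast
  qed
qed

text \<open>The value of \<open>p\<close> at \<open>a\<close> is the only scalar \<open>c\<close> for which \<open>a - c\<close> lies in the kernel.\<close>

lemma pt_ideal_inj: "inj_on (pt_ideal k A) (Pts k A)"
proof (rule inj_onI)
  fix p q assume p: "p \<in> Pts k A" and q: "q \<in> Pts k A" and eq: "pt_ideal k A p = pt_ideal k A q"
  have "p a = q a" if a: "a \<in> carrier A" for a
  proof -
    have c: "p a \<in> carrier k" "q a \<in> carrier k" using Pts_hom(2) p q a by auto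
    have "a \<ominus>\<^bsub>A\<^esub> p a \<odot>\<^bsub>A\<^esub> \<one>\<^bsub>A\<^esub> \<in> pt_ideal k A p"
      using a c by (simp add: pt_ideal_eq Pts_minus[OF p] Pts_hom[OF p] k.r_right_minus_eq)
    then have "a \<ominus>\<^bsub>A\<^esub> p a \<odot>\<^bsub>A\<^esub> \<one>\<^bsub>A\<^esub> \<in> pt_ideal k A q" by (simp add: eq)
    then have "q a \<ominus>\<^bsub>k\<^esub> p a = \<zero>\<^bsub>k\<^esub>"
      using a c by (simp add: pt_ideal_eq Pts_minus[OF q] Pts_hom[OF q])
    then show ?thesis using c by (simp add: k.r_right_minus_eq)
  qed
  then show "p = q"
    using p q by (auto simp: Pts_def intro: extensionalityI)
qed

lemma non_zeros_eq: "carrier A - pt_ideal k A p = {a \<in> carrier A. p a \<noteq> \<zero>\<^bsub>k\<^esub>}"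
  by (auto simp: pt_ideal_eq)

lemma localized_at_point:
  assumes p: "p \<in> Pts k A"
  shows "localized_algebra k A (carrier A - pt_ideal k A p)"
  by (unfold_locales) (auto simp: pt_ideal_eq Pts_hom[OF p] k.integral_iff)

lemma local_alg_algebra: "p \<in> Pts k A \<Longrightarrow> algebra k (local_alg k A p)"
  unfolding local_alg_def by (rule localized_algebra.loc_algebra[OF localized_at_point])

lemma topspace_Pts_topology: "topspace (Pts_topology k A) = Pts k A"
proof -
  let ?B = "\<lambda>U. \<exists>f \<in> carrier A. U = basic_open k A f"
  have one: "basic_open k A \<one>\<^bsub>A\<^esub> = Pts k A"
    by (auto simp: basic_open_def Pts_hom)
  have inter: "basic_open k A f \<inter> basic_open k A g = basic_open k A (f \<otimes>\<^bsub>A\<^esub> g)"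
    if "f \<in> carrier A" "g \<in> carrier A" for f g
    using that by (auto simp: basic_open_def Pts_hom k.integral_iff)
  have "istopology (arbitrary union_of ?B)"
  proof (rule istopology_base)
    fix S T assume "?B S" "?B T"
    then show "?B (S \<inter> T)" using inter by blast
  qed
  then have open_iff: "openin (Pts_topology k A) U \<longleftrightarrow> (arbitrary union_of ?B) U" for U
    unfolding Pts_topology_def by (simp add: topology_inverse')
  have "openin (Pts_topology k A) (Pts k A)"
    unfolding open_iff using one by (intro union_of_inc) (auto simp: arbitrary_def intro: bexI[of _ "\<one>\<^bsub>A\<^esub>"])
  moreover have "U \<subseteq> Pts k A" if "openin (Pts_topology k A) U" for U
    using that unfolding open_iff union_of_def by (auto simp: basic_open_def)
  ultimately show ?thesis
    unfolding topspace_def by blast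
qed

lemma global_sections_eq: "global_sections k A = str_sheaf k A (Pts k A)"
  by (simp add: global_sections_def topspace_Pts_topology)

end

context algebra_over_field
begin

section \<open>Global sections as fractions\<close>

definition nowhere_zero :: "'a set"
  where "nowhere_zero = {s \<in> carrier A. \<forall>p \<in> Pts k A. p s \<noteq> \<zero>\<^bsub>k\<^esub>}"

text \<open>The section given by the fraction \<open>a / s\<close>: its germs at all points.\<close>

definition sect :: "'a \<Rightarrow> 'a \<Rightarrow> ('a \<Rightarrow> 'k) \<Rightarrow> ('a \<times> 'a) set"
  where "sect a s = (\<lambda>p \<in> Pts k A. fraction A (carrier A - pt_ideal k A p) a s)"

lemma nowhere_zero_carrier: "s \<in> nowhere_zero \<Longrightarrow> s \<in> carrier A"
  by (simp add: nowhere_zero_def)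

lemma nowhere_zero_at: "s \<in> nowhere_zero \<Longrightarrow> p \<in> Pts k A \<Longrightarrow> s \<in> carrier A - pt_ideal k A p"
  by (simp add: nowhere_zero_def non_zeros_eq)

lemma nowhere_zero_one: "\<one>\<^bsub>A\<^esub> \<in> nowhere_zero"
  by (simp add: nowhere_zero_def Pts_hom)

lemma nowhere_zero_mult: "s \<in> nowhere_zero \<Longrightarrow> t \<in> nowhere_zero \<Longrightarrow> s \<otimes>\<^bsub>A\<^esub> t \<in> nowhere_zero"
  by (simp add: nowhere_zero_def Pts_hom k.integral_iff)

lemma stalk_prod_algebra: "algebra k (stalk_prod k A (Pts k A))"
  unfolding stalk_prod_def by (intro prod_alg_algebra R_cring local_alg_algebra)

lemmas local_rules = localized_algebra.frc_closed[OF localized_at_point]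
  localized_algebra.loc_mult[OF localized_at_point] localized_algebra.loc_add[OF localized_at_point]
  localized_algebra.loc_smult[OF localized_at_point] localized_algebra.loc_one[OF localized_at_point]
  localized_algebra.loc_zero[OF localized_at_point]

lemma sect_at: "p \<in> Pts k A \<Longrightarrow> sect a s p = fraction A (carrier A - pt_ideal k A p) a s"
  by (simp add: sect_def)

lemma sect_eqI:
  assumes "a \<in> carrier A" "s \<in> nowhere_zero" "b \<in> carrier A" "t \<in> nowhere_zero"
    "a \<otimes>\<^bsub>A\<^esub> t = b \<otimes>\<^bsub>A\<^esub> s"
  shows "sect a s = sect b t"
  unfolding sect_def using assms
  by (intro restrict_ext localized_algebra.frc_eqI[OF localized_at_point] nowhere_zero_at)

lemma sect_mult:
  assumes "a \<in> carrier A" "s \<in> nowhere_zero" "b \<in> carrier A" "t \<in> nowhere_zero"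
  shows "sect a s \<otimes>\<^bsub>stalk_prod k A (Pts k A)\<^esub> sect b t = sect (a \<otimes>\<^bsub>A\<^esub> b) (s \<otimes>\<^bsub>A\<^esub> t)"
  unfolding stalk_prod_def prod_alg_simps sect_def local_alg_def using assms
  by (intro restrict_ext) (simp add: local_rules(2) nowhere_zero_at del: Diff_iff)

lemma sect_add:
  assumes "a \<in> carrier A" "s \<in> nowhere_zero" "b \<in> carrier A" "t \<in> nowhere_zero"
  shows "sect a s \<oplus>\<^bsub>stalk_prod k A (Pts k A)\<^esub> sect b t =
    sect (a \<otimes>\<^bsub>A\<^esub> t \<oplus>\<^bsub>A\<^esub> b \<otimes>\<^bsub>A\<^esub> s) (s \<otimes>\<^bsub>A\<^esub> t)"
  unfolding stalk_prod_def prod_alg_simps sect_def local_alg_def using assms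
  by (intro restrict_ext) (simp add: local_rules(3) nowhere_zero_at del: Diff_iff)

lemma sect_smult:
  assumes "c \<in> carrier k" "a \<in> carrier A" "s \<in> nowhere_zero"
  shows "c \<odot>\<^bsub>stalk_prod k A (Pts k A)\<^esub> sect a s = sect (c \<odot>\<^bsub>A\<^esub> a) s"
  unfolding stalk_prod_def prod_alg_simps sect_def local_alg_def using assms
  by (intro restrict_ext) (simp add: local_rules(4) nowhere_zero_at del: Diff_iff)

lemma sect_one: "\<one>\<^bsub>stalk_prod k A (Pts k A)\<^esub> = sect \<one>\<^bsub>A\<^esub> \<one>\<^bsub>A\<^esub>"
  unfolding stalk_prod_def prod_alg_simps sect_def local_alg_def
  by (intro restrict_ext) (simp add: local_rules(5))

lemma sect_closed:
  "a \<in> carrier A \<Longrightarrow> s \<in> nowhere_zero \<Longrightarrow> sect a s \<in> carrier (stalk_prod k A (Pts k A))"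
  unfolding stalk_prod_def prod_alg_simps sect_def local_alg_def
  by (simp add: restrict_PiE_iff local_rules(1) nowhere_zero_at del: Diff_iff)

lemma rho_eq_sect: "rho k A (Pts k A) a = sect a \<one>\<^bsub>A\<^esub>"
  by (simp add: rho_def sect_def)

lemma sect_inverse:
  assumes "s \<in> nowhere_zero"
  shows "sect s \<one>\<^bsub>A\<^esub> \<otimes>\<^bsub>stalk_prod k A (Pts k A)\<^esub> sect \<one>\<^bsub>A\<^esub> s = \<one>\<^bsub>stalk_prod k A (Pts k A)\<^esub>"
  using assms nowhere_zero_carrier[OF assms] nowhere_zero_one
  by (auto simp: sect_mult sect_one intro!: sect_eqI nowhere_zero_mult)

text \<open>A germ at \<open>p\<close> of an element that \<open>p\<close> kills lies in the maximal ideal of the local ring at \<open>p\<close>.\<close>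

lemma unit_rho_iff:
  assumes "a \<in> carrier A"
  shows "rho k A (Pts k A) a \<in> Units (stalk_prod k A (Pts k A)) \<longleftrightarrow> a \<in> nowhere_zero"
proof
  interpret P: algebra k "stalk_prod k A (Pts k A)" by (rule stalk_prod_algebra)
  {
    assume "a \<in> nowhere_zero"
    then show "rho k A (Pts k A) a \<in> Units (stalk_prod k A (Pts k A))"
      using sect_inverse sect_closed[OF assms nowhere_zero_one] sect_closed[OF one_closed]
        P.m_comm[of "sect a \<one>\<^bsub>A\<^esub>" "sect \<one>\<^bsub>A\<^esub> a"]
      unfolding rho_eq_sect Units_def by auto
  next
    assume "rho k A (Pts k A) a \<in> Units (stalk_prod k A (Pts k A))"
    then obtain y where y: "y \<in> carrier (stalk_prod k A (Pts k A))"
      "sect a \<one>\<^bsub>A\<^esub> \<otimes>\<^bsub>stalk_prod k A (Pts k A)\<^esub> y = \<one>\<^bsub>stalk_prod k A (Pts k A)\<^esub>"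
      unfolding rho_eq_sect Units_def by auto
    have "p a \<noteq> \<zero>\<^bsub>k\<^esub>" if p: "p \<in> Pts k A" for p
    proof
      assume pa: "p a = \<zero>\<^bsub>k\<^esub>"
      let ?D = "carrier A - pt_ideal k A p"
      interpret L: localized_algebra k A ?D by (rule localized_at_point[OF p])
      from y(1) p have "y p \<in> carrier (localization A ?D)"
        by (auto simp: stalk_prod_def local_alg_def)
      then obtain b t where b: "b \<in> carrier A" "t \<in> ?D" "y p = fraction A ?D b t"
        by (rule L.loc_cases)
      from fun_cong[OF y(2), of p] p have "fraction A ?D a \<one>\<^bsub>A\<^esub> \<otimes>\<^bsub>localization A ?D\<^esub> y p =
          fraction A ?D \<one>\<^bsub>A\<^esub> \<one>\<^bsub>A\<^esub>"
        by (simp add: stalk_prod_def local_alg_def sect_at local_rules(5))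
      then have "fraction A ?D (a \<otimes>\<^bsub>A\<^esub> b) t = fraction A ?D \<one>\<^bsub>A\<^esub> \<one>\<^bsub>A\<^esub>"
        using L.loc_mult[OF assms L.denominators(2) b(1,2)] b L.S_carrier by simp
      then obtain u where u: "u \<in> ?D" "u \<otimes>\<^bsub>A\<^esub> (a \<otimes>\<^bsub>A\<^esub> b \<otimes>\<^bsub>A\<^esub> \<one>\<^bsub>A\<^esub>) = u \<otimes>\<^bsub>A\<^esub> (\<one>\<^bsub>A\<^esub> \<otimes>\<^bsub>A\<^esub> t)"
        using L.frc_eq_iff[of "a \<otimes>\<^bsub>A\<^esub> b" t "\<one>\<^bsub>A\<^esub>" "\<one>\<^bsub>A\<^esub>"] assms b L.denominators(2) by auto
      have car: "u \<in> carrier A" "t \<in> carrier A" using u(1) b(2) by auto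
      have ut: "u \<otimes>\<^bsub>A\<^esub> (a \<otimes>\<^bsub>A\<^esub> b) = u \<otimes>\<^bsub>A\<^esub> t" using u(2) assms b(1) car by simp
      have "p u \<otimes>\<^bsub>k\<^esub> p t = p u \<otimes>\<^bsub>k\<^esub> (p a \<otimes>\<^bsub>k\<^esub> p b)"
        using arg_cong[OF ut, of p] car assms b(1) by (simp add: Pts_hom[OF p])
      then have "p u \<otimes>\<^bsub>k\<^esub> p t = \<zero>\<^bsub>k\<^esub>"
        using pa car b(1) by (simp add: Pts_hom[OF p])
      then show False using u b by (auto simp: non_zeros_eq Pts_hom[OF p] k.integral_iff)
    qed
    then show "a \<in> nowhere_zero" using assms by (simp add: nowhere_zero_def)
  }
qed

lemma inv_rho:
  assumes "s \<in> nowhere_zero"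
  shows "inv\<^bsub>stalk_prod k A (Pts k A)\<^esub> (rho k A (Pts k A) s) = sect \<one>\<^bsub>A\<^esub> s"
proof -
  interpret P: algebra k "stalk_prod k A (Pts k A)" by (rule stalk_prod_algebra)
  show ?thesis
    unfolding rho_eq_sect
    by (rule P.comm_inv_char)
      (use assms sect_inverse sect_closed nowhere_zero_carrier nowhere_zero_one in auto)
qed

lemma inverted_units_eq: "inverted_units k A (Pts k A) = sect \<one>\<^bsub>A\<^esub> ` nowhere_zero"
proof (intro equalityI subsetI)
  fix y assume "y \<in> inverted_units k A (Pts k A)"
  then obtain a where a: "a \<in> carrier A" "rho k A (Pts k A) a \<in> Units (stalk_prod k A (Pts k A))"
    "y = inv\<^bsub>stalk_prod k A (Pts k A)\<^esub> (rho k A (Pts k A) a)"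
    by (auto simp: inverted_units_def)
  then have "a \<in> nowhere_zero" by (simp add: unit_rho_iff)
  with a inv_rho show "y \<in> sect \<one>\<^bsub>A\<^esub> ` nowhere_zero" by blast
next
  fix y assume "y \<in> sect \<one>\<^bsub>A\<^esub> ` nowhere_zero"
  then obtain s where s: "s \<in> nowhere_zero" "y = sect \<one>\<^bsub>A\<^esub> s" by blast
  then have "s \<in> carrier A" "y = inv\<^bsub>stalk_prod k A (Pts k A)\<^esub> (rho k A (Pts k A) s)"
    "rho k A (Pts k A) s \<in> Units (stalk_prod k A (Pts k A))"
    by (simp_all add: inv_rho unit_rho_iff nowhere_zero_carrier)
  then show "y \<in> inverted_units k A (Pts k A)"
    by (auto simp: inverted_units_def)
qed

lemma sections_subalg:
  "subalg k (stalk_prod k A (Pts k A)) {sect a s | a s. a \<in> carrier A \<and> s \<in> nowhere_zero}"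
    (is "subalg k ?P ?B")
proof -
  interpret P: algebra k ?P by (rule stalk_prod_algebra)
  note C = nowhere_zero_carrier nowhere_zero_one nowhere_zero_mult
  have sm: "c \<odot>\<^bsub>?P\<^esub> x \<in> ?B" if c: "c \<in> carrier k" and x: "x \<in> ?B" for c x
  proof -
    from x obtain a s where x: "x = sect a s" "a \<in> carrier A" "s \<in> nowhere_zero" by blast
    then have "c \<odot>\<^bsub>?P\<^esub> x = sect (c \<odot>\<^bsub>A\<^esub> a) s" using c by (simp add: sect_smult)
    then show ?thesis using x c by blast
  qed
  have "subring ?B ?P"
  proof (rule P.subringI)
    show sub: "?B \<subseteq> carrier ?P" using sect_closed by blast
    show "\<one>\<^bsub>?P\<^esub> \<in> ?B" using sect_one C by blast
    show "\<ominus>\<^bsub>?P\<^esub> x \<in> ?B" if x: "x \<in> ?B" for x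
    proof -
      have xc: "x \<in> carrier ?P" using x sub by (rule subsetD[rotated])
      have "(\<ominus>\<^bsub>k\<^esub> \<one>\<^bsub>k\<^esub>) \<odot>\<^bsub>?P\<^esub> x = \<ominus>\<^bsub>?P\<^esub> x"
        using xc by (simp add: P.smult_l_minus)
      with sm[OF _ x, of "\<ominus>\<^bsub>k\<^esub> \<one>\<^bsub>k\<^esub>"] show ?thesis by simp
    qed
    fix x y assume "x \<in> ?B" "y \<in> ?B"
    then obtain a s b t where xy: "x = sect a s" "y = sect b t"
      "a \<in> carrier A" "s \<in> nowhere_zero" "b \<in> carrier A" "t \<in> nowhere_zero" by blast
    have "x \<otimes>\<^bsub>?P\<^esub> y = sect (a \<otimes>\<^bsub>A\<^esub> b) (s \<otimes>\<^bsub>A\<^esub> t)"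
      "x \<oplus>\<^bsub>?P\<^esub> y = sect (a \<otimes>\<^bsub>A\<^esub> t \<oplus>\<^bsub>A\<^esub> b \<otimes>\<^bsub>A\<^esub> s) (s \<otimes>\<^bsub>A\<^esub> t)"
      using xy by (simp_all add: sect_mult sect_add)
    moreover have "a \<otimes>\<^bsub>A\<^esub> b \<in> carrier A" "a \<otimes>\<^bsub>A\<^esub> t \<oplus>\<^bsub>A\<^esub> b \<otimes>\<^bsub>A\<^esub> s \<in> carrier A" "s \<otimes>\<^bsub>A\<^esub> t \<in> nowhere_zero"
      using xy C by auto
    ultimately show "x \<otimes>\<^bsub>?P\<^esub> y \<in> ?B" "x \<oplus>\<^bsub>?P\<^esub> y \<in> ?B" by blast+
  qed
  with sm show ?thesis unfolding subalg_def by blast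
qed

text \<open>The generators are the fractions \<open>a / 1\<close> and \<open>1 / s\<close>, and their products already form a subalgebra.\<close>

lemma pts_alg_carrier:
  "carrier (pts_alg k A) = {sect a s | a s. a \<in> carrier A \<and> s \<in> nowhere_zero}" (is "_ = ?B")
proof -
  let ?P = "stalk_prod k A (Pts k A)" and ?G = "rho k A (Pts k A) ` carrier A \<union> inverted_units k A (Pts k A)"
  have "generated_subalg k ?P ?G = ?B"
  proof
    have "?G \<subseteq> ?B"
      unfolding inverted_units_eq rho_eq_sect using nowhere_zero_one by blast
    then show "generated_subalg k ?P ?G \<subseteq> ?B"
      unfolding generated_subalg_def using sections_subalg by blast
    show "?B \<subseteq> generated_subalg k ?P ?G"
      unfolding generated_subalg_def
    proof (intro subsetI InterI)
      fix x C assume "x \<in> ?B" and C: "C \<in> {B. subalg k ?P B \<and> ?G \<subseteq> B}"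
      then obtain a s where x: "x = sect a s" "a \<in> carrier A" "s \<in> nowhere_zero" by blast
      have "sect a \<one>\<^bsub>A\<^esub> \<in> C" "sect \<one>\<^bsub>A\<^esub> s \<in> C"
        using C x unfolding inverted_units_eq rho_eq_sect by blast+
      moreover have "x = sect a \<one>\<^bsub>A\<^esub> \<otimes>\<^bsub>?P\<^esub> sect \<one>\<^bsub>A\<^esub> s"
        using x nowhere_zero_one by (simp add: sect_mult nowhere_zero_carrier)
      ultimately show "x \<in> C"
        using C unfolding subalg_def by (simp add: subringE(6))
    qed
  qed
  then show ?thesis by (simp add: pts_alg_def str_sheaf_def)
qed

lemma pts_alg_ops:
  "monoid.mult (pts_alg k A) = monoid.mult (stalk_prod k A (Pts k A))"
  "add (pts_alg k A) = add (stalk_prod k A (Pts k A))"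
  "one (pts_alg k A) = one (stalk_prod k A (Pts k A))"
  "zero (pts_alg k A) = zero (stalk_prod k A (Pts k A))"
  "smult (pts_alg k A) = smult (stalk_prod k A (Pts k A))"
  by (simp_all add: pts_alg_def str_sheaf_def)

lemma pts_alg_algebra: "algebra k (pts_alg k A)"
proof -
  have "pts_alg k A = (stalk_prod k A (Pts k A))
      \<lparr>carrier := {sect a s | a s. a \<in> carrier A \<and> s \<in> nowhere_zero}\<rparr>"
    unfolding pts_alg_carrier[symmetric] by (simp add: pts_alg_def str_sheaf_def)
  then show ?thesis
    using subalg_algebra[OF stalk_prod_algebra sections_subalg] by simp
qed

lemma pts_alg_cases:
  assumes "x \<in> carrier (pts_alg k A)"
  obtains a s where "a \<in> carrier A" "s \<in> nowhere_zero" "x = sect a s"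
  using assms by (auto simp: pts_alg_carrier)

lemma pts_alg_sect_closed: "a \<in> carrier A \<Longrightarrow> s \<in> nowhere_zero \<Longrightarrow> sect a s \<in> carrier (pts_alg k A)"
  by (auto simp: pts_alg_carrier)

lemmas pts_alg_rules = sect_mult[folded pts_alg_ops] sect_add[folded pts_alg_ops]
  sect_smult[folded pts_alg_ops] sect_one[folded pts_alg_ops] sect_inverse[folded pts_alg_ops]

lemma rho_hom: "rho k A (Pts k A) \<in> alg_hom k A (pts_alg k A)"
  unfolding rho_eq_sect
  by (rule alg_homI) (auto simp: pts_alg_rules nowhere_zero_one intro: pts_alg_sect_closed)

section \<open>Points and local rings of the algebra of global sections\<close>

text \<open>The extension of the point \<open>q\<close> to global sections.  A section is evaluated at \<open>q\<close> through a
representative of its germ, which is the class \<open>x q\<close> of pairs.\<close>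

definition point_value :: "('a \<Rightarrow> 'k) \<Rightarrow> (('a \<Rightarrow> 'k) \<Rightarrow> ('a \<times> 'a) set) \<Rightarrow> 'k"
  where "point_value q = (\<lambda>x \<in> carrier (pts_alg k A). let (a, s) = SOME y. y \<in> x q in q a \<otimes>\<^bsub>k\<^esub> inv\<^bsub>k\<^esub> q s)"

lemma point_inv:
  assumes "q \<in> Pts k A" "s \<in> carrier A - pt_ideal k A q"
  shows "q s \<in> carrier k" "inv\<^bsub>k\<^esub> q s \<in> carrier k" "q s \<otimes>\<^bsub>k\<^esub> inv\<^bsub>k\<^esub> q s = \<one>\<^bsub>k\<^esub>"
proof -
  have "q s \<in> Units k" using assms by (simp add: non_zeros_eq k.field_Units Pts_hom)
  then show "q s \<in> carrier k" "inv\<^bsub>k\<^esub> q s \<in> carrier k" "q s \<otimes>\<^bsub>k\<^esub> inv\<^bsub>k\<^esub> q s = \<one>\<^bsub>k\<^esub>"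
    by (simp_all add: k.Units_closed)
qed

lemma point_value_sect:
  assumes q: "q \<in> Pts k A" and a: "a \<in> carrier A" and s: "s \<in> nowhere_zero"
  shows "point_value q (sect a s) = q a \<otimes>\<^bsub>k\<^esub> inv\<^bsub>k\<^esub> q s"
proof -
  let ?D = "carrier A - pt_ideal k A q"
  interpret L: localized_algebra k A ?D by (rule localized_at_point[OF q])
  have sD: "s \<in> ?D" using nowhere_zero_at s q by blast
  obtain b t where bt: "(SOME y. y \<in> fraction A ?D a s) = (b, t)" by fastforce
  have "(b, t) \<in> fraction A ?D a s"
    unfolding bt[symmetric] by (rule someI) (rule L.frc_self[OF a sD])
  then obtain u where b: "b \<in> carrier A" "t \<in> ?D" "u \<in> ?D"
    and eq: "u \<otimes>\<^bsub>A\<^esub> (b \<otimes>\<^bsub>A\<^esub> s) = u \<otimes>\<^bsub>A\<^esub> (a \<otimes>\<^bsub>A\<^esub> t)"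
    using a sD by (auto simp: L.mem_frc_iff L.frc_eq_iff)
  have u: "u \<in> carrier A" "t \<in> carrier A" "s \<in> carrier A" "q u \<noteq> \<zero>\<^bsub>k\<^esub>"
    using b sD by (auto simp: non_zeros_eq)
  note c = Pts_hom(2)[OF q a] Pts_hom(2)[OF q b(1)] Pts_hom(2)[OF q u(1)] point_inv[OF q sD] point_inv[OF q b(2)]
  have "q u \<otimes>\<^bsub>k\<^esub> (q b \<otimes>\<^bsub>k\<^esub> q s) = q u \<otimes>\<^bsub>k\<^esub> (q a \<otimes>\<^bsub>k\<^esub> q t)"
    using arg_cong[OF eq, of q] a b u by (simp add: Pts_hom[OF q])
  then have eq': "q b \<otimes>\<^bsub>k\<^esub> q s = q a \<otimes>\<^bsub>k\<^esub> q t"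
    using c u(4) by (simp add: k.m_lcancel)
  have "q b \<otimes>\<^bsub>k\<^esub> inv\<^bsub>k\<^esub> q t = (q b \<otimes>\<^bsub>k\<^esub> q s) \<otimes>\<^bsub>k\<^esub> inv\<^bsub>k\<^esub> q s \<otimes>\<^bsub>k\<^esub> inv\<^bsub>k\<^esub> q t"
    using c by (simp add: k.m_assoc)
  also have "\<dots> = (q a \<otimes>\<^bsub>k\<^esub> inv\<^bsub>k\<^esub> q s) \<otimes>\<^bsub>k\<^esub> (q t \<otimes>\<^bsub>k\<^esub> inv\<^bsub>k\<^esub> q t)"
    unfolding eq' using c(1,4-8) by (simp only: k.m_closed k.m_ac)
  finally have "q b \<otimes>\<^bsub>k\<^esub> inv\<^bsub>k\<^esub> q t = q a \<otimes>\<^bsub>k\<^esub> inv\<^bsub>k\<^esub> q s" using c by simp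
  then show ?thesis
    using bt q a s by (simp add: point_value_def pts_alg_sect_closed sect_at)
qed

lemma point_value_Pts:
  assumes q: "q \<in> Pts k A"
  shows "point_value q \<in> Pts k (pts_alg k A)"
proof -
  interpret B: algebra_over_field k "pts_alg k A"
    by (intro algebra_over_field.intro k.field_axioms pts_alg_algebra)
  have inv_mult: "inv\<^bsub>k\<^esub> (x \<otimes>\<^bsub>k\<^esub> y) = inv\<^bsub>k\<^esub> x \<otimes>\<^bsub>k\<^esub> inv\<^bsub>k\<^esub> y"
    if "x \<in> carrier k" "y \<in> carrier k" "inv\<^bsub>k\<^esub> x \<in> carrier k" "inv\<^bsub>k\<^esub> y \<in> carrier k"
      "x \<otimes>\<^bsub>k\<^esub> inv\<^bsub>k\<^esub> x = \<one>\<^bsub>k\<^esub>" "y \<otimes>\<^bsub>k\<^esub> inv\<^bsub>k\<^esub> y = \<one>\<^bsub>k\<^esub>" for x y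
  proof (rule k.comm_inv_char)
    have "x \<otimes>\<^bsub>k\<^esub> y \<otimes>\<^bsub>k\<^esub> (inv\<^bsub>k\<^esub> x \<otimes>\<^bsub>k\<^esub> inv\<^bsub>k\<^esub> y) = (x \<otimes>\<^bsub>k\<^esub> inv\<^bsub>k\<^esub> x) \<otimes>\<^bsub>k\<^esub> (y \<otimes>\<^bsub>k\<^esub> inv\<^bsub>k\<^esub> y)"
      using that(1-4) by (simp only: k.m_closed k.m_ac)
    then show "x \<otimes>\<^bsub>k\<^esub> y \<otimes>\<^bsub>k\<^esub> (inv\<^bsub>k\<^esub> x \<otimes>\<^bsub>k\<^esub> inv\<^bsub>k\<^esub> y) = \<one>\<^bsub>k\<^esub>" using that by simp
  qed (use that in auto)
  note C = nowhere_zero_one nowhere_zero_mult nowhere_zero_carrier Pts_hom[OF q] point_value_sect[OF q]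
    point_inv[OF q nowhere_zero_at[OF _ q]]
  show ?thesis
  proof (rule B.PtsI)
    fix x assume "x \<in> carrier (pts_alg k A)"
    then obtain a s where x: "x = sect a s" "a \<in> carrier A" "s \<in> nowhere_zero" by (rule pts_alg_cases)
    then show "point_value q x \<in> carrier k" by (simp add: C)
    show "point_value q (c \<odot>\<^bsub>pts_alg k A\<^esub> x) = c \<otimes>\<^bsub>k\<^esub> point_value q x" if "c \<in> carrier k" for c
      using that x by (simp add: C pts_alg_rules k.m_assoc)
    fix y assume "y \<in> carrier (pts_alg k A)"
    then obtain b t where y: "y = sect b t" "b \<in> carrier A" "t \<in> nowhere_zero" by (rule pts_alg_cases)
    have c: "q a \<in> carrier k" "q b \<in> carrier k" "q s \<in> carrier k" "q t \<in> carrier k"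
      "inv\<^bsub>k\<^esub> q s \<in> carrier k" "inv\<^bsub>k\<^esub> q t \<in> carrier k" using x y by (simp_all add: C)
    have inv_st: "inv\<^bsub>k\<^esub> (q s \<otimes>\<^bsub>k\<^esub> q t) = inv\<^bsub>k\<^esub> q s \<otimes>\<^bsub>k\<^esub> inv\<^bsub>k\<^esub> q t"
      using x y by (intro inv_mult) (simp_all add: C)
    show "point_value q (x \<otimes>\<^bsub>pts_alg k A\<^esub> y) = point_value q x \<otimes>\<^bsub>k\<^esub> point_value q y"
      using x y c by (simp add: C pts_alg_rules inv_st k.m_ac)
    have "(q a \<otimes>\<^bsub>k\<^esub> q t \<oplus>\<^bsub>k\<^esub> q b \<otimes>\<^bsub>k\<^esub> q s) \<otimes>\<^bsub>k\<^esub> (inv\<^bsub>k\<^esub> q s \<otimes>\<^bsub>k\<^esub> inv\<^bsub>k\<^esub> q t) =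
      q a \<otimes>\<^bsub>k\<^esub> inv\<^bsub>k\<^esub> q s \<otimes>\<^bsub>k\<^esub> (q t \<otimes>\<^bsub>k\<^esub> inv\<^bsub>k\<^esub> q t) \<oplus>\<^bsub>k\<^esub> q b \<otimes>\<^bsub>k\<^esub> inv\<^bsub>k\<^esub> q t \<otimes>\<^bsub>k\<^esub> (q s \<otimes>\<^bsub>k\<^esub> inv\<^bsub>k\<^esub> q s)"
      using c by algebra
    then show "point_value q (x \<oplus>\<^bsub>pts_alg k A\<^esub> y) = point_value q x \<oplus>\<^bsub>k\<^esub> point_value q y"
      using x y c by (simp add: C pts_alg_rules inv_st)
  next
    show "point_value q \<one>\<^bsub>pts_alg k A\<^esub> = \<one>\<^bsub>k\<^esub>"
      using point_inv(3)[OF q nowhere_zero_at[OF nowhere_zero_one q]]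
      by (simp add: pts_alg_rules C)
  qed (simp add: point_value_def)
qed

lemma compose_rho_Pts:
  assumes "p \<in> Pts k (pts_alg k A)"
  shows "compose (carrier A) p (rho k A (Pts k A)) \<in> Pts k A"
proof -
  interpret B: algebra_over_field k "pts_alg k A"
    by (intro algebra_over_field.intro k.field_axioms pts_alg_algebra)
  show ?thesis
    by (rule PtsI)
      (auto simp: compose_def alg_homD[OF rho_hom] B.Pts_hom[OF assms])
qed

text \<open>The map \<open>a / s \<mapsto> \<rho> a / \<rho> s\<close> from the local ring of \<open>A\<close> at \<open>q\<close> to that of \<open>A\<^sub>k\<close> at \<open>p\<close> is an
isomorphism.  It is onto because \<open>(a / s) / (b / t)\<close> is the image of \<open>a t / b s\<close>.  It is injective
because an equation between global sections holds in particular for their germs at \<open>q\<close>, that is, in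
the local ring of \<open>A\<close> at \<open>q\<close> that is to be recovered.\<close>

lemma local_iso:
  assumes p: "p \<in> Pts k (pts_alg k A)"
  defines "q \<equiv> compose (carrier A) p (rho k A (Pts k A))"
  shows "alg_isomorphic k (local_alg k (pts_alg k A) p) (local_alg k A q)"
proof -
  interpret B: algebra_over_field k "pts_alg k A"
    by (intro algebra_over_field.intro k.field_axioms pts_alg_algebra)
  let ?B = "pts_alg k A" and ?\<rho> = "rho k A (Pts k A)"
  let ?S = "carrier A - pt_ideal k A q" and ?T = "carrier ?B - pt_ideal k ?B p"
  let ?h = "localization_map ?B ?T ?\<rho>"
  have q: "q \<in> Pts k A" unfolding q_def by (rule compose_rho_Pts[OF p])
  have q_eq: "q a = p (sect a \<one>\<^bsub>A\<^esub>)" if "a \<in> carrier A" for a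
    using that by (simp add: q_def compose_def rho_eq_sect)
  interpret L: localized_algebra k A ?S by (rule localized_at_point[OF q])
  interpret M: localized_algebra k ?B ?T by (rule B.localized_at_point[OF p])
  note C = nowhere_zero_one nowhere_zero_mult nowhere_zero_carrier pts_alg_sect_closed
  have \<rho>T: "?\<rho> s \<in> ?T" if "s \<in> ?S" for s
    using that alg_homD(2)[OF rho_hom]
    by (auto simp: non_zeros_eq B.non_zeros_eq q_eq rho_eq_sect)
  have sT: "sect s \<one>\<^bsub>A\<^esub> \<in> ?T" if "s \<in> ?S" for s
    using \<rho>T[OF that] by (simp add: rho_eq_sect)
  note map_frac = localization_map_fraction[OF L.localized_algebra_axioms M.localized_algebra_axioms rho_hom \<rho>T]
  have p_sect: "p (sect a s) \<otimes>\<^bsub>k\<^esub> q s = q a" if "a \<in> carrier A" "s \<in> nowhere_zero" for a s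
  proof -
    have "sect a s \<otimes>\<^bsub>?B\<^esub> sect s \<one>\<^bsub>A\<^esub> = sect a \<one>\<^bsub>A\<^esub>"
      using that by (simp add: pts_alg_rules C) (rule sect_eqI, auto simp: C m_ac)
    with B.Pts_hom(3)[OF p, of "sect a s" "sect s \<one>\<^bsub>A\<^esub>"] that show ?thesis by (simp add: C q_eq)
  qed
  have inj: "inj_on ?h (carrier (localization A ?S))"
  proof (rule inj_onI)
    fix x y assume "x \<in> carrier (localization A ?S)" "y \<in> carrier (localization A ?S)" and eq: "?h x = ?h y"
    then obtain a s b t where x: "a \<in> carrier A" "s \<in> ?S" "x = fraction A ?S a s"
      and y: "b \<in> carrier A" "t \<in> ?S" "y = fraction A ?S b t" by (metis L.loc_cases)
    have st: "s \<in> carrier A" "t \<in> carrier A" using x y by auto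
    from eq obtain z where z: "z \<in> ?T"
      "z \<otimes>\<^bsub>?B\<^esub> (sect a \<one>\<^bsub>A\<^esub> \<otimes>\<^bsub>?B\<^esub> sect t \<one>\<^bsub>A\<^esub>) = z \<otimes>\<^bsub>?B\<^esub> (sect b \<one>\<^bsub>A\<^esub> \<otimes>\<^bsub>?B\<^esub> sect s \<one>\<^bsub>A\<^esub>)"
      using x(1,2) y(1,2) M.frc_eq_iff[of "sect a \<one>\<^bsub>A\<^esub>" "sect s \<one>\<^bsub>A\<^esub>" "sect b \<one>\<^bsub>A\<^esub>" "sect t \<one>\<^bsub>A\<^esub>"]
        sT unfolding x(3) y(3) by (auto simp: map_frac rho_eq_sect C simp del: Diff_iff)
    from z(1) obtain c r where c: "c \<in> carrier A" "r \<in> nowhere_zero" "z = sect c r"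
      by (metis DiffD1 pts_alg_cases)
    have "p z \<noteq> \<zero>\<^bsub>k\<^esub>" using z(1) by (auto simp: B.non_zeros_eq)
    then have "q c \<noteq> \<zero>\<^bsub>k\<^esub>"
      using p_sect[OF c(1,2)] c q nowhere_zero_at[OF c(2) q] B.Pts_hom(2)[OF p, of z] C Pts_hom(2)[OF q]
      by (auto simp: non_zeros_eq k.integral_iff)
    then have cS: "c \<in> ?S" using c by (simp add: non_zeros_eq)
    have rS: "r \<in> ?S" using nowhere_zero_at[OF c(2) q] .
    have rc: "r \<in> carrier A" using rS by blast
    have "sect (c \<otimes>\<^bsub>A\<^esub> (a \<otimes>\<^bsub>A\<^esub> t)) r = sect (c \<otimes>\<^bsub>A\<^esub> (b \<otimes>\<^bsub>A\<^esub> s)) r"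
      using z(2) c x(1) y(1) st by (simp add: pts_alg_rules C)
    from fun_cong[OF this, of q] q
    have "fraction A ?S (c \<otimes>\<^bsub>A\<^esub> (a \<otimes>\<^bsub>A\<^esub> t)) r = fraction A ?S (c \<otimes>\<^bsub>A\<^esub> (b \<otimes>\<^bsub>A\<^esub> s)) r"
      by (simp add: sect_at)
    then obtain u where u: "u \<in> ?S"
      "u \<otimes>\<^bsub>A\<^esub> (c \<otimes>\<^bsub>A\<^esub> (a \<otimes>\<^bsub>A\<^esub> t) \<otimes>\<^bsub>A\<^esub> r) = u \<otimes>\<^bsub>A\<^esub> (c \<otimes>\<^bsub>A\<^esub> (b \<otimes>\<^bsub>A\<^esub> s) \<otimes>\<^bsub>A\<^esub> r)"
      using L.frc_eq_iff[of "c \<otimes>\<^bsub>A\<^esub> (a \<otimes>\<^bsub>A\<^esub> t)" r "c \<otimes>\<^bsub>A\<^esub> (b \<otimes>\<^bsub>A\<^esub> s)" r] c x(1) y(1) st rS by auto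
    have uc: "u \<in> carrier A" using u by blast
    have "(u \<otimes>\<^bsub>A\<^esub> c \<otimes>\<^bsub>A\<^esub> r) \<otimes>\<^bsub>A\<^esub> (a \<otimes>\<^bsub>A\<^esub> t) = u \<otimes>\<^bsub>A\<^esub> (c \<otimes>\<^bsub>A\<^esub> (a \<otimes>\<^bsub>A\<^esub> t) \<otimes>\<^bsub>A\<^esub> r)"
      using uc c(1) rc x(1) st by algebra
    also have "\<dots> = (u \<otimes>\<^bsub>A\<^esub> c \<otimes>\<^bsub>A\<^esub> r) \<otimes>\<^bsub>A\<^esub> (b \<otimes>\<^bsub>A\<^esub> s)"
      unfolding u(2) using uc c(1) rc y(1) st by algebra
    finally have "(u \<otimes>\<^bsub>A\<^esub> c \<otimes>\<^bsub>A\<^esub> r) \<otimes>\<^bsub>A\<^esub> (a \<otimes>\<^bsub>A\<^esub> t) = (u \<otimes>\<^bsub>A\<^esub> c \<otimes>\<^bsub>A\<^esub> r) \<otimes>\<^bsub>A\<^esub> (b \<otimes>\<^bsub>A\<^esub> s)" .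
    moreover have "u \<otimes>\<^bsub>A\<^esub> c \<otimes>\<^bsub>A\<^esub> r \<in> ?S" using u(1) cS rS by (intro L.denominators(3))
    ultimately show "x = y"
      using x y L.frc_eq_iff by blast
  qed
  have "?h ` carrier (localization A ?S) = carrier (localization ?B ?T)"
  proof (intro equalityI subsetI)
    fix y assume "y \<in> ?h ` carrier (localization A ?S)"
    then show "y \<in> carrier (localization ?B ?T)"
      using alg_homD(2)[OF localization_map_hom[OF L.localized_algebra_axioms M.localized_algebra_axioms rho_hom \<rho>T]]
      by auto
  next
    fix y assume "y \<in> carrier (localization ?B ?T)"
    then obtain v w where vw: "v \<in> carrier ?B" "w \<in> ?T" "y = fraction ?B ?T v w" by (rule M.loc_cases)
    from vw obtain a s b t where v: "a \<in> carrier A" "s \<in> nowhere_zero" "v = sect a s"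
      and w: "b \<in> carrier A" "t \<in> nowhere_zero" "w = sect b t" by (metis DiffD1 pts_alg_cases)
    note st = nowhere_zero_carrier[OF v(2)] nowhere_zero_carrier[OF w(2)]
    have "p w \<noteq> \<zero>\<^bsub>k\<^esub>" "p w \<in> carrier k" using vw(2) B.Pts_hom(2)[OF p] by (auto simp: B.non_zeros_eq)
    then have "q b \<noteq> \<zero>\<^bsub>k\<^esub>"
      using p_sect[OF w(1,2)] w nowhere_zero_at[OF w(2) q] Pts_hom(2)[OF q]
      by (auto simp: non_zeros_eq k.integral_iff)
    then have bS: "b \<otimes>\<^bsub>A\<^esub> s \<in> ?S"
      using w nowhere_zero_at[OF v(2) q] by (intro L.denominators(3)) (simp_all add: non_zeros_eq)
    have "?h (fraction A ?S (a \<otimes>\<^bsub>A\<^esub> t) (b \<otimes>\<^bsub>A\<^esub> s)) =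
        fraction ?B ?T (sect (a \<otimes>\<^bsub>A\<^esub> t) \<one>\<^bsub>A\<^esub>) (sect (b \<otimes>\<^bsub>A\<^esub> s) \<one>\<^bsub>A\<^esub>)"
      using v w st bS by (simp add: map_frac rho_eq_sect del: Diff_iff)
    also have "\<dots> = y"
      unfolding vw(3)
    proof (rule M.frc_eqI)
      have "sect (a \<otimes>\<^bsub>A\<^esub> t \<otimes>\<^bsub>A\<^esub> b) t = sect (a \<otimes>\<^bsub>A\<^esub> (b \<otimes>\<^bsub>A\<^esub> s)) s"
        using v w st by (intro sect_eqI) (auto simp: m_ac)
      then show "sect (a \<otimes>\<^bsub>A\<^esub> t) \<one>\<^bsub>A\<^esub> \<otimes>\<^bsub>?B\<^esub> w = v \<otimes>\<^bsub>?B\<^esub> sect (b \<otimes>\<^bsub>A\<^esub> s) \<one>\<^bsub>A\<^esub>"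
        using v w st by (simp add: pts_alg_rules C)
    qed (use v w st bS sT vw C in \<open>auto simp del: Diff_iff\<close>)
    finally show "y \<in> ?h ` carrier (localization A ?S)"
      using v w st bS L.frc_closed by (metis imageI m_closed)
  qed
  with inj have "bij_betw ?h (carrier (localization A ?S)) (carrier (localization ?B ?T))"
    by (simp add: bij_betw_def)
  then have "alg_isomorphic k (localization A ?S) (localization ?B ?T)"
    using localization_map_hom[OF L.localized_algebra_axioms M.localized_algebra_axioms rho_hom \<rho>T]
    unfolding alg_isomorphic_def by blast
  then show ?thesis
    unfolding local_alg_def by (rule alg_isomorphic_sym[OF L.loc_algebra])
qed

end

section \<open>Forms without nontrivial zeros\<close>

text \<open>The homogenization \<open>b\<^sup>n P(a / b)\<close> of a polynomial \<open>P\<close> of degree \<open>n\<close>, evaluated without division.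
As for polynomials in general, the list of coefficients begins with the leading one.\<close>

fun (in ring) homogenized_eval :: "'a list \<Rightarrow> 'a \<Rightarrow> 'a \<Rightarrow> 'a"
  where
    "homogenized_eval [] a b = \<zero>"
  | "homogenized_eval (c # cs) a b = c \<otimes> a [^] length cs \<oplus> b \<otimes> homogenized_eval cs a b"

lemma (in ring) homogenized_eval_closed [simp]:
  "set cs \<subseteq> carrier R \<Longrightarrow> a \<in> carrier R \<Longrightarrow> b \<in> carrier R \<Longrightarrow> homogenized_eval cs a b \<in> carrier R"
  by (induction cs) auto

lemma (in ring_hom_ring) hom_homogenized_eval:
  assumes "set cs \<subseteq> carrier R" "a \<in> carrier R" "b \<in> carrier R"
  shows "h (R.homogenized_eval cs a b) = S.homogenized_eval (map h cs) (h a) (h b)"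
  using assms by (induction cs) (auto simp: hom_nat_pow)

text \<open>A form of positive degree has no constant term.  A list of length 1 is a constant form, and the empty
list is the zero form.\<close>

lemma (in ring) homogenized_eval_in_ideal:
  assumes I: "ideal I R" and ab: "a \<in> I" "b \<in> I" and cs: "set cs \<subseteq> carrier R" "length cs \<noteq> 1"
  shows "homogenized_eval cs a b \<in> I"
proof -
  interpret I: ideal I R by fact
  have car: "a \<in> carrier R" "b \<in> carrier R" using ab I.a_subset by auto
  have pow: "a [^] Suc n \<in> I" for n
    using ab(1) car by (auto intro: I.I_l_closed)
  show ?thesis
  proof (cases cs)
    case (Cons c ds)
    with cs(2) obtain n where n: "length ds = Suc n" by (cases ds) auto
    have "c \<otimes> a [^] length ds \<in> I"
      unfolding n using cs Cons pow by (intro I.I_l_closed) auto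
    moreover have "b \<otimes> homogenized_eval ds a b \<in> I"
      using cs Cons ab car by (intro I.I_r_closed) auto
    ultimately show ?thesis using Cons by (auto intro: I.a_closed)
  qed (simp add: I.zero_closed)
qed

lemma (in field) homogenized_eval_eq:
  assumes "set cs \<subseteq> carrier R" "t \<in> carrier R" "b \<in> carrier R"
  shows "homogenized_eval cs (t \<otimes> b) b \<otimes> b = b [^] length cs \<otimes> eval cs t"
  using assms(1)
proof (induction cs)
  case Nil
  then show ?case using assms by simp
next
  case (Cons c cs)
  let ?n = "length cs" and ?h = "homogenized_eval cs (t \<otimes> b) b"
  have car: "c \<in> carrier R" "?h \<in> carrier R" "eval cs t \<in> carrier R"
    "t [^] ?n \<in> carrier R" "b [^] ?n \<in> carrier R"
    using Cons.prems assms eval_in_carrier by auto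
  have "homogenized_eval (c # cs) (t \<otimes> b) b \<otimes> b = c \<otimes> (t [^] ?n \<otimes> b [^] ?n) \<otimes> b \<oplus> b \<otimes> (?h \<otimes> b)"
    using car assms by (simp add: nat_pow_distrib l_distr m_assoc)
  also have "\<dots> = c \<otimes> (t [^] ?n \<otimes> b [^] ?n) \<otimes> b \<oplus> b \<otimes> (b [^] ?n \<otimes> eval cs t)"
    using Cons by simp
  also have "\<dots> = (b [^] ?n \<otimes> b) \<otimes> (c \<otimes> t [^] ?n \<oplus> eval cs t)"
    using car assms by algebra
  finally show ?case by simp
qed

lemma (in field) homogenized_eval_eq_zero:
  assumes c: "c \<in> carrier R" "c \<noteq> \<zero>" "set cs \<subseteq> carrier R" "cs \<noteq> []"
    and no_root: "\<And>t. t \<in> carrier R \<Longrightarrow> eval (c # cs) t \<noteq> \<zero>"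
    and ab: "a \<in> carrier R" "b \<in> carrier R" "homogenized_eval (c # cs) a b = \<zero>"
  shows "a = \<zero> \<and> b = \<zero>"
proof (cases "b = \<zero>")
  case True
  then have "c \<otimes> a [^] length cs = \<zero>" using ab c by simp
  then have "a [^] length cs = \<zero>" using c ab integral_iff by auto
  then have "a \<notin> Units R"
    using Units_pow_closed[of a "length cs"] field_Units by auto
  then show ?thesis using True ab(1) field_Units by blast
next
  case False
  then have b: "b \<in> Units R" using ab field_Units by auto
  define t where "t = a \<otimes> inv b"
  have t: "t \<in> carrier R" "t \<otimes> b = a" using b ab by (auto simp: t_def m_assoc)
  from homogenized_eval_eq[of "c # cs" t b] c t ab
  have "b [^] length (c # cs) \<otimes> eval (c # cs) t = \<zero>" by (auto simp del: nat_pow_Suc)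
  moreover have "b [^] length (c # cs) \<noteq> \<zero>"
    using b ab Units_pow_closed[of b] field_Units by blast
  moreover have "eval (c # cs) t \<in> carrier R" using c t by (intro eval_in_carrier) auto
  ultimately have "eval (c # cs) t = \<zero>" using integral_iff ab by blast
  with no_root t show ?thesis by blast
qed

section \<open>Points on prime ideals\<close>

lemma finite_extension_Cons:
  "ring R \<Longrightarrow> ring.finite_extension R K (x # xs) = ring.simple_extension R (ring.finite_extension R K xs) x"
  by (simp add: ring.finite_extension.simps)

lemma image_finite_extension:
  assumes "ring_hom_ring R S h" "cring R" "cring S" "subring K R" "set xs \<subseteq> carrier R"
  shows "h ` ring.finite_extension R K xs = ring.finite_extension S (h ` K) (map h xs)"
  using assms(5)
proof (induction xs)
  case Nil
  have "ring R" "ring S" using assms(2,3) cring.axioms(1) by auto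
  then show ?case by (simp add: ring.finite_extension.simps)
next
  case (Cons x xs)
  have r: "ring R" "ring S" using assms(2,3) cring.axioms(1) by auto
  have "subring (ring.finite_extension R K xs) R"
    using cring.finite_extension_subring[OF assms(2,4)] Cons.prems by auto
  from image_simple_extension[OF assms(1-3) this] Cons
  show ?case by (simp add: finite_extension_Cons r del: ring.finite_extension.simps)
qed

context algebra_over_field
begin

abbreviation scalar :: "'k \<Rightarrow> 'a" where "scalar c \<equiv> c \<odot>\<^bsub>A\<^esub> \<one>\<^bsub>A\<^esub>"

lemma scalar_hom: "ring_hom_ring k A scalar"
proof (rule ring_hom_ringI)
  fix c d assume cd: "c \<in> carrier k" "d \<in> carrier k"
  have "scalar c \<otimes>\<^bsub>A\<^esub> scalar d = c \<odot>\<^bsub>A\<^esub> (\<one>\<^bsub>A\<^esub> \<otimes>\<^bsub>A\<^esub> scalar d)" using cd by (intro smult_assoc2) auto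
  then show "scalar (c \<otimes>\<^bsub>k\<^esub> d) = scalar c \<otimes>\<^bsub>A\<^esub> scalar d" using cd by (simp add: smult_assoc1)
qed (auto simp: smult_l_distr k.ring_axioms ring_axioms)

lemma scalars_subring: "subring (scalar ` carrier k) A"
  using ring_hom_ring.img_is_subring[OF scalar_hom k.carrier_is_subring] .

lemma smult_eq_scalar: "c \<in> carrier k \<Longrightarrow> x \<in> carrier A \<Longrightarrow> c \<odot>\<^bsub>A\<^esub> x = scalar c \<otimes>\<^bsub>A\<^esub> x"
  by (simp add: smult_assoc2)

lemma Pts_scalar: "p \<in> Pts k A \<Longrightarrow> c \<in> carrier k \<Longrightarrow> p (scalar c) = c"
  by (simp add: Pts_hom)

lemma finitely_generated_eq_finite_extension:
  assumes "finitely_generated_alg k A"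
  obtains xs where "set xs \<subseteq> carrier A" "finite_extension (scalar ` carrier k) xs = carrier A"
proof -
  from assms obtain G where G: "finite G" "G \<subseteq> carrier A" "generated_subalg k A G = carrier A"
    by (auto simp: finitely_generated_alg_def)
  from finite_list[OF G(1)] obtain xs where xs: "set xs = G" by blast
  let ?E = "finite_extension (scalar ` carrier k) xs"
  have sub: "subring ?E A"
    using finite_extension_subring[OF scalars_subring] xs G(2) by simp
  have incl: "scalar ` carrier k \<union> G \<subseteq> ?E"
    using finite_extension_subset[OF scalars_subring, of xs] xs G(2) by simp
  have "subalg k A ?E"
    unfolding subalg_def
  proof (intro conjI ballI sub)
    fix c x assume "c \<in> carrier k" "x \<in> ?E"
    then have "x \<in> carrier A" "scalar c \<in> ?E" using incl subringE(1)[OF sub] by blast+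
    then show "c \<odot>\<^bsub>A\<^esub> x \<in> ?E"
      using smult_eq_scalar[OF \<open>c \<in> carrier k\<close>, of x] subringE(6)[OF sub _ \<open>x \<in> ?E\<close>] by presburger
  qed
  then have "carrier A \<subseteq> ?E"
    using incl unfolding G(3)[symmetric] generated_subalg_def by blast
  then have "?E = carrier A" using subringE(1)[OF sub] by blast
  with that xs G(2) show thesis by blast
qed

lemma noetherian_scalars: "noetherian_ring (A\<lparr>carrier := scalar ` carrier k\<rparr>)"
proof -
  let ?K = "scalar ` carrier k"
  let ?R = "A\<lparr>carrier := ?K\<rparr>"
  note ideal_iff = ideal_subring_iff[OF scalars_subring]
  have "\<exists>G. finite G \<and> G \<subseteq> I \<and> (\<forall>J. ideal J ?R \<and> G \<subseteq> J \<longrightarrow> I \<subseteq> J)" if I: "ideal I ?R" for I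
  proof (cases "I \<subseteq> {\<zero>\<^bsub>A\<^esub>}")
    case True
    then show ?thesis by (intro exI[of _ "{}"]) (auto simp: ideal_iff)
  next
    case False
    then obtain c where c: "c \<in> carrier k" "scalar c \<in> I" "scalar c \<noteq> \<zero>\<^bsub>A\<^esub>"
      using I[unfolded ideal_iff] by blast
    then have "c \<noteq> \<zero>\<^bsub>k\<^esub>" by auto
    with c(1) have cU: "c \<in> Units k" by (simp add: k.field_Units)
    have "I \<subseteq> J" if J: "ideal J ?R" "{scalar c} \<subseteq> J" for J
    proof
      fix x assume "x \<in> I"
      then obtain d where d: "d \<in> carrier k" "x = scalar d" using I[unfolded ideal_iff] by blast
      let ?e = "d \<otimes>\<^bsub>k\<^esub> inv\<^bsub>k\<^esub> c"
      have e: "?e \<in> carrier k" using d cU by simp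
      have "scalar ?e \<otimes>\<^bsub>A\<^esub> scalar c = scalar (?e \<otimes>\<^bsub>k\<^esub> c)"
        using e c by (simp add: ring_hom_ring.homh[OF scalar_hom] ring_hom_mult[OF ring_hom_ring.homh[OF scalar_hom]])
      also have "\<dots> = x" using d cU c by (simp add: k.m_assoc)
      finally have "x = scalar ?e \<otimes>\<^bsub>A\<^esub> scalar c" ..
      moreover have "scalar ?e \<in> ?K" using e by blast
      ultimately show "x \<in> J" using J[unfolded ideal_iff] by blast
    qed
    with c show ?thesis by (intro exI[of _ "{scalar c}"]) simp
  qed
  then show ?thesis
    using ring.noetherian_ring_iff_finite_test_set[OF subring_is_ring[OF scalars_subring]] by blast
qed

lemma noetherian_finitely_generated:
  assumes "finitely_generated_alg k A"
  shows "noetherian_ring A"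
proof -
  obtain xs where xs: "set xs \<subseteq> carrier A" "finite_extension (scalar ` carrier k) xs = carrier A"
    using assms by (rule finitely_generated_eq_finite_extension)
  from xs(1) have "noetherian_ring (A\<lparr>carrier := finite_extension (scalar ` carrier k) xs\<rparr>)"
  proof (induction xs)
    case Nil
    then show ?case using noetherian_scalars by simp
  next
    case (Cons x xs)
    then show ?case
      using hilbert_basis[OF finite_extension_subring[OF scalars_subring, of xs], of x] by simp
  qed
  moreover have "A\<lparr>carrier := carrier A\<rparr> = A" by simp
  ultimately show ?thesis using xs(2) by simp
qed

text \<open>Repeated application of the homogenization of a polynomial without roots in \<open>k\<close>.\<close>

lemma common_zeros_by_one_element:
  assumes not_closed: "\<not> algebraically_closed k" and I: "ideal I A"
    and G: "finite G" "G \<subseteq> I"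
  shows "\<exists>f \<in> I. \<forall>p \<in> Pts k A. p f = \<zero>\<^bsub>k\<^esub> \<longrightarrow> (\<forall>g \<in> G. p g = \<zero>\<^bsub>k\<^esub>)"
proof -
  interpret I: ideal I A by fact
  obtain c cs where c: "c \<in> carrier k" "c \<noteq> \<zero>\<^bsub>k\<^esub>" "set cs \<subseteq> carrier k" "cs \<noteq> []"
    and no_root: "\<And>t. t \<in> carrier k \<Longrightarrow> k.eval (c # cs) t \<noteq> \<zero>\<^bsub>k\<^esub>"
  proof -
    from not_closed k.algebraically_closedI obtain p where
      p: "p \<in> carrier (poly_ring k)" "length p - 1 > 1" "\<not> (\<exists>x \<in> carrier k. k.eval p x = \<zero>\<^bsub>k\<^esub>)"
      by blast
    then obtain c cs where cs: "p = c # cs" by (cases p) auto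
    show thesis
      by (rule that[of c cs]) (use p cs in \<open>auto simp: univ_poly_def polynomial_def\<close>)
  qed
  have sc: "set (map scalar (c # cs)) \<subseteq> carrier A" using c by auto
  let ?N = "homogenized_eval (map scalar (c # cs))"
  have N: "p (?N f g) = \<zero>\<^bsub>k\<^esub> \<Longrightarrow> p f = \<zero>\<^bsub>k\<^esub> \<and> p g = \<zero>\<^bsub>k\<^esub>"
    if p: "p \<in> Pts k A" and fg: "f \<in> carrier A" "g \<in> carrier A" for p f g
  proof -
    interpret p: ring_hom_ring A k p
      using ring_hom_ringI2[OF ring_axioms k.ring_axioms Pts_hom(1)[OF p]] .
    have "map p (map scalar (c # cs)) = c # cs"
      using c Pts_scalar[OF p] by (auto simp: map_idI subset_eq)
    then have "p (?N f g) = k.homogenized_eval (c # cs) (p f) (p g)"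
      using p.hom_homogenized_eval[OF sc fg] by simp
    then show "p (?N f g) = \<zero>\<^bsub>k\<^esub> \<Longrightarrow> p f = \<zero>\<^bsub>k\<^esub> \<and> p g = \<zero>\<^bsub>k\<^esub>"
      using k.homogenized_eval_eq_zero[OF c no_root p.hom_closed[OF fg(1)] p.hom_closed[OF fg(2)]]
      by metis
  qed
  from G show ?thesis
  proof (induction G)
    case empty
    then show ?case using I.zero_closed by blast
  next
    case (insert g G)
    then obtain f where f: "f \<in> I" "\<And>p. p \<in> Pts k A \<Longrightarrow> p f = \<zero>\<^bsub>k\<^esub> \<Longrightarrow> \<forall>g \<in> G. p g = \<zero>\<^bsub>k\<^esub>" by auto
    have car: "f \<in> carrier A" "g \<in> carrier A" using f(1) insert.prems I.a_subset by auto
    have "?N f g \<in> I"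
      using f(1) insert.prems sc c(4) by (intro homogenized_eval_in_ideal[OF I]) auto
    moreover have "\<forall>h \<in> insert g G. p h = \<zero>\<^bsub>k\<^esub>" if p: "p \<in> Pts k A" "p (?N f g) = \<zero>\<^bsub>k\<^esub>" for p
      using N[OF p(1) car p(2)] f(2)[OF p(1)] by simp
    ultimately show ?case by blast
  qed
qed

text \<open>A point that kills \<open>J\<close> is a homomorphism from the domain \<open>A / J\<close> to \<open>k\<close> that is the identity on
scalars.  It is obtained by extending the identity of \<open>k\<close>, viewed as a homomorphism on the scalars in
\<open>A / J\<close>, generator by generator.\<close>

lemma nullstellensatz:
  assumes closed: "algebraically_closed k" and fg: "finitely_generated_alg k A"
    and J: "primeideal J A"
  shows "\<exists>p \<in> Pts k A. J \<subseteq> pt_ideal k A p"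
proof -
  interpret J: primeideal J A by fact
  let ?D = "A Quot J"
  let ?P = "RDirProd ?D k"
  interpret D: domain ?D by (rule J.quotient_is_domain)
  interpret P: cring ?P by (intro RDirProd_cring D.cring_axioms R_cring)
  define \<pi> where "\<pi> = (\<lambda>a. J +>\<^bsub>A\<^esub> a)"
  interpret \<pi>: ring_hom_ring A ?D \<pi> unfolding \<pi>_def by (rule J.rcos_ring_hom_ring)
  interpret scalar: ring_hom_ring k A scalar by (rule scalar_hom)
  have \<pi>_onto: "\<pi> ` carrier A = carrier ?D"
    by (auto simp: \<pi>_def FactRing_def A_RCOSETS_def')
  have \<pi>_zero: "\<pi> a = \<zero>\<^bsub>?D\<^esub> \<longleftrightarrow> a \<in> J" if "a \<in> carrier A" for a
    using that J.a_rcos_const J.a_rcos_self[of a] by (auto simp: \<pi>_def FactRing_def)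
  let ?K = "\<pi> ` scalar ` carrier k"
  have K: "subring ?K ?D" by (rule \<pi>.img_is_subring[OF scalars_subring])
  obtain xs where xs: "set xs \<subseteq> carrier A" "finite_extension (scalar ` carrier k) xs = carrier A"
    using fg by (rule finitely_generated_eq_finite_extension)
  have ext: "D.finite_extension ?K (map \<pi> xs) = carrier ?D"
    using image_finite_extension[OF \<pi>.ring_hom_ring_axioms M_cring D.cring_axioms scalars_subring xs(1)]
      xs(2) \<pi>_onto by simp
  have "set (map \<pi> xs) \<subseteq> carrier ?D" using xs(1) by auto
  from extend_partial_hom_finite[OF D.domain_axioms closed K this, unfolded ext, of "\<one>\<^bsub>?D\<^esub>"]
  obtain r where r: "r \<noteq> \<zero>\<^bsub>?D\<^esub>"
    "\<forall>G. partial_hom ?D k G \<and> fst ` G = ?K \<and> (r, \<zero>\<^bsub>k\<^esub>) \<notin> G \<longrightarrow>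
      (\<exists>G'. partial_hom ?D k G' \<and> G \<subseteq> G' \<and> fst ` G' = carrier ?D \<and> (\<one>\<^bsub>?D\<^esub>, \<zero>\<^bsub>k\<^esub>) \<notin> G')"
    using D.one_closed D.one_not_zero by blast
  define \<gamma> where "\<gamma> c = (\<pi> (scalar c), c)" for c
  have \<gamma>: "ring_hom_ring k ?P \<gamma>"
    by (rule ring_hom_ringI)
      (auto simp: \<gamma>_def RDirProd_carrier RDirProd_simps k.ring_axioms P.ring_axioms
        simp del: smult_one)
  have const_inj: "c = \<zero>\<^bsub>k\<^esub>" if c: "c \<in> carrier k" "\<pi> (scalar c) = \<zero>\<^bsub>?D\<^esub>" for c
  proof (rule ccontr)
    assume "c \<noteq> \<zero>\<^bsub>k\<^esub>"
    then have cU: "c \<in> Units k" using c k.field_Units by auto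
    have "scalar (inv\<^bsub>k\<^esub> c \<otimes>\<^bsub>k\<^esub> c) = scalar (inv\<^bsub>k\<^esub> c) \<otimes>\<^bsub>A\<^esub> scalar c"
      using cU c(1) by (intro scalar.hom_mult) auto
    also have "\<dots> \<in> J" using c cU \<pi>_zero by (intro J.I_l_closed) auto
    finally have "\<one>\<^bsub>A\<^esub> \<in> J" using cU by simp
    then show False using J.one_imp_carrier J.I_notcarr by auto
  qed
  have "partial_hom ?D k (\<gamma> ` carrier k)"
    unfolding partial_hom_def
    using ring_hom_ring.img_is_subring[OF \<gamma> k.carrier_is_subring] const_inj
    by (auto simp: \<gamma>_def)
  moreover have "fst ` \<gamma> ` carrier k = ?K" by (auto simp: \<gamma>_def image_image)
  moreover have "(r, \<zero>\<^bsub>k\<^esub>) \<notin> \<gamma> ` carrier k" using r(1) by (auto simp: \<gamma>_def)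
  ultimately obtain G where G: "partial_hom ?D k G" "\<gamma> ` carrier k \<subseteq> G" "fst ` G = carrier ?D"
    using r(2) by metis
  have sG: "subring G ?P" using G(1) by (simp add: partial_hom_def)
  define p where "p = (\<lambda>a \<in> carrier A. THE c. (\<pi> a, c) \<in> G)"
  have p_unique: "p a = c" if "a \<in> carrier A" "(\<pi> a, c) \<in> G" for a c
    using that partial_homD[OF D.cring_axioms R_cring G(1)] by (auto simp: p_def)
  have p_mem: "(\<pi> a, p a) \<in> G" if a: "a \<in> carrier A" for a
  proof -
    have "\<pi> a \<in> fst ` G" using a G(3) by auto
    then obtain c where "(\<pi> a, c) \<in> G" by force
    with p_unique[OF a this] show ?thesis by simp
  qed
  have "p \<in> Pts k A"
  proof (rule PtsI)
    show pC: "p x \<in> carrier k" if "x \<in> carrier A" for x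
      using subringE(1)[OF sG] p_mem[OF that] by (auto simp: RDirProd_carrier)
    show pM: "p (x \<otimes>\<^bsub>A\<^esub> y) = p x \<otimes>\<^bsub>k\<^esub> p y" if "x \<in> carrier A" "y \<in> carrier A" for x y
      using subringE(6)[OF sG p_mem p_mem, OF that] that
      by (intro p_unique) (auto simp: RDirProd_simps)
    show "p (x \<oplus>\<^bsub>A\<^esub> y) = p x \<oplus>\<^bsub>k\<^esub> p y" if "x \<in> carrier A" "y \<in> carrier A" for x y
      using subringE(7)[OF sG p_mem p_mem, OF that] that
      by (intro p_unique) (auto simp: RDirProd_simps)
    have pS: "p (scalar c) = c" if "c \<in> carrier k" for c
      using G(2) that by (intro p_unique) (auto simp: \<gamma>_def)
    show "p \<one>\<^bsub>A\<^esub> = \<one>\<^bsub>k\<^esub>" using pS[of "\<one>\<^bsub>k\<^esub>"] by simp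
    show "p (c \<odot>\<^bsub>A\<^esub> x) = c \<otimes>\<^bsub>k\<^esub> p x" if "c \<in> carrier k" "x \<in> carrier A" for c x
      using that pM[of "scalar c" x] pS smult_eq_scalar[of c x] by simp
  qed (simp add: p_def)
  moreover have "p a = \<zero>\<^bsub>k\<^esub>" if "a \<in> J" for a
    using that G(1) p_mem[of a] \<pi>_zero[of a] J.a_subset unfolding partial_hom_def by auto
  ultimately show ?thesis using J.a_subset by (intro bexI[of _ p]) (auto simp: pt_ideal_eq)
qed

text \<open>An ideal that is contained in the kernel of a point contains no nowhere zero elements; this is the
converse for prime ideals.\<close>

theorem point_on_prime:
  assumes fg: "finitely_generated_alg k A" and J: "primeideal J A" and "J \<inter> nowhere_zero = {}"
  shows "\<exists>p \<in> Pts k A. J \<subseteq> pt_ideal k A p"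
proof (cases "algebraically_closed k")
  case True
  then show ?thesis using nullstellensatz fg J by blast
next
  case False
  have I: "ideal J A" using J primeideal.axioms(1) by blast
  from noetherian_finitely_generated[OF fg] I obtain G where
    G: "finite G" "G \<subseteq> J" "\<And>I. ideal I A \<Longrightarrow> G \<subseteq> I \<Longrightarrow> J \<subseteq> I"
    unfolding noetherian_ring_iff_finite_test_set by metis
  from common_zeros_by_one_element[OF False I G(1,2)] obtain f where
    f: "f \<in> J" "\<And>p. p \<in> Pts k A \<Longrightarrow> p f = \<zero>\<^bsub>k\<^esub> \<Longrightarrow> \<forall>g \<in> G. p g = \<zero>\<^bsub>k\<^esub>" by blast
  have "J \<subseteq> carrier A" using additive_subgroup.a_subset[OF ideal.axioms(1)[OF I]] .
  then obtain p where p: "p \<in> Pts k A" "p f = \<zero>\<^bsub>k\<^esub>"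
    using f(1) assms(3) by (auto simp: nowhere_zero_def)
  have "G \<subseteq> pt_ideal k A p"
    using f(2)[OF p] G(2) \<open>J \<subseteq> carrier A\<close> by (auto simp: pt_ideal_eq)
  from G(3)[OF pt_ideal_ideal[OF p(1)] this] p show ?thesis by blast
qed

section \<open>Maximal ideals of the algebra of global sections\<close>

theorem maximal_ideal_of_pts_alg:
  assumes fg: "finitely_generated_alg k A" and m: "maximalideal m (pts_alg k A)"
  shows "\<exists>p \<in> Pts k (pts_alg k A). m = pt_ideal k (pts_alg k A) p"
proof -
  let ?B = "pts_alg k A" and ?\<rho> = "rho k A (Pts k A)"
  interpret B: algebra_over_field k ?B
    by (intro algebra_over_field.intro k.field_axioms pts_alg_algebra)
  have m_ideal: "ideal m ?B" and m_prime: "primeideal m ?B"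
    using m B.maximalideal_prime maximalideal.axioms(1) by blast+
  note m_closed' = ideal.I_r_closed[OF m_ideal] and m_subset = ideal.Icarr[OF m_ideal]
  interpret \<rho>: ring_hom_ring A ?B ?\<rho>
    using ring_hom_ringI2[OF ring_axioms B.ring_axioms alg_homD(1)[OF rho_hom]] .
  note C = nowhere_zero_one nowhere_zero_mult nowhere_zero_carrier pts_alg_sect_closed
  define J where "J = {a \<in> carrier A. ?\<rho> a \<in> m}"
  have one_notin: "\<one>\<^bsub>?B\<^esub> \<notin> m" 
    using ideal.one_imp_carrier[OF m_ideal] maximalideal.I_notcarr[OF m] by auto
  have "ideal J A"
    unfolding J_def by (rule \<rho>.ideal_vimage) (rule m_ideal)
  then have J: "primeideal J A"
  proof (rule primeidealI[OF _ M_cring])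
    have "\<one>\<^bsub>A\<^esub> \<notin> J" using one_notin by (simp add: J_def)
    then show "carrier A \<noteq> J" using one_closed by blast
    show "a \<in> J \<or> b \<in> J" if "a \<in> carrier A" "b \<in> carrier A" "a \<otimes>\<^bsub>A\<^esub> b \<in> J" for a b
      using that primeideal.I_prime[OF m_prime, of "?\<rho> a" "?\<rho> b"] by (auto simp: J_def)
  qed
  moreover have "J \<inter> nowhere_zero = {}"
  proof (rule ccontr)
    assume "J \<inter> nowhere_zero \<noteq> {}"
    then obtain s where s: "s \<in> nowhere_zero" "sect s \<one>\<^bsub>A\<^esub> \<in> m" by (auto simp: J_def rho_eq_sect)
    then have "sect s \<one>\<^bsub>A\<^esub> \<otimes>\<^bsub>?B\<^esub> sect \<one>\<^bsub>A\<^esub> s \<in> m" by (intro m_closed') (auto simp: C)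
    with s one_notin show False by (simp add: pts_alg_rules)
  qed
  ultimately obtain q where q: "q \<in> Pts k A" "J \<subseteq> pt_ideal k A q"
    using point_on_prime[OF fg] by blast
  let ?p = "point_value q"
  have p: "?p \<in> Pts k ?B" by (rule point_value_Pts[OF q(1)])
  have "m \<subseteq> pt_ideal k ?B ?p"
  proof
    fix x assume x: "x \<in> m"
    then have xB: "x \<in> carrier ?B" using m_subset by blast
    then obtain a s where as: "a \<in> carrier A" "s \<in> nowhere_zero" "x = sect a s" by (rule pts_alg_cases)
    have "x \<otimes>\<^bsub>?B\<^esub> sect s \<one>\<^bsub>A\<^esub> \<in> m" using x as by (intro m_closed') (auto simp: C)
    moreover have "x \<otimes>\<^bsub>?B\<^esub> sect s \<one>\<^bsub>A\<^esub> = ?\<rho> a"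
      using as by (simp add: rho_eq_sect pts_alg_rules C) (rule sect_eqI, auto simp: C m_ac)
    ultimately have "a \<in> J" using as by (simp add: J_def)
    then have "q a = \<zero>\<^bsub>k\<^esub>" using q(2) by (auto simp: pt_ideal_eq)
    then have "?p x = \<zero>\<^bsub>k\<^esub>"
      using as point_inv[OF q(1) nowhere_zero_at[OF as(2) q(1)]] by (simp add: point_value_sect[OF q(1)])
    with xB show "x \<in> pt_ideal k ?B ?p" by (simp add: B.pt_ideal_eq)
  qed
  moreover note p_max = B.pt_ideal_maximal[OF p]
  ultimately have "m = pt_ideal k ?B ?p"
    using maximalideal.I_maximal[OF m maximalideal.axioms(1)[OF p_max]] maximalideal.I_notcarr[OF p_max]
    by (auto simp: B.pt_ideal_eq)
  with p show ?thesis by blast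
qed

end

theorem lemma2:
  fixes k :: "('k, 'm) ring_scheme" and A :: "('k, 'a, 'n) module_scheme"
  assumes "field k" and "algebra k A" and "finitely_generated_alg k A"
  shows "bij_betw (pt_ideal k (pts_alg k A)) (Pts k (pts_alg k A)) (Max_ideals (pts_alg k A)) \<and>
         (\<forall>p \<in> Pts k (pts_alg k A).
           compose (carrier A) p (rho k A (Pts k A)) \<in> Pts k A \<and>
           alg_isomorphic k (local_alg k (pts_alg k A) p)
             (local_alg k A (compose (carrier A) p (rho k A (Pts k A))))) \<and>
         global_sections k A = str_sheaf k A (Pts k A) \<and>
         alg_isomorphic k (str_sheaf k A (Pts k A)) (pts_alg k A)"
proof -
  interpret A: algebra_over_field k A
    by (intro algebra_over_field.intro assms)
  interpret B: algebra_over_field k "pts_alg k A"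
    by (intro algebra_over_field.intro assms A.pts_alg_algebra)
  have "bij_betw (pt_ideal k (pts_alg k A)) (Pts k (pts_alg k A)) (Max_ideals (pts_alg k A))"
    unfolding bij_betw_def Max_ideals_def
    using B.pt_ideal_inj B.pt_ideal_maximal A.maximal_ideal_of_pts_alg[OF assms(3)] by blast
  moreover have "str_sheaf k A (Pts k A) = pts_alg k A" by (simp add: pts_alg_def)
  ultimately show ?thesis
    using A.compose_rho_Pts A.local_iso A.global_sections_eq alg_isomorphic_refl by simp
qed

end
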